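(* Let $\Gamma<\operatorname{SO}(d+1,1)^\circ$ be Zariski dense, torsion-free, geometrically finite with parabolic elements, with $\infty$ a parabolic fixed point, and let $\Delta_0$ be the fundamental region for $\infty$, $T$ the expanding map on a full-measure subset of $\Delta_0$, $\mathcal H$ its set of inverse branches and $C_1,\lambda$ the constants of the specific coding described in the context. This coding satisfies the following uniform nonintegrability condition (UNI). There exist $r>0$ and $\epsilon_0>0$ such that for any $C>1$ the following holds for any large $n_0$. There exist $j_0\in\mathbb{N}$ and $\{\gamma_{mj}:1\le m\le 2,\ 1\le j\le j_0\}$ in $\mathcal{H}^{n_0}$ such that for any $x\in\Lambda_\Gamma\cap\overline{\Delta_0}$ and any unit vector $e\in\mathbb{R}^d$ there exists $j\le j_0$ such that for all $y\in B(x,r)$ $$|\partial_e(\tau_{1j}-\tau_{2j})(y)|\ge\epsilon_0,$$ where $\tau_{mj}(x)=R_{n_0}(\gamma_{mj}x)=-\log|\gamma_{mj}'(x)|$. Moreover, for all $m,j$, $$|\mathrm{D}\tau_{mj}|_\infty\le C_2,\qquad |\gamma_{mj}'|_\infty\le\epsilon_0/C,$$ where $C_2=C_1/(1-\lambda)$.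
   Context: Basic notation. Upper half-space model of $\mathbb H^{d+1}$, $G=\operatorname{SO}(d+1,1)^\circ$, $\partial\mathbb{H}^{d+1}=\mathbb{R}^d\cup\{\infty\}$; $|g'(x)|$ is the Euclidean linear distortion of the conformal action of $g$ on the boundary; $B(x,r)$ is the Euclidean ball; $\Lambda_\Gamma$ is the limit set, $\delta$ the critical exponent, $\mu$ the Patterson-Sullivan measure based at $o=(0,\dots,0,1)$ (from the $\Gamma$-invariant conformal density of dimension $\delta$ on $\Lambda_\Gamma$). Geometrically finite: every limit point is conical or bounded parabolic. $|\cdot|_\infty$ is the supremum over $\Delta_0$, $\partial_e$ the directional derivative. Fundamental regions. If $\infty$ is a parabolic fixed point of a geometrically finite group $\Gamma'$, then by Bieberbach there are a finite-index maximal normal abelian subgroup $\Gamma'_\infty$ of $\mathrm{Stab}_{\Gamma'}(\infty)$ and a $\mathrm{Stab}_{\Gamma'}(\infty)$-invariant affine subspace $Z\subset\mathbb{R}^d$ of dimension $k$ on which $\Gamma'_\infty$ acts by translations with rank $k$; write $\mathbb{R}^d=Y\times Z$ orthogonally and $B_Y(s)=\{y\in Y:|y|<s\}$. A fundamental region for $\infty$ is $B_Y(C')\times\Delta'$ with $\Delta'\subset Z$ an open parallelotope that is a fundamental region of $\Gamma'_\infty$ on $Z$ and $C'$ such that $\Lambda_{\Gamma'}\subset\{\infty\}\cup\bigcup_{\gamma\in\Gamma'_\infty}\gamma(\overline{B_Y(C'/2)\times\Delta'})$. Cusps. Let $\mathcal P$ be the set of parabolic fixed points of $\Gamma$ and $p_1=\infty,p_2,\dots,p_q$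 a complete set of $\Gamma$-inequivalent ones. Fix a $\Gamma$-equivariant family of pairwise disjoint horoballs $H_p$ based at $p\in\mathcal P$, normalized so that $H_\infty=\{x_{d+1}>1\}$. Fix $g_i\in G$ with $g_ip_i=\infty$, $g_iH_{p_i}=H_\infty$, $g_1=\mathrm{id}$, and put $\Gamma_i=g_i\Gamma g_i^{-1}$, $\Gamma_{p_i}=g_i^{-1}(\Gamma_i)_\infty g_i$. Let $\Delta_{p_i}=g_i^{-1}\Delta_{p_i}'$, where $\Delta_{p_i}'$ is a fundamental region for $\infty$ for the group $\Gamma_i$, chosen so that the $\Delta_{p_i}$ are disjoint and $\{p_1,\dots,p_q\}\cap\bigcup_k\overline{\Delta_{p_k}}=\emptyset$; $\Delta_0=\Delta_{p_1}$. For a horoball $H$ not based at $\infty$, $h(H)$ is the supremum of the last coordinate on $H$. Flowers. Let $\eta\in(0,1)$ be a fixed, sufficiently small constant (depending on $\Gamma$). For $p\in\mathcal P$ write $p=\gamma p_i$, with $\gamma\in\Gamma$ a fixed choice such that $\gamma^{-1}p_i\in\overline{\Delta_{p_i}}$. With $Y,Z$ and the parallelotope $\Delta'\subset Z$ attached to $\Gamma_i$, let $R_p\subset Z$ be the smallest parallelotope tiled by $(\Gamma_i)_\infty$-translates of $\overline{\Delta'}$ such that $B_Y(2/\eta)\times R_p\supset B(g_i\gamma^{-1}p_i,1/\eta)$. Set $J_p=\gamma g_i^{-1}\big((B_Y(2/\eta)\times R_p)^c\big)$ and $N_p=\{\gamma_1\in\Gamma_{p_i}:\gamma\gamma_1\Delta_{p_i}\subset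 J_p\}$. The coding. For each $l\in\{1,\dots,q\}$ put $h_n=e^{-n}$, $\Omega^{(l)}_0=g_l\Delta_{p_l}$ and inductively $P^{(l)}_{n+1}=\{p\in\mathcal P:\eta\, h(g_lH_p)\in(h_{n+1},h_n],\ B(g_lp,h_n/(4\eta))\subset\Omega^{(l)}_n\}$, $\Omega^{(l)}_{n+1}=\Omega^{(l)}_n-\bigcup_{p\in P^{(l)}_{n+1}}g_lJ_p$. The map $T_0$ is defined on the disjoint union, over all $l$, $n\geq 1$, $p=\gamma p_i\in P^{(l)}_n$ and $\gamma_1\in N_p$, of the open sets $\gamma\gamma_1\Delta_{p_i}\subset\Delta_{p_l}$, by $T_0=(\gamma\gamma_1)^{-1}$ on $\gamma\gamma_1\Delta_{p_i}$. It is assumed, without loss of generality, that $T_0$ is irreducible (no nonempty proper subfamily of the $\Delta_{p_i}$ has union mapped into itself by $T_0$). $T$ is the first return map of $T_0$ to $\Delta_0$: $T(x)=T_0^{n(x)}(x)$, $n(x)=\inf\{n\ge1:T_0^n(x)\in\Delta_0\}$, where $n(x)<\infty$ (with only one cusp, $T=T_0$). The domain of $T$ is a countable disjoint union of open sets $\Delta_j=\gamma_j\Delta_0\subset\Delta_0$ with $\gamma_j\in\Gamma$ and $T|_{\Delta_j}=\gamma_j^{-1}$. It is known that there are constants $C_1>0$, $\lambda,\epsilon_o\in(0,1)$ with: $\sum_j\mu(\Delta_j)=\mu(\Delta_0)$; $|\gamma_j'(x)|\le\lambda$ and $|\mathrm{D}(\log|\gamma_j'|)(x)|<C_1$ for all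 $x\in\Delta_0$ and all $j$; and $\int e^{\epsilon_oR}\,\mathrm{d}\mu<\infty$ for $R(x)=\log|\mathrm{D}T(x)|$ on $\sqcup_j\Delta_j$. Put $\mathcal{H}=\{\gamma_j\}$, $\mathcal{H}^n=\{\gamma_{j_1}\cdots\gamma_{j_n}:\gamma_{j_k}\in\mathcal{H}\}$, and $R_n=\sum_{0\le k\le n-1}R\circ T^k$ where defined; for $\gamma\in\mathcal{H}^n$, $R_n(\gamma x)=-\log|\gamma'(x)|$. *)

theory Defs
  imports "HOL-Analysis.Analysis" "HOL-Algebra.Coset"
begin

section \<open>Hyperbolic space and its isometry group\<close>

text \<open>
  \<open>\<real>\<^sup>d\<close> is \<^typ>\<open>real^'d\<close>. Points of the upper half-space are pairs \<open>(x, t)\<close> with \<open>t > 0\<close>.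
  The boundary \<open>\<real>\<^sup>d \<union> {\<infinity>}\<close> is the option type with \<^const>\<open>None\<close> as \<open>\<infinity>\<close>, topologised as the
  one-point compactification. Minkowski space \<open>\<real>\<^bsup>d+1,1\<^esup>\<close> has the coordinates \<open>Inl j\<close>, \<open>Inr False\<close>
  (spacelike) and \<open>Inr True\<close> (timelike).
\<close>

type_synonym 'd hpt = "(real^'d) \<times> real"
type_synonym 'd bdry = "(real^'d) option"
type_synonym 'd mink = "real^('d + bool)"
type_synonym 'd mat = "real^('d + bool)^('d + bool)"

definition lorentz_form :: "'d::finite mat" where
  "lorentz_form = (\<chi> i j. if i = j then (if i = Inr True then -1 else 1) else 0)"

definition SO :: "'d::finite mat set" where
  "SO = {g. transpose g ** lorentz_form ** g = lorentz_form \<and> det g = 1}"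

definition SO0 :: "'d::finite mat monoid" where
  "SO0 = \<lparr>carrier = connected_component_set SO (mat 1), mult = (**), one = mat 1\<rparr>"

definition half_space :: "'d::finite hpt set" where
  "half_space = {z. snd z > 0}"

definition base_pt :: "'d::finite hpt" where
  "base_pt = (0, 1)"

definition hdist :: "'d::finite hpt \<Rightarrow> 'd hpt \<Rightarrow> real" where
  "hdist z w = arcosh (1 + (dist z w)\<^sup>2 / (2 * snd z * snd w))"

text \<open>
  With the light-cone coordinates \<open>a = v\<^sub>T + v\<^sub>F\<close> and \<open>b = v\<^sub>T - v\<^sub>F\<close> the form is \<open>|x|\<^sup>2 - a b\<close>.
  The point \<open>(x, t)\<close> of the closed half-space corresponds to the line of \<open>(x, a, b) = (x, |x|\<^sup>2 + t\<^sup>2, 1)\<close>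
  (on which the form equals \<open>- t\<^sup>2\<close>) and \<open>\<infinity>\<close> to the null line of \<open>(0, 2, 0)\<close>. For \<open>t > 0\<close>, dividing
  by \<open>t\<close> gives the usual isometry with the hyperboloid.
\<close>

definition mink_vec :: "'d::finite hpt \<Rightarrow> 'd mink" where
  "mink_vec z = (\<chi> i. case i of
      Inl j \<Rightarrow> fst z $ j
    | Inr s \<Rightarrow> ((norm (fst z))\<^sup>2 + (snd z)\<^sup>2 + (if s then 1 else -1)) / 2)"

definition bdry_vec :: "'d::finite bdry \<Rightarrow> 'd mink" where
  "bdry_vec \<xi> = (case \<xi> of
      None \<Rightarrow> (\<chi> i. case i of Inl j \<Rightarrow> 0 | Inr s \<Rightarrow> 1)
    | Some x \<Rightarrow> mink_vec (x, 0))"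

definition lc_b :: "'d::finite mink \<Rightarrow> real" where
  "lc_b v = v $ Inr True - v $ Inr False"

definition hact :: "'d::finite mat \<Rightarrow> 'd hpt \<Rightarrow> 'd hpt" where
  "hact g z = (let v = g *v mink_vec z in ((\<chi> j. v $ Inl j / lc_b v), snd z / lc_b v))"

definition bact :: "'d::finite mat \<Rightarrow> 'd bdry \<Rightarrow> 'd bdry" where
  "bact g \<xi> = (let v = g *v bdry_vec \<xi> in
     if lc_b v = 0 then None else Some (\<chi> j. v $ Inl j / lc_b v))"

definition bdry_top :: "'d::finite bdry topology" where
  "bdry_top = Alexandroff_compactification euclidean"

text \<open>The filter of points of the half-space converging to a boundary point.\<close>

definition to_bdry :: "'d::finite bdry \<Rightarrow> 'd hpt filter" where
  "to_bdry \<xi> = inf (case \<xi> of None \<Rightarrow> at_infinity | Some x \<Rightarrow> nhds (x, 0)) (principal half_space)"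

text \<open>
  \<open>|f'(x)|\<close>, the Euclidean linear distortion at \<open>x\<close> of a map of the boundary that is finite near \<open>x\<close>
  (except possibly at \<open>\<infinity>\<close>).
\<close>

definition lin_dist :: "('d::finite bdry \<Rightarrow> 'd bdry) \<Rightarrow> real^'d \<Rightarrow> real" where
  "lin_dist f x = onorm (frechet_derivative (\<lambda>y. the (f (Some y))) (at x))"

definition conj_set :: "'d::finite mat \<Rightarrow> 'd mat set \<Rightarrow> 'd mat set" where
  "conj_set g S = (\<lambda>\<gamma>. g ** \<gamma> ** matrix_inv g) ` S"

section \<open>Geometrically finite groups\<close>

definition zariski_dense :: "'d::finite mat set \<Rightarrow> bool" where
  "zariski_dense \<Gamma> \<longleftrightarrow> (\<forall>f. real_polynomial_function f \<longrightarrow> (\<forall>g\<in>\<Gamma>. f g = 0) \<longrightarrow>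
     (\<forall>g\<in>carrier SO0. f g = 0))"

definition torsion_free :: "'d::finite mat set \<Rightarrow> bool" where
  "torsion_free \<Gamma> \<longleftrightarrow> (\<forall>g\<in>\<Gamma>. \<forall>n::nat. 0 < n \<longrightarrow> g [^]\<^bsub>SO0\<^esub> n = \<one>\<^bsub>SO0\<^esub> \<longrightarrow> g = \<one>\<^bsub>SO0\<^esub>)"

definition limit_set :: "'d::finite mat set \<Rightarrow> 'd bdry set" where
  "limit_set \<Gamma> = {\<xi>. \<exists>f. (\<forall>n. f n \<in> \<Gamma>) \<and> filterlim (\<lambda>n. hact (f n) base_pt) (to_bdry \<xi>) sequentially}"

definition geodesic_ray :: "(real \<Rightarrow> 'd::finite hpt) \<Rightarrow> bool" where
  "geodesic_ray r \<longleftrightarrow> (\<forall>s\<ge>0. r s \<in> half_space) \<and> (\<forall>s\<ge>0. \<forall>t\<ge>0. hdist (r s) (r t) = \<bar>s - t\<bar>)"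

definition conical :: "'d::finite mat set \<Rightarrow> 'd bdry \<Rightarrow> bool" where
  "conical \<Gamma> \<xi> \<longleftrightarrow> (\<exists>r f K. geodesic_ray r \<and> filterlim r (to_bdry \<xi>) at_top \<and>
     (\<forall>n. f n \<in> \<Gamma>) \<and> filterlim (\<lambda>n. hact (f n) base_pt) (to_bdry \<xi>) sequentially \<and>
     (\<forall>n. \<exists>t\<ge>0. hdist (hact (f n) base_pt) (r t) \<le> K))"

definition parabolic_element :: "'d::finite mat \<Rightarrow> bool" where
  "parabolic_element g \<longleftrightarrow> g \<in> carrier SO0 \<and> (\<exists>!\<xi>. bact g \<xi> = \<xi>) \<and> (\<forall>z\<in>half_space. hact g z \<noteq> z)"

definition parabolic_points :: "'d::finite mat set \<Rightarrow> 'd bdry set" where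
  "parabolic_points \<Gamma> = {\<xi>. \<exists>g\<in>\<Gamma>. parabolic_element g \<and> bact g \<xi> = \<xi>}"

definition stab :: "'d::finite mat set \<Rightarrow> 'd bdry \<Rightarrow> 'd mat set" where
  "stab \<Gamma> \<xi> = {g\<in>\<Gamma>. bact g \<xi> = \<xi>}"

text \<open>Bounded: the stabilizer acts cocompactly on the limit set minus the point.\<close>

definition bounded_parabolic :: "'d::finite mat set \<Rightarrow> 'd bdry \<Rightarrow> bool" where
  "bounded_parabolic \<Gamma> \<xi> \<longleftrightarrow> \<xi> \<in> parabolic_points \<Gamma> \<and>
     (\<exists>K. compactin bdry_top K \<and> K \<subseteq> limit_set \<Gamma> - {\<xi>} \<and>
        limit_set \<Gamma> - {\<xi>} = (\<Union>g\<in>stab \<Gamma> \<xi>. bact g ` K))"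

definition geometrically_finite :: "'d::finite mat set \<Rightarrow> bool" where
  "geometrically_finite \<Gamma> \<longleftrightarrow> subgroup \<Gamma> SO0 \<and> discrete \<Gamma> \<and>
     (\<forall>\<xi>\<in>limit_set \<Gamma>. conical \<Gamma> \<xi> \<or> bounded_parabolic \<Gamma> \<xi>)"

section \<open>Patterson-Sullivan measure\<close>

definition critical_exponent :: "'d::finite mat set \<Rightarrow> real" where
  "critical_exponent \<Gamma> =
     Inf {s. 0 \<le> s \<and> (\<lambda>g. exp (- s * hdist base_pt (hact g base_pt))) summable_on \<Gamma>}"

definition busemann :: "'d::finite bdry \<Rightarrow> 'd hpt \<Rightarrow> 'd hpt \<Rightarrow> real" where
  "busemann \<xi> x y = Lim (to_bdry \<xi>) (\<lambda>z. hdist x z - hdist y z)"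

definition bdry_borel :: "'d::finite bdry measure" where
  "bdry_borel = sigma UNIV {U. openin bdry_top U}"

text \<open>
  \<open>\<nu>\<close> is a \<open>\<Gamma>\<close>-invariant conformal density of dimension \<open>\<delta>\<close> on the limit set. The Patterson-Sullivan
  measure \<open>\<mu>\<close> is \<open>\<nu> base_pt\<close>.
\<close>

definition ps_density :: "'d::finite mat set \<Rightarrow> ('d hpt \<Rightarrow> 'd bdry measure) \<Rightarrow> bool" where
  "ps_density \<Gamma> \<nu> \<longleftrightarrow>
     (\<forall>x\<in>half_space. sets (\<nu> x) = sets bdry_borel \<and> finite_measure (\<nu> x) \<and>
        emeasure (\<nu> x) UNIV \<noteq> 0 \<and> emeasure (\<nu> x) (- limit_set \<Gamma>) = 0) \<and>
     (\<forall>x\<in>half_space. \<forall>g\<in>\<Gamma>. distr (\<nu> x) bdry_borel (bact g) = \<nu> (hact g x)) \<and>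
     (\<forall>x\<in>half_space. \<forall>y\<in>half_space.
        \<nu> y = density (\<nu> x) (\<lambda>\<xi>. ennreal (exp (- critical_exponent \<Gamma> * busemann \<xi> y x))))"

section \<open>Fundamental regions at infinity\<close>

definition direction :: "(real^'d::finite) set \<Rightarrow> (real^'d) set" where
  "direction Z = {z - z' | z z'. z \<in> Z \<and> z' \<in> Z}"

text \<open>\<open>cyl Z s A\<close> is \<open>B\<^sub>Y(s) \<times> A\<close> for \<open>A \<subseteq> Z\<close>, where \<open>\<real>\<^sup>d = Y \<times> Z\<close> via \<open>(y, z) \<mapsto> y + z\<close>.\<close>

definition cyl :: "(real^'d::finite) set \<Rightarrow> real \<Rightarrow> (real^'d) set \<Rightarrow> (real^'d) set" where
  "cyl Z s A = {y + z | y z. y \<in> orthogonal_comp (direction Z) \<and> norm y < s \<and> z \<in> A}"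

definition trans_vecs :: "'d::finite mat set \<Rightarrow> (real^'d) set \<Rightarrow> (real^'d) set" where
  "trans_vecs L Z = {v. \<exists>\<gamma>\<in>L. \<forall>z\<in>Z. bact \<gamma> (Some z) = Some (z + v)}"

definition abelian_normal :: "'d::finite mat set \<Rightarrow> 'd mat set \<Rightarrow> bool" where
  "abelian_normal L S \<longleftrightarrow> L \<lhd> SO0\<lparr>carrier := S\<rparr> \<and> (\<forall>a\<in>L. \<forall>b\<in>L. a ** b = b ** a)"

text \<open>\<open>L\<close> and \<open>Z\<close> are a choice of \<open>\<Gamma>'\<^sub>\<infinity>\<close> and of the affine subspace given by Bieberbach's theorem.\<close>

definition bieberbach :: "'d::finite mat set \<Rightarrow> 'd mat set \<Rightarrow> (real^'d) set \<Rightarrow> bool" where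
  "bieberbach \<Gamma>' L Z \<longleftrightarrow> (let S = stab \<Gamma>' None in
     abelian_normal L S \<and> finite (rcosets\<^bsub>SO0\<lparr>carrier := S\<rparr>\<^esub> L) \<and>
     (\<forall>L'. abelian_normal L' S \<and> L \<subseteq> L' \<longrightarrow> L' = L) \<and>
     affine Z \<and> Z \<noteq> {} \<and> (\<forall>g\<in>S. bact g ` Some ` Z = Some ` Z) \<and>
     (\<forall>\<gamma>\<in>L. \<exists>v. \<forall>z\<in>Z. bact \<gamma> (Some z) = Some (z + v)) \<and>
     int (dim (trans_vecs L Z)) = aff_dim Z)"

definition parallelotope :: "(real^'d::finite) \<Rightarrow> (real^'d) set \<Rightarrow> (real^'d) set" where
  "parallelotope a E = {a + (\<Sum>v\<in>E. c v *\<^sub>R v) | c. \<forall>v\<in>E. 0 < c v \<and> c v < 1}"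

definition parallelotope_in :: "(real^'d::finite) set \<Rightarrow> (real^'d) \<Rightarrow> (real^'d) set \<Rightarrow> bool" where
  "parallelotope_in Z a E \<longleftrightarrow> a \<in> Z \<and> independent E \<and> E \<subseteq> direction Z \<and> int (card E) = aff_dim Z"

text \<open>
  An open parallelotope \<open>P\<close> in \<open>Z\<close> that is a fundamental region for \<open>L\<close> on \<open>Z\<close>. Its edges are required to
  be lattice vectors: larger parallelotopes tiled by its translates, as used in the definition of the
  flowers, exist only then.
\<close>

definition fund_parallelotope ::
    "'d::finite mat set \<Rightarrow> (real^'d) set \<Rightarrow> (real^'d) set \<Rightarrow> bool" where
  "fund_parallelotope L Z P \<longleftrightarrow>
     (\<exists>a E. parallelotope_in Z a E \<and> E \<subseteq> trans_vecs L Z \<and> P = parallelotope a E) \<and>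
     (\<forall>\<gamma>\<in>L. \<forall>\<gamma>'\<in>L. \<gamma> \<noteq> \<gamma>' \<longrightarrow> bact \<gamma> ` Some ` P \<inter> bact \<gamma>' ` Some ` P = {}) \<and>
     Some ` Z = (\<Union>\<gamma>\<in>L. bact \<gamma> ` Some ` closure P)"

definition tiled_parallelotope ::
    "'d::finite mat set \<Rightarrow> (real^'d) set \<Rightarrow> (real^'d) set \<Rightarrow> (real^'d) set \<Rightarrow> bool" where
  "tiled_parallelotope L Z P R \<longleftrightarrow>
     (\<exists>a E. parallelotope_in Z a E \<and> R = closure (parallelotope a E)) \<and>
     (\<exists>F\<subseteq>L. Some ` R = (\<Union>\<gamma>\<in>F. bact \<gamma> ` Some ` closure P))"

section \<open>Cusps\<close>

text \<open>Horoballs are open; at \<open>x \<in> \<real>\<^sup>d\<close> they are Euclidean balls tangent to \<open>\<real>\<^sup>d\<close> at \<open>x\<close>.\<close>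

definition horoball :: "'d::finite bdry \<Rightarrow> 'd hpt set \<Rightarrow> bool" where
  "horoball \<xi> H \<longleftrightarrow> (\<exists>s>0. H = (case \<xi> of None \<Rightarrow> {z. snd z > s} | Some x \<Rightarrow> ball (x, s) s))"

definition height :: "'d::finite hpt set \<Rightarrow> real" where
  "height H = Sup (snd ` H)"

text \<open>
  The choices \<open>q\<close>, \<open>p\<^sub>i\<close>, \<open>H\<^sub>p\<close>, \<open>g\<^sub>i\<close>, \<open>(\<Gamma>\<^sub>i)\<^sub>\<infinity>\<close>, and the \<open>Z\<close>, \<open>C'\<close> and \<open>\<Delta>'\<close> attached to \<open>\<Gamma>\<^sub>i\<close>, where the
  index \<open>i\<close> runs through \<open>{1..q}\<close>.
\<close>

record ('d::finite) cusp_data =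
  ncusps :: nat
  cpt :: "nat \<Rightarrow> (real^'d) option"
  hball :: "(real^'d) option \<Rightarrow> ((real^'d) \<times> real) set"
  gmap :: "nat \<Rightarrow> real^('d + bool)^('d + bool)"
  lat :: "nat \<Rightarrow> (real^('d + bool)^('d + bool)) set"
  flat :: "nat \<Rightarrow> (real^'d) set"
  width :: "nat \<Rightarrow> real"
  ptope :: "nat \<Rightarrow> (real^'d) set"

definition Delta :: "('d::finite) cusp_data \<Rightarrow> nat \<Rightarrow> 'd bdry set" where
  "Delta D i = bact (matrix_inv (gmap D i)) ` Some ` cyl (flat D i) (width D i) (ptope D i)"

definition cusp_group :: "('d::finite) cusp_data \<Rightarrow> nat \<Rightarrow> 'd mat set" where
  "cusp_group D i = conj_set (matrix_inv (gmap D i)) (lat D i)"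

definition cusp_setup :: "'d::finite mat set \<Rightarrow> 'd cusp_data \<Rightarrow> bool" where
  "cusp_setup \<Gamma> D \<longleftrightarrow>
     1 \<le> ncusps D \<and> cpt D 1 = None \<and> cpt D ` {1..ncusps D} \<subseteq> parabolic_points \<Gamma> \<and>
     (\<forall>\<xi>\<in>parabolic_points \<Gamma>. \<exists>!i. i \<in> {1..ncusps D} \<and> (\<exists>\<gamma>\<in>\<Gamma>. \<xi> = bact \<gamma> (cpt D i))) \<and>
     (\<forall>\<xi>\<in>parabolic_points \<Gamma>. horoball \<xi> (hball D \<xi>)) \<and>
     (\<forall>\<xi>\<in>parabolic_points \<Gamma>. \<forall>\<gamma>\<in>\<Gamma>. hball D (bact \<gamma> \<xi>) = hact \<gamma> ` hball D \<xi>) \<and>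
     disjoint_family_on (hball D) (parabolic_points \<Gamma>) \<and>
     hball D None = {z. snd z > 1} \<and>
     gmap D 1 = mat 1 \<and>
     (\<forall>i\<in>{1..ncusps D}. gmap D i \<in> carrier SO0 \<and> bact (gmap D i) (cpt D i) = None \<and>
        hact (gmap D i) ` hball D (cpt D i) = hball D None) \<and>
     (\<forall>i\<in>{1..ncusps D}. let \<Gamma>\<^sub>i = conj_set (gmap D i) \<Gamma> in
        bieberbach \<Gamma>\<^sub>i (lat D i) (flat D i) \<and>
        fund_parallelotope (lat D i) (flat D i) (ptope D i) \<and> 0 < width D i \<and>
        limit_set \<Gamma>\<^sub>i \<subseteq> insert None
          (\<Union>\<gamma>\<in>lat D i. bact \<gamma> ` Some ` closure (cyl (flat D i) (width D i / 2) (ptope D i)))) \<and>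
     disjoint_family_on (Delta D) {1..ncusps D} \<and>
     (\<forall>k\<in>{1..ncusps D}. cpt D ` {1..ncusps D} \<inter> bdry_top closure_of Delta D k = {})"

section \<open>Flowers\<close>

definition cusp_index :: "'d::finite mat set \<Rightarrow> 'd cusp_data \<Rightarrow> 'd bdry \<Rightarrow> nat" where
  "cusp_index \<Gamma> D p = (THE i. i \<in> {1..ncusps D} \<and> (\<exists>\<gamma>\<in>\<Gamma>. p = bact \<gamma> (cpt D i)))"

text \<open>
  \<open>gam p\<close> is the fixed choice of \<open>\<gamma>\<close> with \<open>p = \<gamma> p\<^sub>i\<close>. The representatives \<open>p\<^sub>i\<close> themselves must be left
  out: \<open>p\<^sub>i = \<gamma> p\<^sub>i\<close> gives \<open>\<gamma>\<^sup>-\<^sup>1 p\<^sub>i = p\<^sub>i\<close>, which lies in no closure of a \<open>\<Delta>\<^bsub>p\<^sub>k\<^esub>\<close>. They do not occur in the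
  coding, where only \<open>p \<in> \<Delta>\<^bsub>p\<^sub>l\<^esub>\<close> are used.
\<close>

definition flower_choice ::
    "'d::finite mat set \<Rightarrow> 'd cusp_data \<Rightarrow> ('d bdry \<Rightarrow> 'd mat) \<Rightarrow> bool" where
  "flower_choice \<Gamma> D gam \<longleftrightarrow> (\<forall>p \<in> parabolic_points \<Gamma> - cpt D ` {1..ncusps D}.
     let i = cusp_index \<Gamma> D p in
       gam p \<in> \<Gamma> \<and> p = bact (gam p) (cpt D i) \<and>
       bact (matrix_inv (gam p)) (cpt D i) \<in> bdry_top closure_of Delta D i)"

text \<open>
  The smallest tiled parallelotope is written as the intersection of all admissible ones; these are
  boxes with lattice vertices, so that the intersection is again one of them.
\<close>

definition flower_box :: "'d::finite mat set \<Rightarrow> 'd cusp_data \<Rightarrow> real \<Rightarrow> ('d bdry \<Rightarrow> 'd mat) \<Rightarrow>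
    'd bdry \<Rightarrow> (real^'d) set" where
  "flower_box \<Gamma> D \<eta> gam p = (let i = cusp_index \<Gamma> D p in
     \<Inter>{R. tiled_parallelotope (lat D i) (flat D i) (ptope D i) R \<and>
          ball (the (bact (gmap D i ** matrix_inv (gam p)) (cpt D i))) (1 / \<eta>)
            \<subseteq> cyl (flat D i) (2 / \<eta>) R})"

definition flower :: "'d::finite mat set \<Rightarrow> 'd cusp_data \<Rightarrow> real \<Rightarrow> ('d bdry \<Rightarrow> 'd mat) \<Rightarrow>
    'd bdry \<Rightarrow> 'd bdry set" where
  "flower \<Gamma> D \<eta> gam p = (let i = cusp_index \<Gamma> D p in
     bact (gam p ** matrix_inv (gmap D i)) `
       (- Some ` cyl (flat D i) (2 / \<eta>) (flower_box \<Gamma> D \<eta> gam p)))"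

definition flower_elements :: "'d::finite mat set \<Rightarrow> 'd cusp_data \<Rightarrow> real \<Rightarrow> ('d bdry \<Rightarrow> 'd mat) \<Rightarrow>
    'd bdry \<Rightarrow> 'd mat set" where
  "flower_elements \<Gamma> D \<eta> gam p = (let i = cusp_index \<Gamma> D p in
     {\<gamma>1\<in>cusp_group D i. bact (gam p ** \<gamma>1) ` Delta D i \<subseteq> flower \<Gamma> D \<eta> gam p})"

section \<open>The coding\<close>

text \<open>\<open>new_points \<Gamma> D \<eta> l n W\<close> is \<open>P\<^sup>(\<^sup>l\<^sup>)\<^sub>n\<^sub>+\<^sub>1\<close> when \<open>W = \<Omega>\<^sup>(\<^sup>l\<^sup>)\<^sub>n\<close>, and \<open>h\<^sub>n = e\<^sup>-\<^sup>n\<close>.\<close>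

definition new_points :: "'d::finite mat set \<Rightarrow> 'd cusp_data \<Rightarrow> real \<Rightarrow> nat \<Rightarrow> nat \<Rightarrow>
    'd bdry set \<Rightarrow> 'd bdry set" where
  "new_points \<Gamma> D \<eta> l n W = {p\<in>parabolic_points \<Gamma>.
     \<eta> * height (hact (gmap D l) ` hball D p) \<in> {exp (- real (Suc n))<..exp (- real n)} \<and>
     (\<exists>x. bact (gmap D l) p = Some x \<and> Some ` ball x (exp (- real n) / (4 * \<eta>)) \<subseteq> W)}"

primrec Omega :: "'d::finite mat set \<Rightarrow> 'd cusp_data \<Rightarrow> real \<Rightarrow> ('d bdry \<Rightarrow> 'd mat) \<Rightarrow> nat \<Rightarrow>
    nat \<Rightarrow> 'd bdry set" where
  "Omega \<Gamma> D \<eta> gam l 0 = bact (gmap D l) ` Delta D l"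
| "Omega \<Gamma> D \<eta> gam l (Suc n) = Omega \<Gamma> D \<eta> gam l n -
     (\<Union>p\<in>new_points \<Gamma> D \<eta> l n (Omega \<Gamma> D \<eta> gam l n). bact (gmap D l) ` flower \<Gamma> D \<eta> gam p)"

text \<open>
  \<open>branch0 \<Gamma> D \<eta> gam l g i\<close>: the map \<open>T\<^sub>0\<close> is \<open>g\<^sup>-\<^sup>1\<close> on the piece \<open>g \<Delta>\<^bsub>p\<^sub>i\<^esub>\<close> of \<open>\<Delta>\<^bsub>p\<^sub>l\<^esub>\<close>.
\<close>

definition branch0 :: "'d::finite mat set \<Rightarrow> 'd cusp_data \<Rightarrow> real \<Rightarrow> ('d bdry \<Rightarrow> 'd mat) \<Rightarrow>
    nat \<Rightarrow> 'd mat \<Rightarrow> nat \<Rightarrow> bool" where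
  "branch0 \<Gamma> D \<eta> gam l g i \<longleftrightarrow> l \<in> {1..ncusps D} \<and>
     (\<exists>n. \<exists>p\<in>new_points \<Gamma> D \<eta> l n (Omega \<Gamma> D \<eta> gam l n). i = cusp_index \<Gamma> D p \<and>
        (\<exists>\<gamma>1\<in>flower_elements \<Gamma> D \<eta> gam p. g = gam p ** \<gamma>1))"

definition dom_T0 :: "'d::finite mat set \<Rightarrow> 'd cusp_data \<Rightarrow> real \<Rightarrow> ('d bdry \<Rightarrow> 'd mat) \<Rightarrow>
    'd bdry set" where
  "dom_T0 \<Gamma> D \<eta> gam = {\<xi>. \<exists>l g i. branch0 \<Gamma> D \<eta> gam l g i \<and> \<xi> \<in> bact g ` Delta D i}"

definition T0 :: "'d::finite mat set \<Rightarrow> 'd cusp_data \<Rightarrow> real \<Rightarrow> ('d bdry \<Rightarrow> 'd mat) \<Rightarrow>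
    'd bdry \<Rightarrow> 'd bdry" where
  "T0 \<Gamma> D \<eta> gam \<xi> = (THE \<zeta>. \<exists>l g i. branch0 \<Gamma> D \<eta> gam l g i \<and> \<xi> \<in> bact g ` Delta D i \<and>
     \<zeta> = bact (matrix_inv g) \<xi>)"

definition T0_irreducible :: "'d::finite mat set \<Rightarrow> 'd cusp_data \<Rightarrow> real \<Rightarrow> ('d bdry \<Rightarrow> 'd mat) \<Rightarrow>
    bool" where
  "T0_irreducible \<Gamma> D \<eta> gam \<longleftrightarrow> (\<forall>I. I \<noteq> {} \<and> I \<subset> {1..ncusps D} \<longrightarrow>
     \<not> T0 \<Gamma> D \<eta> gam ` (dom_T0 \<Gamma> D \<eta> gam \<inter> (\<Union>i\<in>I. Delta D i)) \<subseteq> (\<Union>i\<in>I. Delta D i))"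

text \<open>
  \<open>returns_at\<close>: the \<open>n\<close>-th iterate of the partial map \<open>T\<^sub>0\<close> is defined at \<open>\<xi>\<close> and lies in
  \<open>\<Delta>\<^sub>0 = Delta D 1\<close>.
\<close>

definition returns_at :: "'d::finite mat set \<Rightarrow> 'd cusp_data \<Rightarrow> real \<Rightarrow> ('d bdry \<Rightarrow> 'd mat) \<Rightarrow>
    'd bdry \<Rightarrow> nat \<Rightarrow> bool" where
  "returns_at \<Gamma> D \<eta> gam \<xi> n \<longleftrightarrow> 1 \<le> n \<and>
     (\<forall>k<n. (T0 \<Gamma> D \<eta> gam ^^ k) \<xi> \<in> dom_T0 \<Gamma> D \<eta> gam) \<and> (T0 \<Gamma> D \<eta> gam ^^ n) \<xi> \<in> Delta D 1"

definition dom_T :: "'d::finite mat set \<Rightarrow> 'd cusp_data \<Rightarrow> real \<Rightarrow> ('d bdry \<Rightarrow> 'd mat) \<Rightarrow>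
    'd bdry set" where
  "dom_T \<Gamma> D \<eta> gam = {\<xi>\<in>Delta D 1. \<exists>n. returns_at \<Gamma> D \<eta> gam \<xi> n}"

definition T_map :: "'d::finite mat set \<Rightarrow> 'd cusp_data \<Rightarrow> real \<Rightarrow> ('d bdry \<Rightarrow> 'd mat) \<Rightarrow>
    'd bdry \<Rightarrow> 'd bdry" where
  "T_map \<Gamma> D \<eta> gam \<xi> = (T0 \<Gamma> D \<eta> gam ^^ (LEAST n. returns_at \<Gamma> D \<eta> gam \<xi> n)) \<xi>"

text \<open>
  \<open>\<H>\<close>. The pieces \<open>\<Delta>\<^sub>j = \<gamma>\<^sub>j \<Delta>\<^sub>0\<close> are the connected components of the domain of \<open>T\<close>, and an element of \<open>\<Gamma>\<close>
  is determined by its action on an open set, so this is exactly the set of the \<open>\<gamma>\<^sub>j\<close>.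
\<close>

definition inverse_branches :: "'d::finite mat set \<Rightarrow> 'd cusp_data \<Rightarrow> real \<Rightarrow>
    ('d bdry \<Rightarrow> 'd mat) \<Rightarrow> 'd mat set" where
  "inverse_branches \<Gamma> D \<eta> gam = {\<gamma>\<in>\<Gamma>. bact \<gamma> ` Delta D 1 \<subseteq> dom_T \<Gamma> D \<eta> gam \<and>
     (\<forall>\<xi>\<in>bact \<gamma> ` Delta D 1. T_map \<Gamma> D \<eta> gam \<xi> = bact (matrix_inv \<gamma>) \<xi>)}"

primrec words :: "'d::finite mat set \<Rightarrow> nat \<Rightarrow> 'd mat set" where
  "words H 0 = {mat 1}"
| "words H (Suc n) = {\<gamma> ** \<gamma>' | \<gamma> \<gamma>'. \<gamma> \<in> H \<and> \<gamma>' \<in> words H n}"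

definition log_expansion :: "'d::finite mat set \<Rightarrow> 'd cusp_data \<Rightarrow> real \<Rightarrow> ('d bdry \<Rightarrow> 'd mat) \<Rightarrow>
    'd bdry \<Rightarrow> real" where
  "log_expansion \<Gamma> D \<eta> gam \<xi> = ln (lin_dist (T_map \<Gamma> D \<eta> gam) (the \<xi>))"

text \<open>
  The known properties of the coding, for \<open>\<mu>\<close> the Patterson-Sullivan measure: full measure, uniform
  contraction by \<open>\<lambda>\<close>, bounded distortion by \<open>C\<^sub>1\<close>, and the exponential tail with exponent \<open>\<epsilon>\<^sub>o\<close>.
\<close>

definition coding_constants :: "'d::finite mat set \<Rightarrow> 'd cusp_data \<Rightarrow> 'd bdry measure \<Rightarrow> real \<Rightarrow>
    ('d bdry \<Rightarrow> 'd mat) \<Rightarrow> real \<Rightarrow> real \<Rightarrow> real \<Rightarrow> bool" where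
  "coding_constants \<Gamma> D \<mu> \<eta> gam C1 lam eps \<longleftrightarrow> (let H = inverse_branches \<Gamma> D \<eta> gam in
     0 < C1 \<and> 0 < lam \<and> lam < 1 \<and> 0 < eps \<and> eps < 1 \<and>
     ((\<lambda>\<gamma>. measure \<mu> (bact \<gamma> ` Delta D 1)) has_sum measure \<mu> (Delta D 1)) H \<and>
     (\<forall>\<gamma>\<in>H. \<forall>x. Some x \<in> Delta D 1 \<longrightarrow> lin_dist (bact \<gamma>) x \<le> lam \<and>
        onorm (frechet_derivative (\<lambda>y. ln (lin_dist (bact \<gamma>) y)) (at x)) < C1) \<and>
     (\<integral>\<^sup>+\<xi>\<in>(\<Union>\<gamma>\<in>H. bact \<gamma> ` Delta D 1). ennreal (exp (eps * log_expansion \<Gamma> D \<eta> gam \<xi>)) \<partial>\<mu>) < \<infinity>)"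

text \<open>\<open>\<tau>(x) = R\<^sub>n(\<gamma> x) = - log |\<gamma>'(x)|\<close> for \<open>\<gamma> \<in> \<H>\<^sup>n\<close>.\<close>

definition tau :: "'d::finite mat \<Rightarrow> real^'d \<Rightarrow> real" where
  "tau \<gamma> x = - ln (lin_dist (bact \<gamma>) x)"

end

theory Submission
  imports Defs
begin

text \<open>
  For \<open>\<gamma>\<close> in the Lorentz group put \<open>\<xi> = \<gamma>\<^sup>-\<^sup>1 \<infinity>\<close>. The gradient of \<open>- log |\<gamma>'|\<close> at \<open>x\<close> is
  \<open>2 (x - \<xi>) / |x - \<xi>|\<^sup>2\<close>, so its component along \<open>e\<close> takes a prescribed value only for \<open>\<xi>\<close> on a
  sphere or hyperplane, that is, for null vectors \<open>\<xi>\<close> in a hyperplane of Minkowski space. Poles of long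
  words cluster on the dual limit set, which is invariant under the inverses of the branches. By
  compactness it suffices that this set does not lie in a hyperplane \<open>n\<^sup>\<bottom>\<close>.

  Suppose it does. If it has two points, pushing one of them forward along the coding of a typical
  point \<open>x\<close> of \<open>\<Delta>\<^sub>0\<close> converges to \<open>x\<close> inside an invariant proper subspace. If it is a single point
  \<open>p\<close>, all branches fix \<open>p\<close>; by discreteness they then also share an attracting fixed point, to which every
  typical point is equal. In both cases almost all of \<open>\<Delta>\<^sub>0\<close> lies in one hyperplane. This contradicts Zariski
  density, as the support of the Patterson-Sullivan measure contains the limit set, which meets \<open>\<Delta>\<^sub>0\<close> by
  Baire's theorem.
\<close>

section \<open>The Minkowski form and the celestial sphere\<close>

text \<open>The constants \<open>r\<close> and \<open>\<epsilon>0\<close> must be fixed before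
  \<open>C\<close> and \<open>n0\<close>, whereas words are available only once \<open>n0\<close> is
  known. Hence gradients are first separated for pairs of points of the dual limit set, with margins
  made uniform by a finite subcover; words are inserted afterwards. This works because poles of
  words of every sufficiently large length approach each dual limit point: prefixing letters to a
  word of length n moves its pole by O(\<open>lam ^ n\<close>) only.

  All estimates rest on poles staying away from \<open>closure \<Delta>\<close>. This is read off
  from the distortion bound C1 / (1 - lam), which caps the gradient norm 2 / |x - \<xi>|. Poles may
  still run to \<infinity>. Boundary points are therefore handled as null vectors with time
  coordinate 1: \<infinity> is then a point like any other, distances and conformal factors become
  Lorentz products, and invariance of the form replaces explicit formulas for Moebius maps.

  The branches are not known to generate \<open>\<Gamma>\<close>, so Zariski density cannot be
  applied to them directly. It reaches them through the full measure of the coded points.\<close>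

definition mform :: "'d::finite mink \<Rightarrow> 'd mink \<Rightarrow> real" where
  "mform u v = u \<bullet> v - 2 * (u $ Inr True * v $ Inr True)"

definition spart :: "'d::finite mink \<Rightarrow> real^'d" where
  "spart v = (\<chi> j. v $ Inl j)"

definition mink_of :: "real^'d::finite \<Rightarrow> real \<Rightarrow> real \<Rightarrow> 'd mink" where
  "mink_of X a b = (\<chi> i. case i of Inl j \<Rightarrow> X $ j | Inr s \<Rightarrow> if s then b else a)"

abbreviation lift :: "real^'d::finite \<Rightarrow> 'd mink" where
  "lift x \<equiv> mink_vec (x, 0)"

text \<open>The null vector of \<infinity> (\<open>bdry_vec_None\<close>); \<open>e_T\<close> below
  is \<open>base_pt\<close> on the hyperboloid (\<open>base_vec\<close>).\<close>

abbreviation qinf :: "'d::finite mink" where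
  "qinf \<equiv> mink_of 0 1 1"

abbreviation e_T :: "'d::finite mink" where
  "e_T \<equiv> mink_of 0 0 1"

lemma mink_of_simps [simp]:
  "spart (mink_of X a b) = X" "mink_of X a b $ Inr False = a" "mink_of X a b $ Inr True = b"
  "mink_of X a b $ Inl j = X $ j"
  by (simp_all add: mink_of_def spart_def)

lemma mink_eqI:
  assumes "spart u = spart v" "u $ Inr False = v $ Inr False" "u $ Inr True = v $ Inr True"
  shows "u = v"
proof -
  have "u $ i = v $ i" for i
  proof (cases i)
    case (Inl j)
    then show ?thesis using assms(1) by (simp add: spart_def vec_eq_iff)
  next
    case (Inr s)
    then show ?thesis using assms(2,3) by (cases s) auto
  qed
  then show ?thesis by (simp add: vec_eq_iff)
qed

lemma mink_of_collapse: "mink_of (spart v) (v $ Inr False) (v $ Inr True) = v"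
  by (rule mink_eqI) auto

lemma spart_linear [simp]:
  "spart (u + v) = spart u + spart v" "spart (u - v) = spart u - spart v"
  "spart (c *\<^sub>R u) = c *\<^sub>R spart u" "spart 0 = 0" "spart (- u) = - spart u"
  by (simp_all add: spart_def vec_eq_iff)

lemma inner_mink:
  fixes u v :: "'d::finite mink"
  shows "u \<bullet> v = spart u \<bullet> spart v + u $ Inr False * v $ Inr False + u $ Inr True * v $ Inr True"
proof -
  have "u \<bullet> v = (\<Sum>i\<in>UNIV. u $ i * v $ i)" by (simp add: inner_vec_def)
  also have "\<dots> = (\<Sum>i\<in>UNIV <+> UNIV. u $ i * v $ i)" by simp
  also have "\<dots> = (\<Sum>j\<in>UNIV. u $ Inl j * v $ Inl j) + (\<Sum>s\<in>UNIV. u $ Inr s * v $ Inr s)"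
    by (subst sum.Plus) auto
  finally show ?thesis by (simp add: UNIV_bool inner_vec_def spart_def)
qed

lemma mform_mink: "mform u v = spart u \<bullet> spart v + u $ Inr False * v $ Inr False - u $ Inr True * v $ Inr True"
  by (simp add: mform_def inner_mink)

lemma mform_linear:
  "mform (u + u') v = mform u v + mform u' v" "mform u (v + v') = mform u v + mform u v'"
  "mform (u - u') v = mform u v - mform u' v" "mform u (v - v') = mform u v - mform u v'"
  "mform (c *\<^sub>R u) v = c * mform u v" "mform u (c *\<^sub>R v) = c * mform u v"
  "mform 0 v = 0" "mform u 0 = 0" "mform (- u) v = - mform u v" "mform u (- v) = - mform u v"
  by (simp_all add: mform_def inner_simps algebra_simps)

lemma mform_sym: "mform u v = mform v u"
  by (simp add: mform_def inner_commute)

lemma continuous_on_mform [continuous_intros]: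
  assumes "continuous_on S f" "continuous_on S g"
  shows "continuous_on S (\<lambda>x. mform (f x) (g x))"
  unfolding mform_def by (intro continuous_intros assms)

lemma tendsto_mform [tendsto_intros]:
  assumes "(f \<longlongrightarrow> a) F" "(g \<longlongrightarrow> b) F"
  shows "((\<lambda>x. mform (f x) (g x)) \<longlongrightarrow> mform a b) F"
  unfolding mform_def by (intro tendsto_intros assms)

lemma spart_mink_vec [simp]: "spart (mink_vec z) = fst z"
  "mink_vec z $ Inr False = ((norm (fst z))\<^sup>2 + (snd z)\<^sup>2 - 1) / 2"
  "mink_vec z $ Inr True = ((norm (fst z))\<^sup>2 + (snd z)\<^sup>2 + 1) / 2"
  by (simp_all add: mink_vec_def spart_def vec_eq_iff)

lemma bdry_vec_None: "bdry_vec None = qinf"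
  by (rule mink_eqI) (simp_all add: bdry_vec_def spart_def vec_eq_iff)

lemma bdry_vec_Some: "bdry_vec (Some x) = lift x"
  by (simp add: bdry_vec_def)

lemma base_vec: "mink_vec base_pt = e_T"
  by (rule mink_eqI) (simp_all add: base_pt_def)

text \<open>Makes the denominators of \<open>hact\<close> and \<open>bact\<close> Lorentz products,
  to which invariance under the group applies.\<close>

lemma lc_b_mform: "lc_b v = - mform v qinf"
  by (simp add: lc_b_def mform_mink)

lemma lc_b_linear: "lc_b (u + v) = lc_b u + lc_b v" "lc_b (c *\<^sub>R u) = c * lc_b u"
  by (simp_all add: lc_b_def algebra_simps)

lemma lc_b_mink_vec [simp]: "lc_b (mink_vec z) = 1"
  by (simp add: lc_b_def field_simps)

lemma mform_mink_vec_self: "mform (mink_vec z) (mink_vec z) = - (snd z)\<^sup>2"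
proof -
  have *: "a + ((a + b - 1) / 2) * ((a + b - 1) / 2) - ((a + b + 1) / 2) * ((a + b + 1) / 2) = - b"
    for a b :: real by (simp add: field_simps)
  show ?thesis
    using *[of "(norm (fst z))\<^sup>2" "(snd z)\<^sup>2"] by (simp add: mform_mink power2_norm_eq_inner)
qed

text \<open>The source of all distance formulas: invariance of the form turns it into the distortion
  identity \<open>emap_dist\<close>.\<close>

lemma mform_lift: "mform (lift x) (lift y) = - (norm (x - y))\<^sup>2 / 2"
  by (simp add: mform_mink power2_norm_eq_inner inner_simps inner_commute) (simp add: field_simps)

lemma mform_lift_mink_vec: "mform (lift x) u = x \<bullet> spart u + ((norm x)\<^sup>2 - 1) / 2 * u $ Inr False - ((norm x)\<^sup>2 + 1) / 2 * u $ Inr True"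
  by (simp add: mform_mink)

text \<open>Once b is nonzero, the relation |x|^2 - a b = - s^2 determines the other light-cone
  coordinate a. The case s = 0 serves finite boundary points, s > 0 points of the
  half-space.\<close>

lemma mink_vec_unique:
  assumes b: "lc_b v = b" "b \<noteq> 0" and "mform v v = - s\<^sup>2"
  shows "v = b *\<^sub>R mink_vec ((1 / b) *\<^sub>R spart v, s / b)"
proof -
  define a where "a = v $ Inr True + v $ Inr False"
  have t: "v $ Inr True = (a + b) / 2" "v $ Inr False = (a - b) / 2"
    using b(1) by (simp_all add: a_def lc_b_def)
  have "(norm (spart v))\<^sup>2 + s\<^sup>2 = a * b"
    using assms(3) by (simp add: mform_mink t power2_norm_eq_inner[symmetric]) (simp add: power2_eq_square field_simps)
  then have "((norm (spart v))\<^sup>2 + s\<^sup>2) / b\<^sup>2 = a / b" using b(2) by (simp add: power2_eq_square)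
  then have *: "(norm ((1 / b) *\<^sub>R spart v))\<^sup>2 + (s / b)\<^sup>2 = a / b"
    by (simp add: power_divide add_divide_distrib)
  show ?thesis
  proof (rule mink_eqI)
    show "v $ Inr False = (b *\<^sub>R mink_vec ((1 / b) *\<^sub>R spart v, s / b)) $ Inr False"
      using b(2) * unfolding t by (simp add: right_diff_distrib)
    show "v $ Inr True = (b *\<^sub>R mink_vec ((1 / b) *\<^sub>R spart v, s / b)) $ Inr True"
      using b(2) * unfolding t by (simp add: distrib_left)
  qed (use b in simp)
qed

section \<open>The celestial sphere as a model of the boundary\<close>

definition tnorm :: "'d::finite mink \<Rightarrow> 'd mink" where
  "tnorm v = (1 / v $ Inr True) *\<^sub>R v"

text \<open>Boundary points are null lines; normalising their time coordinate to 1 turns the boundary into a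
  compact subset of Minkowski space.\<close>

definition celestial :: "'d::finite mink set" where
  "celestial = {v. mform v v = 0 \<and> v $ Inr True = 1}"

definition ray :: "'d::finite bdry \<Rightarrow> 'd mink" where
  "ray \<xi> = tnorm (bdry_vec \<xi>)"

lemma pos_sq1: "0 < (norm (x::'a::real_normed_vector))\<^sup>2 + 1" "(norm x)\<^sup>2 + 1 \<noteq> 0"
proof -
  show "0 < (norm x)\<^sup>2 + 1" by (rule add_nonneg_pos) auto
  then show "(norm x)\<^sup>2 + 1 \<noteq> 0" by linarith
qed

lemma ray_None: "ray None = qinf"
  by (simp add: ray_def bdry_vec_None tnorm_def)

lemma ray_Some: "ray (Some x) = (2 / ((norm x)\<^sup>2 + 1)) *\<^sub>R lift x"
  by (simp add: ray_def bdry_vec_Some tnorm_def)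

lemma lift_null [simp]: "mform (lift x) (lift x) = 0"
  by (simp add: mform_mink_vec_self)

lemma qinf_null [simp]: "mform qinf qinf = 0"
  by (simp add: mform_mink)

lemma tnorm_celestial: "mform v v = 0 \<Longrightarrow> v $ Inr True \<noteq> 0 \<Longrightarrow> tnorm v \<in> celestial"
  by (simp add: tnorm_def celestial_def mform_linear)

lemma bdry_vec_null: "mform (bdry_vec \<xi>) (bdry_vec \<xi>) = 0" "bdry_vec \<xi> $ Inr True > 0"
proof -
  show "mform (bdry_vec \<xi>) (bdry_vec \<xi>) = 0"
    by (cases \<xi>) (simp_all add: bdry_vec_None bdry_vec_Some)
  show "bdry_vec \<xi> $ Inr True > 0"
  proof (cases \<xi>)
    case (Some x)
    then show ?thesis using pos_sq1(1)[of x] by (simp add: bdry_vec_Some)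
  qed (simp add: bdry_vec_None)
qed

lemma ray_celestial: "ray \<xi> \<in> celestial"
  unfolding ray_def using bdry_vec_null[of \<xi>] by (intro tnorm_celestial) auto

text \<open>The difference has time coordinate 0, and on such vectors the Lorentz form is the
  Euclidean one. Convergence of rays thus amounts to a Lorentz product tending to 0.\<close>

lemma celestial_dist: "u \<in> celestial \<Longrightarrow> v \<in> celestial \<Longrightarrow> - mform u v = (norm (u - v))\<^sup>2 / 2"
proof -
  assume u: "u \<in> celestial" "v \<in> celestial"
  have "(norm (u - v))\<^sup>2 = mform (u - v) (u - v)"
    using u by (simp add: mform_def celestial_def power2_norm_eq_inner)
  also have "\<dots> = - 2 * mform u v"
    using u by (simp add: mform_linear celestial_def mform_sym)
  finally show ?thesis by simp
qed

lemma celestial_mform_neg: "u \<in> celestial \<Longrightarrow> v \<in> celestial \<Longrightarrow> u \<noteq> v \<Longrightarrow> mform u v < 0"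
proof -
  assume *: "u \<in> celestial" "v \<in> celestial" "u \<noteq> v"
  then have "(norm (u - v))\<^sup>2 > 0" by simp
  then show ?thesis using celestial_dist[OF *(1,2)] by linarith
qed

lemma celestial_mform_eq0: "u \<in> celestial \<Longrightarrow> v \<in> celestial \<Longrightarrow> mform u v = 0 \<longleftrightarrow> u = v"
  using celestial_mform_neg[of u v] by (fastforce simp: celestial_def)

lemma compact_celestial: "compact (celestial :: 'd::finite mink set)"
proof -
  have "closed (celestial :: 'd mink set)"
    unfolding celestial_def by (intro closed_Collect_conj closed_Collect_eq continuous_intros)
  moreover have "bounded (celestial :: 'd mink set)"
  proof (rule boundedI)
    fix v :: "'d mink" assume "v \<in> celestial"
    then have "v \<bullet> v = 2" by (simp add: celestial_def mform_def)
    then show "norm v \<le> sqrt 2" by (simp add: norm_eq_sqrt_inner)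
  qed
  ultimately show ?thesis by (simp add: compact_eq_bounded_closed)
qed

lemma celestial_surj: assumes "v \<in> celestial" shows "\<exists>\<xi>. v = ray \<xi>"
proof (cases "lc_b v = 0")
  case True
  then have F: "v $ Inr False = 1" using assms by (simp add: lc_b_def celestial_def)
  then have "spart v \<bullet> spart v = 0" using assms unfolding celestial_def by (auto simp: mform_mink)
  then have "spart v = 0" by simp
  then have "v = ray None" unfolding ray_None
    by (intro mink_eqI) (use F assms in \<open>auto simp: celestial_def\<close>)
  then show ?thesis by blast
next
  case False
  define x where "x = (1 / lc_b v) *\<^sub>R spart v"
  have v: "v = lc_b v *\<^sub>R lift x"
    using mink_vec_unique[OF refl False, of 0] assms by (simp add: x_def celestial_def)
  have "v $ Inr True = 1" using assms by (simp add: celestial_def)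
  then have "1 = lc_b v * (((norm x)\<^sup>2 + 1) / 2)" by (subst (asm) v) simp
  then have "lc_b v = 2 / ((norm x)\<^sup>2 + 1)" using pos_sq1(2)[of x] by (simp add: field_simps)
  then have "v = ray (Some x)" using v by (simp add: ray_Some)
  then show ?thesis by blast
qed

lemma ray_inj: "ray \<xi> = ray \<zeta> \<longleftrightarrow> \<xi> = \<zeta>"
proof
  assume *: "ray \<xi> = ray \<zeta>"
  have 0: "lc_b (ray (Some x)) = 2 / ((norm x)\<^sup>2 + 1)" for x :: "real^'a"
    by (simp add: ray_Some lc_b_linear)
  have 1: "lc_b (ray (None::'a bdry)) = 0" by (simp add: ray_None lc_b_def)
  show "\<xi> = \<zeta>"
  proof (cases \<xi>)
    case None
    show ?thesis
    proof (rule ccontr)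
      assume "\<xi> \<noteq> \<zeta>" then obtain y where "\<zeta> = Some y" using None by (cases \<zeta>) auto
      then show False using * None 0[of y] 1 pos_sq1[of y] by simp
    qed
  next
    case (Some x)
    show ?thesis
    proof (cases \<zeta>)
      case None then show ?thesis using * Some 0[of x] 1 pos_sq1[of x] by simp
    next
      case (Some y)
      have e: "2 / ((norm x)\<^sup>2 + 1) = 2 / ((norm y)\<^sup>2 + 1)" using * \<open>\<xi> = Some x\<close> Some 0 by metis
      have "spart (ray \<xi>) = spart (ray \<zeta>)" using * by simp
      then have "x = y" using \<open>\<xi> = Some x\<close> Some e pos_sq1[of y] by (simp add: ray_Some)
      then show ?thesis using Some \<open>\<xi> = Some x\<close> by simp
    qed
  qed
qed simp

text \<open>Lifts of an open set span Minkowski space: for nonzero \<open>n\<close> the zero set is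
  at most a sphere or hyperplane and has empty interior.\<close>

lemma mform_lift_zero_on_open:
  assumes W: "open W" "W \<noteq> {}" and z: "\<And>y. y \<in> W \<Longrightarrow> mform n (lift y) = 0"
  shows "n = 0"
proof -
  obtain x where "x \<in> W" using W by blast
  then obtain r where r: "r > 0" "ball x r \<subseteq> W" using W openE by blast
  define P where "P s e = mform n (lift (x + s *\<^sub>R e))" for s e
  define c where "c = n $ Inr False - n $ Inr True"
  have P: "P s e = P 0 e + s * (e \<bullet> spart n + c * (x \<bullet> e)) + s\<^sup>2 * (e \<bullet> e) * c / 2" for s e
    unfolding P_def c_def
    by (simp add: mform_sym[of n] mform_lift_mink_vec power2_norm_eq_inner inner_simps inner_commute)
       (simp add: field_simps power2_eq_square)
  have P0: "P s e = 0" if "\<bar>s\<bar> * norm e < r" for s e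
  proof -
    have "x + s *\<^sub>R e \<in> ball x r" using that by (simp add: dist_norm)
    then show ?thesis using r z unfolding P_def by blast
  qed
  have key: "(e \<bullet> spart n + c * (x \<bullet> e)) = 0 \<and> (e \<bullet> e) * c = 0" if "norm e < r" for e
  proof -
    have "P 1 e = 0" "P 0 e = 0" "P (-1) e = 0" using that r by (auto intro!: P0)
    then have "e \<bullet> spart n + c * (x \<bullet> e) + (e \<bullet> e) * c / 2 = 0"
        "- (e \<bullet> spart n + c * (x \<bullet> e)) + (e \<bullet> e) * c / 2 = 0"
      using P[of 1 e] P[of "-1" e] by simp_all
    then show ?thesis by linarith
  qed
  obtain u :: "real^'a" where u: "norm u = r/2" using vector_choose_size[of "r/2"] r by auto
  have "u \<bullet> u \<noteq> 0" using u r by auto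
  moreover have "norm u < r" using u r by simp
  ultimately have c0: "c = 0" using key[of u] by auto
  have *: "e \<bullet> spart n = 0" for e
  proof -
    show ?thesis
    proof (cases "e = 0")
      case False
      then have "norm ((r / (2 * norm e)) *\<^sub>R e) < r" using r by simp
      then have "((r / (2 * norm e)) *\<^sub>R e) \<bullet> spart n = 0"
        using key[of "(r / (2 * norm e)) *\<^sub>R e"] c0 by simp
      then show ?thesis using False r by simp
    qed simp
  qed
  then have s0: "spart n = 0" using inner_eq_zero_iff by blast
  have "mform n (lift x) = 0" using z \<open>x \<in> W\<close> by blast
  then have "n $ Inr True = 0" using s0 c0
    by (simp add: mform_sym[of n] mform_lift_mink_vec c_def field_simps)
  then show ?thesis using s0 c0 by (intro mink_eqI) (auto simp: c_def)
qed

section \<open>The Lorentz group and its action on the boundary\<close>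

lemma inner_lorentz_form: "u \<bullet> (lorentz_form *v v) = mform u v"
proof -
  have "(lorentz_form *v v) $ i = (if i = Inr True then - v $ i else v $ i)" for i
    by (simp add: lorentz_form_def matrix_vector_mult_def if_distrib[of "\<lambda>x. x * _"] sum.delta' cong: if_cong)
  then have "lorentz_form *v v = mink_of (spart v) (v $ Inr False) (- v $ Inr True)"
    by (intro mink_eqI) (simp_all add: spart_def)
  then show ?thesis by (simp add: inner_mink mform_mink)
qed

lemma lorentz_form_sq: "lorentz_form ** lorentz_form = (mat 1 :: 'd::finite mat)"
proof -
  have "(lorentz_form :: 'd mat) *v (lorentz_form *v v) = v" for v
  proof -
    have *: "u \<bullet> (lorentz_form *v v) = (lorentz_form *v u) \<bullet> v" for u v :: "'d mink"
      using inner_lorentz_form mform_sym inner_commute by metis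
    have **: "lorentz_form *v v = mink_of (spart v) (v $ Inr False) (- v $ Inr True)" for v :: "'d mink"
    proof -
      have "u \<bullet> (lorentz_form *v v) = u \<bullet> mink_of (spart v) (v $ Inr False) (- v $ Inr True)" for u
        unfolding inner_lorentz_form by (simp add: inner_mink mform_mink)
      then show ?thesis using vector_eq_ldot by blast
    qed
    show ?thesis unfolding ** by (rule mink_eqI) auto
  qed
  then show ?thesis by (simp add: matrix_eq matrix_vector_mul_assoc[symmetric])
qed

lemma preserves_mform_iff:
  "transpose g ** lorentz_form ** g = (lorentz_form :: 'd::finite mat) \<longleftrightarrow>
   (\<forall>u v. mform (g *v u) (g *v v) = mform u v)"
proof -
  have *: "mform (g *v u) (g *v v) = u \<bullet> ((transpose g ** lorentz_form ** g) *v v)" for u v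
  proof -
    have "mform (g *v u) (g *v v) = (g *v u) \<bullet> (lorentz_form *v (g *v v))"
      by (simp add: inner_lorentz_form)
    also have "\<dots> = u \<bullet> (transpose g *v (lorentz_form *v (g *v v)))"
      by (metis dot_lmul_matrix inner_commute transpose_matrix_vector)
    finally show ?thesis by (simp add: matrix_vector_mul_assoc matrix_mul_assoc)
  qed
  show ?thesis
  proof
    assume "\<forall>u v. mform (g *v u) (g *v v) = mform u v"
    then have "u \<bullet> ((transpose g ** lorentz_form ** g) *v v) = u \<bullet> (lorentz_form *v v)" for u v
      by (simp add: inner_lorentz_form flip: *)
    then show "transpose g ** lorentz_form ** g = lorentz_form"
      by (metis matrix_eq vector_eq_ldot)
  qed (simp add: * inner_lorentz_form)
qed

lemma SO_mform: "g \<in> SO \<Longrightarrow> mform (g *v u) (g *v v) = mform u v"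
  using preserves_mform_iff by (auto simp: SO_def)

lemma SO_I: "(\<And>u v. mform (g *v u) (g *v v) = mform u v) \<Longrightarrow> det g = 1 \<Longrightarrow> g \<in> SO"
  using preserves_mform_iff by (auto simp: SO_def)

text \<open>The Lorentz adjoint. It agrees with \<open>matrix_inv\<close> on \<open>SO\<close>, but
  is given by a formula that is visibly continuous, as the connectedness and limit arguments
  need.\<close>

definition linv :: "'d::finite mat \<Rightarrow> 'd mat" where
  "linv g = lorentz_form ** transpose g ** lorentz_form"

lemma linv_left: assumes "g \<in> SO" shows "linv g ** g = mat 1"
proof -
  have "linv g ** g = lorentz_form ** (transpose g ** lorentz_form ** g)"
    by (simp add: linv_def matrix_mul_assoc)
  then show ?thesis using assms by (simp add: SO_def lorentz_form_sq)
qed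

lemma linv_right: assumes "g \<in> SO" shows "g ** linv g = mat 1"
  using linv_left[OF assms] matrix_left_right_inverse by blast

lemma matrix_inv_SO: assumes "g \<in> SO" shows "matrix_inv g = linv g"
proof -
  have "invertible g" unfolding invertible_def using linv_left[OF assms] linv_right[OF assms]
    by blast
  then have "g ** matrix_inv g = mat 1" "matrix_inv g ** g = mat 1"
    unfolding matrix_inv_def invertible_def by (metis (mono_tags, lifting) someI_ex)+
  then show ?thesis using linv_left[OF assms]
    by (metis matrix_mul_assoc matrix_mul_lid matrix_mul_rid)
qed

lemma SO_mult: "g \<in> SO \<Longrightarrow> h \<in> SO \<Longrightarrow> g ** h \<in> SO"
  by (rule SO_I) (simp_all add: SO_mform det_mul flip: matrix_vector_mul_assoc, simp add: SO_def)

lemma SO_one: "mat 1 \<in> SO"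
  by (rule SO_I) auto

lemma SO_inv: assumes "g \<in> SO" shows "linv g \<in> SO"
proof (rule SO_I)
  fix u v
  have "g *v (linv g *v u) = u" for u
    using linv_right[OF assms] by (simp add: matrix_vector_mul_assoc)
  then show "mform (linv g *v u) (linv g *v v) = mform u v"
    using SO_mform[OF assms, of "linv g *v u" "linv g *v v"] by simp
next
  have "det (linv g) * det g = 1"
    using linv_left[OF assms] by (metis det_I det_mul)
  then show "det (linv g) = 1" using assms by (simp add: SO_def)
qed

lemma SO0_SO: "g \<in> carrier SO0 \<Longrightarrow> g \<in> SO"
  using connected_component_subset by (fastforce simp: SO0_def)

lemma SO0_connectedI:
  assumes "connected C" "C \<subseteq> SO" "a \<in> C" "a \<in> carrier SO0" "b \<in> C"
  shows "b \<in> carrier SO0"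
proof -
  have "connected_component_set SO (mat 1) = connected_component_set SO a"
    using assms(4) by (simp add: SO0_def connected_component_eq)
  moreover have "C \<subseteq> connected_component_set SO a"
    using assms by (intro connected_component_maximal) auto
  ultimately show ?thesis using assms(5) by (auto simp: SO0_def)
qed

lemma SO0_one [simp]: "mat 1 \<in> carrier SO0"
  using SO_one by (simp add: SO0_def connected_component_refl)

lemma connected_SO0: "connected (carrier SO0)"
  by (simp add: SO0_def)

lemma continuous_on_matrix_mult [continuous_intros]:
  fixes f :: "'a::topological_space \<Rightarrow> real^'n^'m" and g :: "'a \<Rightarrow> real^'k^'n"
  assumes "continuous_on S f" "continuous_on S g"
  shows "continuous_on S (\<lambda>x. f x ** g x)"
  unfolding matrix_matrix_mult_def
  by (intro continuous_on_vec_lambda continuous_intros assms)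

lemma continuous_on_transpose [continuous_intros]:
  fixes f :: "'a::topological_space \<Rightarrow> real^'n^'m"
  assumes "continuous_on S f"
  shows "continuous_on S (\<lambda>x. transpose (f x))"
  unfolding transpose_def
  by (intro continuous_on_vec_lambda continuous_intros assms)

lemma continuous_on_matrix_vector [continuous_intros]:
  fixes f :: "'a::topological_space \<Rightarrow> real^'n^'m"
  assumes "continuous_on S f" "continuous_on S g"
  shows "continuous_on S (\<lambda>x. f x *v g x)"
  unfolding matrix_vector_mult_def
  by (intro continuous_on_vec_lambda continuous_intros assms)

lemma SO0_mult: assumes "g \<in> carrier SO0" "h \<in> carrier SO0" shows "g ** h \<in> carrier SO0"
proof (rule SO0_connectedI)
  show "connected ((\<lambda>k. g ** k) ` carrier SO0)"
    by (intro connected_continuous_image connected_SO0 continuous_intros)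
  show "(\<lambda>k. g ** k) ` carrier SO0 \<subseteq> SO"
    using assms SO0_SO SO_mult by blast
  show "g \<in> (\<lambda>k. g ** k) ` carrier SO0"
    by (rule image_eqI[OF _ SO0_one]) simp
qed (use assms in auto)

lemma SO0_linv: assumes "g \<in> carrier SO0" shows "linv g \<in> carrier SO0"
proof (rule SO0_connectedI)
  show "connected (linv ` carrier SO0)"
    unfolding linv_def by (intro connected_continuous_image connected_SO0 continuous_intros)
  show "linv ` carrier SO0 \<subseteq> SO"
    using assms SO0_SO SO_inv by blast
  show "mat 1 \<in> linv ` carrier SO0"
    by (rule image_eqI[of _ _ "mat 1"]) (simp_all add: linv_def lorentz_form_sq transpose_mat)
qed (use assms in auto)

lemma SO0_inv: "g \<in> carrier SO0 \<Longrightarrow> matrix_inv g \<in> carrier SO0"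
  by (simp add: SO0_SO SO0_linv matrix_inv_SO)

lemma SO0_inv_cancel:
  assumes "g \<in> carrier SO0"
  shows "matrix_inv g ** g = mat 1" "g ** matrix_inv g = mat 1"
    "matrix_inv g *v (g *v v) = v" "g *v (matrix_inv g *v v) = v"
  using linv_left[OF SO0_SO[OF assms]] linv_right[OF SO0_SO[OF assms]]
  by (simp_all add: matrix_inv_SO[OF SO0_SO[OF assms]] matrix_vector_mul_assoc)

lemma group_SO0: "group (SO0 :: 'd::finite mat monoid)"
proof (rule groupI)
  fix x :: "'d mat" assume x: "x \<in> carrier SO0"
  show "\<exists>y\<in>carrier SO0. y \<otimes>\<^bsub>SO0\<^esub> x = \<one>\<^bsub>SO0\<^esub>"
    using SO0_inv[OF x] SO0_inv_cancel[OF x]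
    by (auto simp: SO0_def intro!: bexI[of _ "matrix_inv x"])
next
  show "x \<otimes>\<^bsub>SO0\<^esub> y \<in> carrier SO0" if "x \<in> carrier SO0" "y \<in> carrier SO0" for x y :: "'d mat"
    using SO0_mult[OF that] by (simp add: SO0_def)
  show "\<one>\<^bsub>SO0\<^esub> \<in> carrier (SO0 :: 'd mat monoid)" using SO0_one by (simp add: SO0_def)
qed (auto simp: SO0_def matrix_mul_assoc)

lemma subgroup_SO0D:
  assumes "subgroup \<Gamma> SO0"
  shows "\<Gamma> \<subseteq> carrier SO0" "mat 1 \<in> \<Gamma>"
    "g \<in> \<Gamma> \<Longrightarrow> h \<in> \<Gamma> \<Longrightarrow> g ** h \<in> \<Gamma>" "g \<in> \<Gamma> \<Longrightarrow> matrix_inv g \<in> \<Gamma>"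
proof -
  show s: "\<Gamma> \<subseteq> carrier SO0" using assms by (rule subgroup.subset)
  show "mat 1 \<in> \<Gamma>" using subgroup.one_closed[OF assms] by (simp add: SO0_def)
  show "g \<in> \<Gamma> \<Longrightarrow> h \<in> \<Gamma> \<Longrightarrow> g ** h \<in> \<Gamma>"
    using subgroup.m_closed[OF assms, of g h] by (simp add: SO0_def)
  show "matrix_inv g \<in> \<Gamma>" if g: "g \<in> \<Gamma>"
  proof -
    have g0: "g \<in> carrier SO0" using g s by blast
    have "inv\<^bsub>SO0\<^esub> g = matrix_inv g"
      by (rule group.inv_equality[OF group_SO0 _ g0 SO0_inv[OF g0]])
        (use SO0_inv_cancel(1)[OF g0] in \<open>simp add: SO0_def\<close>)
    then show ?thesis using subgroup.m_inv_closed[OF assms g] by simp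
  qed
qed

lemma SO0_mform: "g \<in> carrier SO0 \<Longrightarrow> mform (g *v u) (g *v v) = mform u v"
  by (simp add: SO0_SO SO_mform)

lemma SO0_mform_inv: "g \<in> carrier SO0 \<Longrightarrow> mform (g *v u) v = mform u (matrix_inv g *v v)"
  by (metis SO0_inv_cancel(4) SO0_mform)

lemma e_T_form: "mform v e_T = - v $ Inr True" "mform e_T v = - v $ Inr True"
  by (simp_all add: mform_mink)

text \<open>The vector \<open>g *v e_T\<close> lies on a two-sheeted hyperboloid, where the square
  of the time coordinate is at least 1. By connectedness it cannot leave the sheet on which it lies
  for the identity.\<close>

lemma SO0_TT: assumes "g \<in> carrier SO0" shows "(g *v e_T) $ Inr True \<ge> 1"
proof (rule ccontr)
  assume less: "\<not> (g *v e_T) $ Inr True \<ge> 1"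
  let ?f = "\<lambda>g::'a mat. (g *v e_T) $ Inr True"
  have sq: "(?f h)\<^sup>2 \<ge> 1" if "h \<in> carrier SO0" for h
  proof -
    have "mform (h *v e_T) (h *v e_T) = -1" using SO0_mform[OF that] by (simp add: e_T_form)
    then have "(?f h)\<^sup>2 = 1 + (spart (h *v e_T) \<bullet> spart (h *v e_T) + ((h *v e_T) $ Inr False)\<^sup>2)"
      by (simp add: mform_mink power2_eq_square)
    then show ?thesis by simp
  qed
  have c: "connected (?f ` carrier SO0)"
    by (intro connected_continuous_image connected_SO0 continuous_intros)
  have "?f g < 1" "1 \<le> (?f g)\<^sup>2" using less sq[OF assms] by auto
  then have "?f g \<le> 0"
    by (smt (verit) power2_eq_1_iff power_le_one power2_less_imp_less one_power2 power_mono_iff)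
  moreover have "?f (mat 1) = 1" by simp
  ultimately have "0 \<in> ?f ` carrier SO0"
    using connectedD_interval[OF c, of "?f g" "?f (mat 1)" 0] assms imageI[OF SO0_one, of ?f]
    by auto
  then show False using sq by force
qed

text \<open>The reverse Cauchy-Schwarz inequality: in the forward cone the space part is no longer
  than the time coordinate, strictly shorter for a timelike vector.\<close>

lemma mform_timelike_neg:
  assumes "mform u u \<le> 0" "u $ Inr True > 0" "mform v v < 0" "v $ Inr True > 0"
  shows "mform u v < 0"
proof -
  let ?u = "u - (u $ Inr True) *\<^sub>R e_T" and ?v = "v - (v $ Inr True) *\<^sub>R e_T"
  have uv: "mform u v = ?u \<bullet> ?v - u $ Inr True * v $ Inr True"
    by (simp add: mform_mink inner_mink)
  have sq: "(norm (u - (u $ Inr True) *\<^sub>R e_T))\<^sup>2 = mform u u + (u $ Inr True)\<^sup>2" for u :: "'a mink"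
  proof -
    define w where "w = u - (u $ Inr True) *\<^sub>R e_T"
    have w: "spart w = spart u" "w $ Inr False = u $ Inr False" "w $ Inr True = 0"
      by (simp_all add: w_def)
    have "w \<bullet> w = mform u u + u $ Inr True * u $ Inr True"
      unfolding inner_mink[of w w] mform_mink[of u u] w by simp
    then show ?thesis
      unfolding w_def[symmetric] power2_norm_eq_inner power2_eq_square[of "u $ Inr True"] .
  qed
  have "(norm ?u)\<^sup>2 = mform u u + (u $ Inr True)\<^sup>2" by (rule sq)
  then have u: "norm ?u \<le> u $ Inr True" 
    using assms(1,2) power2_le_imp_le[of "norm ?u" "u $ Inr True"] by linarith
  have "(norm ?v)\<^sup>2 = mform v v + (v $ Inr True)\<^sup>2" by (rule sq)
  then have v: "norm ?v < v $ Inr True" 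
    using assms(3,4) power2_less_imp_less[of "norm ?v" "v $ Inr True"] by linarith
  have "?u \<bullet> ?v \<le> norm ?u * norm ?v" by (rule norm_cauchy_schwarz)
  also have "\<dots> \<le> u $ Inr True * norm ?v" using u by (intro mult_right_mono) auto
  also have "\<dots> < u $ Inr True * v $ Inr True" using v assms(2) by (intro mult_strict_left_mono)
  finally show ?thesis using uv by simp
qed

text \<open>By invariance the time coordinate of \<open>g *v v\<close> is minus the product of
  \<open>v\<close> with the forward timelike vector \<open>matrix_inv g *v e_T\<close>.\<close>

lemma SO0_forward:
  assumes g: "g \<in> carrier SO0" and v: "mform v v \<le> 0" "v $ Inr True > 0"
  shows "(g *v v) $ Inr True > 0"
proof -
  let ?u = "matrix_inv g *v e_T"
  have u: "mform ?u ?u < 0" "?u $ Inr True > 0"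
    using SO0_TT[OF SO0_inv[OF g]] SO0_mform[OF SO0_inv[OF g]] by (simp_all add: e_T_form)
  have "- (g *v v) $ Inr True = mform v ?u"
    using SO0_mform_inv[OF g, of v e_T] by (simp add: e_T_form)
  then show ?thesis using mform_timelike_neg[OF v u] by linarith
qed

lemma null_lc_b_nonneg:
  assumes "mform v v = 0" "v $ Inr True > 0" shows "lc_b v \<ge> 0"
proof -
  have "(v $ Inr False)\<^sup>2 \<le> (v $ Inr True)\<^sup>2"
    using assms(1) inner_ge_zero[of "spart v"] unfolding mform_mink power2_eq_square by linarith
  then have "\<bar>v $ Inr False\<bar> \<le> v $ Inr True"
    using assms(2) by (metis abs_le_square_iff abs_of_pos)
  then show ?thesis by (simp add: lc_b_def)
qed

lemma null_cases:
  assumes "mform v v = 0" "v $ Inr True > 0"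
  shows "lc_b v = 0 \<Longrightarrow> v = (v $ Inr True) *\<^sub>R qinf"
    "lc_b v \<noteq> 0 \<Longrightarrow> lc_b v > 0 \<and> v = lc_b v *\<^sub>R lift ((1 / lc_b v) *\<^sub>R spart v)"
proof -
  assume "lc_b v = 0"
  then have F: "v $ Inr False = v $ Inr True" by (simp add: lc_b_def)
  then have "spart v \<bullet> spart v = 0" using assms by (simp add: mform_mink)
  then have "spart v = 0" by simp
  then show "v = (v $ Inr True) *\<^sub>R qinf" by (intro mink_eqI) (use F in auto)
next
  assume "lc_b v \<noteq> 0"
  then show "lc_b v > 0 \<and> v = lc_b v *\<^sub>R lift ((1 / lc_b v) *\<^sub>R spart v)"
    using mink_vec_unique[OF refl, of v 0] assms null_lc_b_nonneg[OF assms] by simp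
qed

lemma tnorm_scaleR: "c \<noteq> 0 \<Longrightarrow> tnorm (c *\<^sub>R v) = tnorm v"
  by (simp add: tnorm_def)

text \<open>The bridge from \<open>bact\<close> to linear algebra: the group laws, continuity and
  measurability of the boundary action are all derived from it.\<close>

lemma ray_bact:
  assumes "g \<in> carrier SO0"
  shows "ray (bact g \<xi>) = tnorm (g *v bdry_vec \<xi>)" "ray (bact g \<xi>) = tnorm (g *v ray \<xi>)"
proof -
  let ?v = "g *v bdry_vec \<xi>"
  have v: "mform ?v ?v = 0" "?v $ Inr True > 0"
    using SO0_mform[OF assms] SO0_forward[OF assms] bdry_vec_null[of \<xi>] by simp_all
  show "ray (bact g \<xi>) = tnorm ?v"
  proof (cases "lc_b ?v = 0")
    case True
    then have "tnorm ?v = tnorm qinf" using null_cases(1)[OF v True] tnorm_scaleR v(2)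
      by (metis less_irrefl)
    then show ?thesis using True by (simp add: bact_def ray_def bdry_vec_None)
  next
    case False
    have "bact g \<xi> = Some ((1 / lc_b ?v) *\<^sub>R spart ?v)"
      using False by (simp add: bact_def Let_def spart_def vec_eq_iff)
    moreover have "tnorm ?v = tnorm (lift ((1 / lc_b ?v) *\<^sub>R spart ?v))"
      using null_cases(2)[OF v False] tnorm_scaleR[OF False] by metis
    ultimately show ?thesis by (simp add: ray_def bdry_vec_Some)
  qed
  then show "ray (bact g \<xi>) = tnorm (g *v ray \<xi>)"
    using bdry_vec_null(2)[of \<xi>] unfolding ray_def tnorm_def[of "bdry_vec \<xi>"]
    by (simp add: matrix_vector_mult_scaleR tnorm_scaleR)
qed

lemma bact_one [simp]: "bact (mat 1) \<xi> = \<xi>"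
  using ray_bact(1)[OF SO0_one, of \<xi>] by (simp add: ray_inj flip: ray_def)

lemma bact_mult:
  assumes "g \<in> carrier SO0" "h \<in> carrier SO0"
  shows "bact (g ** h) \<xi> = bact g (bact h \<xi>)"
proof -
  let ?v = "h *v bdry_vec \<xi>"
  have v: "?v $ Inr True > 0"
    using SO0_forward[OF assms(2)] bdry_vec_null[of \<xi>] by simp_all
  have "ray (bact g (bact h \<xi>)) = tnorm (g *v tnorm ?v)"
    using ray_bact assms by metis
  also have "\<dots> = tnorm (g *v ?v)"
    using v unfolding tnorm_def[of ?v] by (simp add: matrix_vector_mult_scaleR tnorm_scaleR)
  also have "\<dots> = ray (bact (g ** h) \<xi>)"
    using ray_bact(1)[OF SO0_mult[OF assms]] by (simp add: matrix_vector_mul_assoc)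
  finally show ?thesis by (simp add: ray_inj)
qed

lemma bact_inv:
  assumes "g \<in> carrier SO0"
  shows "bact (matrix_inv g) (bact g \<xi>) = \<xi>" "bact g (bact (matrix_inv g) \<xi>) = \<xi>"
  using bact_mult[OF assms SO0_inv[OF assms]] bact_mult[OF SO0_inv[OF assms] assms]
  by (simp_all add: SO0_inv_cancel[OF assms] flip: bact_mult)

lemma bact_image: "g \<in> carrier SO0 \<Longrightarrow> bact g ` A = bact (matrix_inv g) -` A"
proof (intro equalityI subsetI)
  fix \<xi> assume "g \<in> carrier SO0" "\<xi> \<in> bact (matrix_inv g) -` A"
  then show "\<xi> \<in> bact g ` A" using bact_inv(2)[of g \<xi>]
    by (intro image_eqI[of _ _ "bact (matrix_inv g) \<xi>"]) auto
qed (auto simp: bact_inv)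

lemma matrix_inv_inv: "g \<in> carrier SO0 \<Longrightarrow> matrix_inv (matrix_inv g) = g"
  using SO0_inv_cancel[of g] SO0_inv_cancel[of "matrix_inv g"] SO0_inv[of g]
  by (metis matrix_mul_assoc matrix_mul_lid matrix_mul_rid)

lemma SO0_eigenvector_inv:
  assumes g: "g \<in> carrier SO0" and v: "g *v v = c *\<^sub>R v" and c: "c \<noteq> 0"
  shows "matrix_inv g *v v = (1 / c) *\<^sub>R v"
proof -
  have "v = c *\<^sub>R (matrix_inv g *v v)"
    using SO0_inv_cancel(3)[OF g, of v] by (simp add: v matrix_vector_mult_scaleR)
  then have "(1 / c) *\<^sub>R v = (1 / c) *\<^sub>R (c *\<^sub>R (matrix_inv g *v v))" by (rule arg_cong)
  then show ?thesis using c by simp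
qed

text \<open>The reciprocal of the linear distortion (\<open>lin_dist_bact\<close>), as a Lorentz
  product that is defined everywhere and vanishes exactly where \<open>bact g\<close> takes the
  value \<infinity>.\<close>

definition bfac :: "'d::finite mat \<Rightarrow> real^'d \<Rightarrow> real" where
  "bfac g x = lc_b (g *v lift x)"

definition emap :: "'d::finite mat \<Rightarrow> real^'d \<Rightarrow> real^'d" where
  "emap g x = (1 / bfac g x) *\<^sub>R spart (g *v lift x)"

lemma lift_T: "lift x $ Inr True > 0"
  using pos_sq1(1)[of x] by simp

lemma bfac_nonneg: "g \<in> carrier SO0 \<Longrightarrow> bfac g x \<ge> 0"
  unfolding bfac_def by (rule null_lc_b_nonneg) (simp_all add: SO0_mform SO0_forward lift_T del: spart_mink_vec)

lemma bact_Some: "bact g (Some x) = (if bfac g x = 0 then None else Some (emap g x))"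
  by (simp add: bact_def Let_def bdry_vec_Some emap_def bfac_def spart_def vec_eq_iff)

lemma bact_SomeD: "bact g (Some x) = Some y \<Longrightarrow> bfac g x \<noteq> 0 \<and> y = emap g x"
  by (auto simp: bact_Some split: if_splits)

lemma emap_lift:
  assumes "g \<in> carrier SO0" "bfac g x \<noteq> 0"
  shows "g *v lift x = bfac g x *\<^sub>R lift (emap g x)"
  using null_cases(2)[of "g *v lift x"] SO0_mform[OF assms(1), of "lift x" "lift x"]
    SO0_forward[OF assms(1), of "lift x"] lift_T[of x] assms(2)
  by (simp add: bfac_def emap_def del: spart_mink_vec)

lemma bfac_mform: "bfac g x = - mform (g *v lift x) qinf"
  by (simp add: bfac_def lc_b_mform)

lemma bfac_mform_inv: "g \<in> carrier SO0 \<Longrightarrow> bfac g x = - mform (lift x) (matrix_inv g *v qinf)"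
  by (simp add: bfac_mform SO0_mform_inv)

text \<open>Both lifts are scaled by their conformal factor while their product is preserved. This
  is |gx - gy|^2 = |g'(x)| |g'(y)| |x - y|^2, obtained before any differentiation.\<close>

lemma emap_dist:
  assumes "g \<in> carrier SO0" "bfac g x \<noteq> 0" "bfac g y \<noteq> 0"
  shows "(norm (emap g x - emap g y))\<^sup>2 = (norm (x - y))\<^sup>2 / (bfac g x * bfac g y)"
proof -
  have "mform (lift x) (lift y) = mform (g *v lift x) (g *v lift y)"
    by (simp add: SO0_mform[OF assms(1)])
  also have "\<dots> = bfac g x * bfac g y * mform (lift (emap g x)) (lift (emap g y))"
    by (simp add: emap_lift assms mform_linear)
  finally have "(norm (x - y))\<^sup>2 = bfac g x * bfac g y * (norm (emap g x - emap g y))\<^sup>2"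
    unfolding mform_lift by simp
  then show ?thesis using assms by simp
qed

text \<open>The chain rule for the distortion in algebraic form.\<close>

lemma bfac_mult:
  assumes "g \<in> carrier SO0" "h \<in> carrier SO0" "bfac h x \<noteq> 0"
  shows "bfac (g ** h) x = bfac g (emap h x) * bfac h x"
    "emap (g ** h) x = emap g (emap h x)"
proof -
  show 1: "bfac (g ** h) x = bfac g (emap h x) * bfac h x"
    unfolding bfac_mform[of "g ** h"] bfac_mform[of g]
    by (simp add: matrix_vector_mul_assoc[symmetric] emap_lift[OF assms(2,3)] matrix_vector_mult_scaleR mform_linear)
  have "spart ((g ** h) *v lift x) = bfac h x *\<^sub>R spart (g *v lift (emap h x))"
    by (simp add: matrix_vector_mul_assoc[symmetric] emap_lift[OF assms(2,3)] matrix_vector_mult_scaleR)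
  then show "emap (g ** h) x = emap g (emap h x)"
    unfolding emap_def[of "g ** h"] emap_def[of g] 1 using assms(3) by simp
qed

lemma hact_half_space:
  assumes "g \<in> carrier SO0" "z \<in> half_space"
  shows "hact g z \<in> half_space" "lc_b (g *v mink_vec z) > 0"
    "g *v mink_vec z = lc_b (g *v mink_vec z) *\<^sub>R mink_vec (hact g z)"
proof -
  let ?v = "g *v mink_vec z"
  have z: "snd z > 0" using assms by (simp add: half_space_def)
  have f: "mform ?v ?v = - (snd z)\<^sup>2" by (simp add: SO0_mform[OF assms(1)] mform_mink_vec_self)
  have zT: "mink_vec z $ Inr True > 0" using z by (simp add: add_nonneg_pos)
  have T: "?v $ Inr True > 0"
    by (rule SO0_forward[OF assms(1)]) (use zT in \<open>simp_all add: mform_mink_vec_self\<close>)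
  have "mform qinf ?v < 0"
    by (rule mform_timelike_neg) (use z f T in \<open>auto simp: qinf_null\<close>)
  then show b: "lc_b ?v > 0" by (simp add: lc_b_mform mform_sym)
  have h: "hact g z = ((1 / lc_b ?v) *\<^sub>R spart ?v, snd z / lc_b ?v)"
    by (simp add: hact_def Let_def spart_def vec_eq_iff)
  show "hact g z \<in> half_space" using b z by (simp add: h half_space_def)
  show "?v = lc_b ?v *\<^sub>R mink_vec (hact g z)"
    unfolding h using mink_vec_unique[OF refl _ f] b by simp
qed

section \<open>Zariski density and the limit set\<close>

lemma continuous_on_mink_of [continuous_intros]:
  assumes "continuous_on S f" "continuous_on S a" "continuous_on S b"
  shows "continuous_on S (\<lambda>x. mink_of (f x) (a x) (b x))"
  unfolding mink_of_def
proof (rule continuous_on_vec_lambda)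
  fix i :: "'b + bool"
  show "continuous_on S (\<lambda>x. case i of Inl j \<Rightarrow> f x $ j | Inr s \<Rightarrow> if s then b x else a x)"
    by (cases i; cases "projr i") (auto intro!: continuous_intros assms)
qed

lemma continuous_on_mink_vec [continuous_intros]:
  fixes f :: "'a::topological_space \<Rightarrow> 'd::finite hpt"
  assumes "continuous_on S f"
  shows "continuous_on S (\<lambda>x. mink_vec (f x))"
proof -
  have mv: "mink_vec z = mink_of (fst z) (((norm (fst z))\<^sup>2 + (snd z)\<^sup>2 - 1) / 2) (((norm (fst z))\<^sup>2 + (snd z)\<^sup>2 + 1) / 2)"
    for z :: "'d hpt" by (rule mink_eqI) simp_all
  show ?thesis
    unfolding mv by (intro continuous_intros assms) simp_all
qed

text \<open>Isometries of the form have determinant 1 or -1, and along a path from the identity the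
  sign cannot change. The path then stays in the identity component.\<close>

lemma SO0_pathI:
  fixes L :: "real \<Rightarrow> 'd::finite mink \<Rightarrow> 'd mink"
  assumes lin: "\<And>s. linear (L s)" and form: "\<And>s v w. mform (L s v) (L s w) = mform v w"
    and cont: "\<And>v. continuous_on UNIV (\<lambda>s. L s v)" and L0: "\<And>v. L 0 v = v"
  shows "matrix (L s) \<in> carrier SO0"
proof -
  let ?G = "\<lambda>s. matrix (L s)"
  have G: "?G s *v v = L s v" for s v using lin by (simp add: matrix_works)
  have contG: "continuous_on UNIV ?G"
    unfolding matrix_def by (intro continuous_on_vec_lambda continuous_intros cont)
  have G0: "?G 0 = mat 1" by (simp add: matrix_eq G L0)
  have detsq: "(det (?G s))\<^sup>2 = 1" for s
  proof -
    have "transpose (?G s) ** lorentz_form ** ?G s = lorentz_form"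
      unfolding preserves_mform_iff by (simp add: G form)
    then have "det (?G s) * det (lorentz_form :: 'd mat) * det (?G s) = det (lorentz_form :: 'd mat)"
      by (metis det_mul det_transpose)
    moreover have "det (lorentz_form :: 'd mat) * det (lorentz_form :: 'd mat) = 1"
      using lorentz_form_sq det_I det_mul by metis
    then have "det (lorentz_form :: 'd mat) \<noteq> 0" by auto
    moreover have "d * L * d = L \<Longrightarrow> L \<noteq> 0 \<Longrightarrow> d\<^sup>2 = 1" for d L :: real
    proof -
      assume "d * L * d = L" "L \<noteq> 0"
      then have "(d * d - 1) * L = 0" by (simp add: algebra_simps)
      with \<open>L \<noteq> 0\<close> show "d\<^sup>2 = 1" by (simp add: power2_eq_square)
    qed
    ultimately show ?thesis by blast
  qed
  have contd: "continuous_on UNIV (\<lambda>s. det (?G s))"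
    unfolding det_def by (intro continuous_intros) (use contG in \<open>auto intro!: continuous_intros\<close>)
  have det1: "det (?G s) = 1" for s
  proof (rule ccontr)
    assume "det (?G s) \<noteq> 1"
    then have m: "det (?G s) = -1" using detsq[of s] by (simp add: power2_eq_1_iff)
    have "connected (range (\<lambda>s. det (?G s)))"
      by (rule connected_continuous_image[OF contd]) simp
    moreover have "-1 \<in> range (\<lambda>s. det (?G s))" 
      by (rule image_eqI[of _ _ s]) (simp_all add: m)
    moreover have "1 \<in> range (\<lambda>s. det (?G s))" 
      by (rule image_eqI[of _ _ 0]) (simp_all add: G0)
    ultimately have "0 \<in> range (\<lambda>s. det (?G s))"
      by (rule connectedD_interval) auto
    then obtain t where "det (?G t) = 0" by auto
    then show False using detsq[of t] by simp
  qed
  show ?thesis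
  proof (rule SO0_connectedI)
    show "connected (range ?G)" by (rule connected_continuous_image[OF contG]) simp
    show "range ?G \<subseteq> SO" by (auto intro!: SO_I simp: G form det1)
    show "mat 1 \<in> range ?G" by (rule image_eqI[of _ _ 0]) (simp_all add: G0)
  qed auto
qed

text \<open>In light-cone coordinates b is kept, x becomes x + b u, and \<open>p\<close> is half of
  the increment of a. On lifts this is x \<mapsto> x + u.\<close>

definition translation :: "real^'d::finite \<Rightarrow> 'd mink \<Rightarrow> 'd mink" where
  "translation u v = (let p = spart v \<bullet> u + (u \<bullet> u) * lc_b v / 2 in
     mink_of (spart v + lc_b v *\<^sub>R u) (v $ Inr False + p) (v $ Inr True + p))"

text \<open>Exchanges the two light-cone coordinates, which is inversion in the unit sphere. It
  reverses orientation and therefore enters the group only in pairs.\<close>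

definition flipF :: "'d::finite mink \<Rightarrow> 'd mink" where
  "flipF v = mink_of (spart v) (- v $ Inr False) (v $ Inr True)"

lemma linear_translation: "linear (translation u)"
  by (rule linearI; rule mink_eqI)
     (simp_all add: translation_def Let_def lc_b_linear inner_simps algebra_simps add_divide_distrib)

lemma linear_flipF: "linear flipF"
  by (rule linearI; rule mink_eqI) (simp_all add: flipF_def)

lemma mform_lightcone: "mform v w = spart v \<bullet> spart w - ((v $ Inr True + v $ Inr False) * lc_b w + (w $ Inr True + w $ Inr False) * lc_b v) / 2"
  by (simp add: mform_mink lc_b_def field_simps)

lemma mform_translation: "mform (translation u v) (translation u w) = mform v w"
proof -
  have "lc_b (translation u v) = lc_b v" for v by (simp add: translation_def Let_def lc_b_def)
  then show ?thesis unfolding mform_lightcone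
    by (simp add: translation_def Let_def inner_simps inner_commute algebra_simps add_divide_distrib)
qed

lemma mform_flipF: "mform (flipF v) (flipF w) = mform v w"
  by (simp add: flipF_def mform_mink)

lemma translation_lift: "translation u (lift x) = lift (x + u)"
proof -
  have n: "(norm (x + u))\<^sup>2 = (norm x)\<^sup>2 + 2 * (x \<bullet> u) + u \<bullet> u"
    unfolding power2_norm_eq_inner inner_add_left inner_add_right inner_commute[of u x] by simp
  show ?thesis
  proof (rule mink_eqI)
    show "translation u (lift x) $ Inr False = lift (x + u) $ Inr False"
      unfolding translation_def Let_def lc_b_mink_vec
      by (simp add: n diff_divide_distrib add_divide_distrib)
    show "translation u (lift x) $ Inr True = lift (x + u) $ Inr True"
      unfolding translation_def Let_def lc_b_mink_vec
      by (simp add: n diff_divide_distrib add_divide_distrib)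
  qed (simp add: translation_def Let_def)
qed

lemma translation_SO0: "matrix (translation u) \<in> carrier SO0"
proof -
  have "matrix ((\<lambda>s. translation (s *\<^sub>R u)) 1) \<in> carrier SO0"
  proof (rule SO0_pathI)
    show "linear (translation (s *\<^sub>R u))" for s by (rule linear_translation)
    show "continuous_on UNIV (\<lambda>s. translation (s *\<^sub>R u) v)" for v
      unfolding translation_def Let_def by (intro continuous_intros) auto
    show "translation (0 *\<^sub>R u) v = v" for v
      by (simp add: translation_def mink_of_collapse)
  qed (rule mform_translation)
  then show ?thesis by simp
qed

text \<open>A parabolic map fixing 0 instead of \<infinity>; it is needed to move \<infinity> to a
  finite point.\<close>

lemma conj_translation_SO0: "matrix (flipF \<circ> translation u \<circ> flipF) \<in> carrier SO0"
proof -
  have "matrix ((\<lambda>s. flipF \<circ> translation (s *\<^sub>R u) \<circ> flipF) 1) \<in> carrier SO0"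
  proof (rule SO0_pathI)
    show "linear (flipF \<circ> translation (s *\<^sub>R u) \<circ> flipF)" for s
      by (intro linear_compose linear_translation linear_flipF)
    show "continuous_on UNIV (\<lambda>s. (flipF \<circ> translation (s *\<^sub>R u) \<circ> flipF) v)" for v
    proof -
      have "continuous_on UNIV (\<lambda>s. translation (s *\<^sub>R u) (flipF v))"
        unfolding translation_def Let_def by (intro continuous_intros) auto
      then show ?thesis unfolding comp_def
        using bounded_linear.continuous_on linear_flipF linear_conv_bounded_linear by blast
    qed
    show "(flipF \<circ> translation (0 *\<^sub>R u) \<circ> flipF) v = v" for v
      by (rule mink_eqI) (simp_all add: translation_def flipF_def)
  qed (simp add: mform_translation mform_flipF)
  then show ?thesis by simp
qed

text \<open>Each new \<open>n\<close> shrinks \<open>W\<close> to the open subset where its form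
  does not vanish, nonempty by \<open>mform_lift_zero_on_open\<close>.\<close>

lemma exists_lift_avoiding:
  assumes "finite N" "0 \<notin> N" "open W" "W \<noteq> {}"
  shows "\<exists>y\<in>W. \<forall>n\<in>N. mform n (lift y) \<noteq> 0"
  using assms
proof (induction N arbitrary: W rule: finite_induct)
  case (insert n N)
  let ?W = "{y \<in> W. mform n (lift y) \<noteq> 0}"
  have "open {y. mform n (lift y) \<noteq> 0}"
    by (intro open_Collect_neq continuous_on_mform continuous_on_mink_vec continuous_on_Pair continuous_on_id continuous_on_const)
  then have "open (W \<inter> {y. mform n (lift y) \<noteq> 0})" using insert.prems(2) by (rule open_Int[rotated])
  moreover have "W \<inter> {y. mform n (lift y) \<noteq> 0} = ?W" by blast
  ultimately have "open ?W" by simp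
  moreover have "?W \<noteq> {}"
    using mform_lift_zero_on_open[OF insert.prems(2,3), of n] insert.prems(1) by auto
  ultimately show ?case using insert.IH[of ?W] insert.prems(1) by auto
qed auto

text \<open>Translations are transitive on finite boundary points, so a finite one can be moved off
  all hyperplanes; \<infinity> is made finite first.\<close>

lemma SO0_avoiding:
  assumes N: "finite N" "0 \<notin> N" and v: "v \<in> celestial"
  shows "\<exists>g\<in>carrier SO0. \<forall>n\<in>N. mform n (g *v v) \<noteq> 0"
proof -
  have fin: "\<exists>g\<in>carrier SO0. \<forall>n\<in>N. mform n (g *v (c *\<^sub>R lift x)) \<noteq> 0" if "c \<noteq> 0" for c x
  proof -
    obtain y where y: "\<forall>n\<in>N. mform n (lift y) \<noteq> 0"
      using exists_lift_avoiding[OF N, of UNIV] by auto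
    have "matrix (translation (y - x)) *v (c *\<^sub>R lift x) = c *\<^sub>R lift y"
      by (simp add: matrix_vector_mult_scaleR matrix_works linear_translation translation_lift
          del: matrix_vector_mult_scaleR) (simp add: linear_scale[OF linear_translation] translation_lift)
    then show ?thesis using y that
      by (intro bexI[of _ "matrix (translation (y - x))"]) (auto simp: mform_linear translation_SO0)
  qed
  obtain \<xi> where \<xi>: "v = ray \<xi>" using celestial_surj[OF v] by blast
  show ?thesis
  proof (cases \<xi>)
    case (Some x)
    show ?thesis unfolding \<xi> Some ray_Some
      by (rule fin) (use pos_sq1(2)[of x] in simp)
  next
    case None
    obtain u :: "real^'a" where u: "norm u = 1" using vector_choose_size[of 1] by auto
    define k where "k = matrix (flipF \<circ> translation u \<circ> flipF)"
    have k: "k \<in> carrier SO0" unfolding k_def by (rule conj_translation_SO0)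
    have "linear (flipF \<circ> translation u \<circ> flipF)"
      by (intro linear_compose linear_translation linear_flipF)
    then have "k *v qinf = flipF (translation u (flipF qinf))"
      unfolding k_def by (simp add: matrix_works)
    also have "\<dots> = mink_of (2 *\<^sub>R u) 0 2"
    proof -
      have "u \<bullet> u = 1" using u by (metis norm_eq_1)
      then show ?thesis by (intro mink_eqI) (simp_all add: flipF_def translation_def lc_b_def)
    qed
    finally have kq: "k *v qinf = mink_of (2 *\<^sub>R u) 0 2" .
    have null: "mform (k *v qinf) (k *v qinf) = 0" using k by (simp add: SO0_mform)
    have "lc_b (k *v qinf) \<noteq> 0" "(k *v qinf) $ Inr True > 0"
      unfolding kq by (simp_all add: lc_b_def)
    then obtain c x where c: "c \<noteq> 0" "k *v qinf = c *\<^sub>R lift x"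
      using null_cases(2)[OF null] by blast
    then obtain g where g: "g \<in> carrier SO0" "\<forall>n\<in>N. mform n (g *v (c *\<^sub>R lift x)) \<noteq> 0"
      using fin by blast
    then have "\<forall>n\<in>N. mform n ((g ** k) *v v) \<noteq> 0"
      using c by (simp add: \<xi> None ray_None matrix_vector_mul_assoc[symmetric])
    then show ?thesis using SO0_mult[OF g(1) k] by blast
  qed
qed

text \<open>Zariski density is applied to the product of the forms over \<open>N\<close>, so that
  one \<open>g\<close> serves all of them.\<close>

lemma zariski_dense_prodD:
  assumes zd: "zariski_dense \<Gamma>" and N: "finite N" "0 \<notin> N" and v: "v \<in> celestial"
  shows "\<exists>g\<in>\<Gamma>. \<forall>n\<in>N. mform n (g *v v) \<noteq> 0"
proof (rule ccontr)
  assume neg: "\<not> ?thesis"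
  define f where "f g = (\<Prod>n\<in>N. mform n (g *v v))" for g
  have "real_polynomial_function f"
    unfolding f_def
  proof (rule real_polynomial_function_prod[OF N(1)])
    fix n
    have "linear (\<lambda>g. mform n (g *v v))"
      by (rule linearI) (simp_all add: mform_linear matrix_vector_mult_add_rdistrib scaleR_matrix_vector_assoc[symmetric])
    then show "real_polynomial_function (\<lambda>g. mform n (g *v v))"
      using linear_conv_bounded_linear real_polynomial_function.intros(1) by blast
  qed
  moreover have "\<forall>g\<in>\<Gamma>. f g = 0" using neg N(1) by (auto simp: f_def)
  ultimately have "\<forall>g\<in>carrier SO0. f g = 0" using zd unfolding zariski_dense_def by blast
  then show False using SO0_avoiding[OF N v] N(1) by (auto simp: f_def)
qed

section \<open>The limit set in the projective model\<close>

lemma tnorm_hyperboloid: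
  assumes "g \<in> carrier SO0"
  shows "mform (tnorm (g *v e_T)) (tnorm (g *v e_T)) = - (1 / (g *v e_T) $ Inr True)\<^sup>2"
    "tnorm (g *v e_T) $ Inr True = 1" "tnorm (g *v e_T) \<in> cball 0 (sqrt 2)"
proof -
  let ?w = "tnorm (g *v e_T)"
  show f: "mform ?w ?w = - (1 / (g *v e_T) $ Inr True)\<^sup>2" "?w $ Inr True = 1"
    using SO0_TT[OF assms]
    by (simp_all add: tnorm_def mform_linear SO0_mform[OF assms] e_T_form power2_eq_square)
  have "?w \<bullet> ?w - 2 = - (1 / (g *v e_T) $ Inr True)\<^sup>2" using f by (simp add: mform_def)
  with zero_le_power2[of "1 / (g *v e_T) $ Inr True"] have "?w \<bullet> ?w \<le> 2" by linarith
  then show "?w \<in> cball 0 (sqrt 2)" by (simp add: norm_eq_sqrt_inner)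
qed

text \<open>The orbit of the base point in the slice with time coordinate 1, a projective ball model
  whose boundary sphere is \<open>celestial\<close>.\<close>

definition orbit :: "'d::finite mat set \<Rightarrow> 'd mink set" where
  "orbit \<Gamma> = (\<lambda>g. tnorm (g *v e_T)) ` \<Gamma>"

text \<open>Orbit points are timelike, so intersecting with \<open>celestial\<close> keeps only
  boundary points of the closure.\<close>

definition limit_rays :: "'d::finite mat set \<Rightarrow> 'd mink set" where
  "limit_rays \<Gamma> = celestial \<inter> closure (orbit \<Gamma>)"

lemma tendsto_tnorm [tendsto_intros]:
  assumes "(f \<longlongrightarrow> a) F" "a $ Inr True \<noteq> 0"
  shows "((\<lambda>x. tnorm (f x)) \<longlongrightarrow> tnorm a) F"
  unfolding tnorm_def by (intro tendsto_intros assms)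

lemma tendsto_matrix_vector: "(f \<longlongrightarrow> a) F \<Longrightarrow> ((\<lambda>x. g *v f x) \<longlongrightarrow> g *v a) F"
  for f :: "_ \<Rightarrow> real^'n"
  by (rule bounded_linear.tendsto[OF matrix_vector_mul_bounded_linear])

lemma closed_limit_rays: "closed (limit_rays \<Gamma>)"
  unfolding limit_rays_def using compact_celestial
  by (intro closed_Int) (auto simp: compact_eq_bounded_closed)

lemma tnorm_mult:
  assumes "g \<in> carrier SO0" "mform v v \<le> 0" "v $ Inr True > 0"
  shows "tnorm (g *v tnorm v) = tnorm (g *v v)"
  using assms unfolding tnorm_def[of v] by (simp add: matrix_vector_mult_scaleR tnorm_scaleR)

lemma tnorm_act_celestial: "g \<in> carrier SO0 \<Longrightarrow> v \<in> celestial \<Longrightarrow> tnorm (g *v v) \<in> celestial"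
  using SO0_forward[of g v] by (intro tnorm_celestial) (auto simp: celestial_def SO0_mform)

lemma tnorm_act_mult:
  assumes "g \<in> carrier SO0" "h \<in> carrier SO0" "v \<in> celestial"
  shows "tnorm ((g ** h) *v v) = tnorm (g *v tnorm (h *v v))"
  using tnorm_mult[OF assms(1), of "h *v v"] SO0_forward[OF assms(2), of v] assms
  by (simp add: matrix_vector_mul_assoc celestial_def SO0_mform)

lemma act_closure:
  assumes g: "g \<in> carrier SO0" and v: "v \<in> celestial" "v \<in> closure S"
    and S: "\<And>u. u \<in> S \<Longrightarrow> tnorm (g *v u) \<in> S"
  shows "tnorm (g *v v) \<in> closure S"
proof -
  obtain f where f: "\<forall>n. f n \<in> S" "f \<longlonglongrightarrow> v" using v(2) unfolding closure_sequential by blast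
  have T: "(g *v v) $ Inr True > 0" using SO0_forward[OF g, of v] v(1) by (simp add: celestial_def)
  have "(\<lambda>n. tnorm (g *v f n)) \<longlonglongrightarrow> tnorm (g *v v)"
    by (intro tendsto_tnorm tendsto_matrix_vector f) (use T in simp)
  then show ?thesis unfolding closure_sequential
    by (intro exI[of _ "\<lambda>n. tnorm (g *v f n)"] conjI allI S) (use f in simp)
qed

lemma limit_rays_invariant:
  assumes \<Gamma>: "subgroup \<Gamma> SO0" and "\<gamma> \<in> \<Gamma>" "v \<in> limit_rays \<Gamma>"
  shows "tnorm (\<gamma> *v v) \<in> limit_rays \<Gamma>"
proof -
  note G = subgroup_SO0D[OF \<Gamma>]
  have g0: "\<gamma> \<in> carrier SO0" using G(1) assms(2) by blast
  have v: "v \<in> celestial" "v \<in> closure (orbit \<Gamma>)" using assms(3) by (auto simp: limit_rays_def)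
  have "tnorm (\<gamma> *v v) \<in> closure (orbit \<Gamma>)"
  proof (rule act_closure[OF g0 v])
    fix u assume "u \<in> orbit \<Gamma>"
    then obtain g where g: "g \<in> \<Gamma>" "u = tnorm (g *v e_T)" by (auto simp: orbit_def)
    have g1: "g \<in> carrier SO0" using G(1) g by blast
    have "tnorm (\<gamma> *v u) = tnorm ((\<gamma> ** g) *v e_T)"
      unfolding g(2) using tnorm_mult[OF g0, of "g *v e_T"] SO0_TT[OF g1]
      by (simp add: SO0_mform[OF g1] e_T_form matrix_vector_mul_assoc)
    then show "tnorm (\<gamma> *v u) \<in> orbit \<Gamma>" using G(3) assms(2) g(1) by (auto simp: orbit_def)
  qed
  then show ?thesis using tnorm_act_celestial[OF g0 v(1)] by (simp add: limit_rays_def)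
qed

lemma norm_hpt: "(norm (z::'d::finite hpt))\<^sup>2 = (norm (fst z))\<^sup>2 + (snd z)\<^sup>2"
  by (cases z) (simp add: norm_Pair)

text \<open>Identifies convergence in the upper half-space with convergence in the projective ball.
  The scale is \<open>d n\<close>, twice the time coordinate of \<open>mink_vec (z n)\<close>: it
  tends to infinity exactly when the points tend to \<infinity>.\<close>

lemma to_bdry_iff:
  fixes z :: "nat \<Rightarrow> 'd::finite hpt"
  assumes "\<And>n. z n \<in> half_space"
  shows "filterlim z (to_bdry \<xi>) sequentially \<longleftrightarrow> (\<lambda>n. tnorm (mink_vec (z n))) \<longlonglongrightarrow> ray \<xi>"
proof -
  define w where "w n = tnorm (mink_vec (z n))" for n
  define d where "d n = (norm (z n))\<^sup>2 + 1" for n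
  have dpos: "d n > 0" for n using pos_sq1(1)[of "z n"] by (simp add: d_def)
  have T: "mink_vec (z n) $ Inr True = d n / 2" for n by (simp add: d_def norm_hpt)
  have w: "w n = (2 / d n) *\<^sub>R mink_vec (z n)" for n
    unfolding w_def tnorm_def T by simp
  have lcw: "lc_b (w n) = 2 / d n" for n by (simp add: w lc_b_linear)
  have ev: "filterlim z (to_bdry \<xi>) sequentially \<longleftrightarrow>
      filterlim z (case \<xi> of None \<Rightarrow> at_infinity | Some x \<Rightarrow> nhds (x, 0)) sequentially"
    unfolding to_bdry_def filterlim_inf filterlim_principal using assms by simp
  have lc: "(\<lambda>n. lc_b (w n)) \<longlonglongrightarrow> lc_b v" if "w \<longlonglongrightarrow> v" for v
    unfolding lc_b_mform by (intro tendsto_intros that)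
  have "filterlim z (to_bdry \<xi>) sequentially \<longleftrightarrow> w \<longlonglongrightarrow> ray \<xi>"
  proof (cases \<xi>)
    case None
    have A: "filterlim z at_infinity sequentially \<longleftrightarrow> filterlim d at_top sequentially"
    proof -
      have "filterlim z at_infinity sequentially \<longleftrightarrow> filterlim (\<lambda>n. norm (z n)) at_top sequentially"
        by (rule filterlim_at_infinity_conv_norm_at_top)
      also have "\<dots> \<longleftrightarrow> filterlim d at_top sequentially"
      proof
        assume "filterlim (\<lambda>n. norm (z n)) at_top sequentially"
        then show "filterlim d at_top sequentially"
        proof (rule filterlim_at_top_mono)
          have "x \<le> x\<^sup>2 + 1" for x :: real
          proof -
            have "0 \<le> (x - 1)\<^sup>2 + x\<^sup>2" by simp
            then show ?thesis by (simp add: power2_eq_square algebra_simps)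
          qed
          then show "eventually (\<lambda>n. norm (z n) \<le> d n) sequentially" by (simp add: d_def)
        qed
      next
        assume *: "filterlim d at_top sequentially"
        show "filterlim (\<lambda>n. norm (z n)) at_top sequentially"
          unfolding filterlim_at_top_ge[where c = "0::real"]
        proof (intro allI impI)
          fix Z :: real assume Z: "0 \<le> Z"
          have "eventually (\<lambda>n. Z\<^sup>2 + 1 \<le> d n) sequentially" using * by (simp add: filterlim_at_top)
          then show "eventually (\<lambda>n. Z \<le> norm (z n)) sequentially"
            by eventually_elim (auto simp: d_def intro: power2_le_imp_le)
        qed
      qed
      finally show ?thesis .
    qed
    \<comment> \<open>The vector \<open>w n - qinf\<close> has time coordinate 0, so its squared
      norm is a Lorentz product. Since \<open>mform (w n) (w n) \<le> 0\<close>, it is at most twice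
      \<open>lc_b (w n)\<close>, that is 4 / d n, rounded up here.\<close>
    have B: "(norm (w n - qinf))\<^sup>2 \<le> 8 / d n" for n
    proof -
      have f: "mform (w n) (w n) \<le> 0" "w n $ Inr True = 1" "w n $ Inr False = 1 - 2 / d n"
      proof -
        show "mform (w n) (w n) \<le> 0" by (simp add: w mform_linear mform_mink_vec_self)
        show 1: "w n $ Inr True = 1" unfolding w using dpos[of n] T[of n] by simp
        show "w n $ Inr False = 1 - 2 / d n" using lcw[of n] 1 by (simp add: lc_b_def)
      qed
      have "(norm (w n - qinf))\<^sup>2 = (w n - qinf) \<bullet> (w n - qinf)" by (rule power2_norm_eq_inner)
      also have "\<dots> = mform (w n - qinf) (w n - qinf)" by (simp add: mform_def f)
      also have "\<dots> = mform (w n) (w n) - 2 * mform (w n) qinf"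
        by (simp add: mform_linear mform_sym[of qinf "w n"])
      also have "\<dots> \<le> 2 * lc_b (w n)" using f by (simp add: lc_b_mform)
      also have "\<dots> \<le> 8 / d n" using dpos[of n] by (simp add: lcw divide_right_mono)
      finally show ?thesis .
    qed
    have "filterlim d at_top sequentially \<longleftrightarrow> w \<longlonglongrightarrow> qinf"
    proof
      assume d: "filterlim d at_top sequentially"
      have "(\<lambda>n. 8 / d n) \<longlonglongrightarrow> 0"
        by (rule tendsto_divide_0[OF tendsto_const filterlim_at_top_imp_at_infinity[OF d]])
      then have "(\<lambda>n. (norm (w n - qinf))\<^sup>2) \<longlonglongrightarrow> 0"
        by (rule Lim_null_comparison[rotated]) (use B in auto)
      then have "(\<lambda>n. norm (w n - qinf)) \<longlonglongrightarrow> 0" by simp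
      then show "w \<longlonglongrightarrow> qinf" by (simp add: LIM_zero_iff tendsto_norm_zero_iff)
    next
      assume "w \<longlonglongrightarrow> qinf"
      then have "(\<lambda>n. lc_b (w n)) \<longlonglongrightarrow> 0" using lc[of qinf] by (simp add: lc_b_def)
      then have "(\<lambda>n. 2 / d n / 2) \<longlonglongrightarrow> 0" unfolding lcw by (intro tendsto_divide_zero)
      then have "(\<lambda>n. inverse (d n)) \<longlonglongrightarrow> 0" by (simp add: inverse_eq_divide)
      then show "filterlim d at_top sequentially"
        using filterlim_inverse_at_top[of "\<lambda>n. inverse (d n)"] dpos by simp
    qed
    then show ?thesis using A ev None by (simp add: ray_None)
  next
    case (Some x)
    show ?thesis
    proof
      assume "filterlim z (to_bdry \<xi>) sequentially"
      then have z: "z \<longlonglongrightarrow> (x, 0)" using ev Some by simp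
      have "(\<lambda>n. mink_vec (z n)) \<longlonglongrightarrow> lift x"
        using continuous_on_tendsto_compose[OF continuous_on_mink_vec[OF continuous_on_id] z, of UNIV]
        by simp
      then show "w \<longlonglongrightarrow> ray \<xi>" unfolding w_def ray_def Some bdry_vec_Some
        by (intro tendsto_tnorm) (use lift_T[of x] in auto)
    next
      assume l: "w \<longlonglongrightarrow> ray \<xi>"
      define c where "c = 2 / ((norm x)\<^sup>2 + 1)"
      have c: "c > 0" using pos_sq1(1)[of x] by (simp add: c_def)
      have nbx: "ray \<xi> = c *\<^sub>R lift x" by (simp add: Some ray_Some c_def)
      have lb: "(\<lambda>n. 2 / d n) \<longlonglongrightarrow> c" using lc[OF l] by (simp add: lcw nbx lc_b_linear)
      have "(\<lambda>n. spart (w n)) \<longlonglongrightarrow> spart (ray \<xi>)"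
        unfolding spart_def by (intro tendsto_vec_lambda tendsto_intros l)
      then have "(\<lambda>n. (1 / (2 / d n)) *\<^sub>R spart (w n)) \<longlonglongrightarrow> (1 / c) *\<^sub>R spart (ray \<xi>)"
        by (intro tendsto_intros lb) (use c in auto)
      moreover have "(1 / (2 / d n)) *\<^sub>R spart (w n) = fst (z n)" for n
        using dpos[of n] by (simp add: w)
      ultimately have fst: "(\<lambda>n. fst (z n)) \<longlonglongrightarrow> x" using c by (simp add: nbx)
      \<comment> \<open>Recovers the squared height from the light-cone coordinate and the
        horizontal part.\<close>
      have "(\<lambda>n. 2 / (2 / d n) - 1 - (norm (fst (z n)))\<^sup>2) \<longlonglongrightarrow> 2 / c - 1 - (norm x)\<^sup>2"
        by (intro tendsto_intros lb fst) (use c in auto)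
      moreover have "2 / (2 / d n) - 1 - (norm (fst (z n)))\<^sup>2 = (snd (z n))\<^sup>2" for n
        
      proof -
        have "2 / (2 / d n) = d n" by simp
        then show ?thesis unfolding d_def norm_hpt by linarith
      qed
      moreover have "2 / c - 1 - (norm x)\<^sup>2 = 0" 
      proof -
        have "2 / c = (norm x)\<^sup>2 + 1" using pos_sq1(2)[of x] unfolding c_def by simp
        then show ?thesis by linarith
      qed
      ultimately have "(\<lambda>n. (snd (z n))\<^sup>2) \<longlonglongrightarrow> 0" by simp
      then have "(\<lambda>n. snd (z n)) \<longlonglongrightarrow> 0" by simp
      then have "(\<lambda>n. (fst (z n), snd (z n))) \<longlonglongrightarrow> (x, 0)" by (intro tendsto_Pair fst)
      then show "filterlim z (to_bdry \<xi>) sequentially" using ev Some by simp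
    qed
  qed
  then show ?thesis unfolding w_def .
qed

lemma limit_set_iff:
  assumes "\<Gamma> \<subseteq> carrier SO0"
  shows "\<xi> \<in> limit_set \<Gamma> \<longleftrightarrow> ray \<xi> \<in> limit_rays \<Gamma>"
proof -
  have base: "base_pt \<in> half_space" by (simp add: base_pt_def half_space_def)
  have t: "tnorm (mink_vec (hact g base_pt)) = tnorm (g *v e_T)" if "g \<in> \<Gamma>" for g
  proof -
    have g: "g \<in> carrier SO0" using that assms by blast
    have "tnorm (g *v e_T) = tnorm (lc_b (g *v e_T) *\<^sub>R mink_vec (hact g base_pt))"
      using hact_half_space(3)[OF g base] unfolding base_vec by (rule arg_cong)
    also have "\<dots> = tnorm (mink_vec (hact g base_pt))"
      by (rule tnorm_scaleR) (use hact_half_space(2)[OF g base] in \<open>simp add: base_vec\<close>)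
    finally show ?thesis by simp
  qed
  have lim: "filterlim (\<lambda>n. hact (f n) base_pt) (to_bdry \<xi>) sequentially \<longleftrightarrow>
      (\<lambda>n. tnorm (f n *v e_T)) \<longlonglongrightarrow> ray \<xi>" if "\<forall>n. f n \<in> \<Gamma>" for f
  proof -
    have "hact (f n) base_pt \<in> half_space" for n
      using that assms by (intro hact_half_space(1) base) blast
    then show ?thesis using to_bdry_iff[of "\<lambda>n. hact (f n) base_pt" \<xi>] that t by simp
  qed
  have "\<xi> \<in> limit_set \<Gamma> \<longleftrightarrow> (\<exists>f. (\<forall>n. f n \<in> \<Gamma>) \<and> (\<lambda>n. tnorm (f n *v e_T)) \<longlonglongrightarrow> ray \<xi>)"
    unfolding limit_set_def using lim by blast
  also have "\<dots> \<longleftrightarrow> (\<exists>w. (\<forall>n. w n \<in> orbit \<Gamma>) \<and> w \<longlonglongrightarrow> ray \<xi>)"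
  proof
    assume "\<exists>w. (\<forall>n. w n \<in> orbit \<Gamma>) \<and> w \<longlonglongrightarrow> ray \<xi>"
    then obtain w where w: "\<forall>n. w n \<in> orbit \<Gamma>" "w \<longlonglongrightarrow> ray \<xi>" by blast
    then have "\<forall>n. \<exists>g. g \<in> \<Gamma> \<and> w n = tnorm (g *v e_T)"
      unfolding orbit_def by blast
    then obtain f where f: "\<forall>n. f n \<in> \<Gamma> \<and> w n = tnorm (f n *v e_T)"
      by (rule choice[THEN exE])
    then have "w = (\<lambda>n. tnorm (f n *v e_T))" by auto
    then show "\<exists>f. (\<forall>n. f n \<in> \<Gamma>) \<and> (\<lambda>n. tnorm (f n *v e_T)) \<longlonglongrightarrow> ray \<xi>"
      using w(2) f by blast
  next
    assume "\<exists>f. (\<forall>n. f n \<in> \<Gamma>) \<and> (\<lambda>n. tnorm (f n *v e_T)) \<longlonglongrightarrow> ray \<xi>"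
    then obtain f where f: "\<forall>n. f n \<in> \<Gamma>" "(\<lambda>n. tnorm (f n *v e_T)) \<longlonglongrightarrow> ray \<xi>" by blast
    then show "\<exists>w. (\<forall>n. w n \<in> orbit \<Gamma>) \<and> w \<longlonglongrightarrow> ray \<xi>"
      by (intro exI[of _ "\<lambda>n. tnorm (f n *v e_T)"]) (auto simp: orbit_def)
  qed
  also have "\<dots> \<longleftrightarrow> ray \<xi> \<in> limit_rays \<Gamma>"
    by (simp add: limit_rays_def ray_celestial closure_sequential)
  finally show ?thesis .
qed

text \<open>A common fixed ray would make the polynomial \<open>mform v (g *v v)\<close> vanish on
  \<open>\<Gamma>\<close>.\<close>

lemma no_fixed_point:
  assumes "zariski_dense \<Gamma>" "v \<in> celestial"
  shows "\<exists>\<gamma>\<in>\<Gamma>. tnorm (\<gamma> *v v) \<noteq> v"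
proof -
  have "v \<noteq> 0" using assms(2) by (auto simp: celestial_def)
  then obtain g where g: "g \<in> \<Gamma>" "mform v (g *v v) \<noteq> 0"
    using zariski_dense_prodD[OF assms(1), of "{v}" v] assms(2) by auto
  have "mform v (tnorm (g *v v)) = mform v (g *v v) / (g *v v) $ Inr True"
    by (simp add: tnorm_def mform_linear)
  \<comment> \<open>\<open>\<Gamma>\<close> is not assumed to lie in \<open>SO0\<close> here. If the
    time coordinate is 0, \<open>tnorm\<close> yields 0 by division by zero, which also differs from
    \<open>v\<close>.\<close>
  moreover have "(g *v v) $ Inr True \<noteq> 0 \<or> tnorm (g *v v) = 0" by (auto simp: tnorm_def)
  moreover have "mform v v = 0" using assms(2) by (simp add: celestial_def)
  ultimately have "tnorm (g *v v) \<noteq> v"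
    using g(2) \<open>v \<noteq> 0\<close> by auto
  then show ?thesis using g(1) by blast
qed

text \<open>Convergence dynamics: if the orbit points of \<open>g n\<close> tend to the boundary
  point \<open>v\<close>, and those of the inverses subconverge to \<open>u0\<close>, then
  \<open>g n\<close> pushes every boundary point other than \<open>u0\<close> to \<open>v\<close>
  along that subsequence.\<close>

lemma limit_rays_minimal:
  assumes \<Gamma>: "subgroup \<Gamma> SO0" and F: "closed F" "F \<subseteq> celestial" "F \<noteq> {}"
    and inv: "\<And>\<gamma> v. \<gamma> \<in> \<Gamma> \<Longrightarrow> v \<in> F \<Longrightarrow> tnorm (\<gamma> *v v) \<in> F"
    and nofix: "\<And>v. v \<in> celestial \<Longrightarrow> \<exists>\<gamma>\<in>\<Gamma>. tnorm (\<gamma> *v v) \<noteq> v"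
  shows "limit_rays \<Gamma> \<subseteq> F"
proof
  fix v assume "v \<in> limit_rays \<Gamma>"
  then have v: "v \<in> celestial" "v \<in> closure (orbit \<Gamma>)" by (auto simp: limit_rays_def)
  note G = subgroup_SO0D[OF \<Gamma>]
  obtain w where w: "\<forall>n. w n \<in> orbit \<Gamma>" "w \<longlonglongrightarrow> v"
    using v(2) unfolding closure_sequential by blast
  then have "\<forall>n. \<exists>g. g \<in> \<Gamma> \<and> w n = tnorm (g *v e_T)" unfolding orbit_def by blast
  then obtain g where g: "\<forall>n. g n \<in> \<Gamma> \<and> w n = tnorm (g n *v e_T)"
    by (rule choice[THEN exE])
  have g0: "g n \<in> carrier SO0" for n using g G(1) by blast
  define t where "t n = (g n *v e_T) $ Inr True" for n
  have t1: "t n \<ge> 1" for n unfolding t_def by (rule SO0_TT[OF g0])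
  define u where "u n = tnorm (matrix_inv (g n) *v e_T)" for n
  have tinv: "(matrix_inv (g n) *v e_T) $ Inr True = t n" for n
    using SO0_mform_inv[OF g0, of n e_T e_T] by (simp add: e_T_form t_def)
  have wn: "w n = (1 / t n) *\<^sub>R (g n *v e_T)" for n using g by (simp add: tnorm_def t_def)
  have un: "u n = (1 / t n) *\<^sub>R (matrix_inv (g n) *v e_T)" for n by (simp add: u_def tnorm_def tinv)
  have wf: "mform (w n) (w n) = - (1 / t n)\<^sup>2" "w n $ Inr True = 1" for n
    using tnorm_hyperboloid[OF g0, of n] g by (simp_all add: t_def)
  have uf: "mform (u n) (u n) = - (1 / t n)\<^sup>2" "u n $ Inr True = 1" "u n \<in> cball 0 (sqrt 2)" for n
    using tnorm_hyperboloid[OF SO0_inv[OF g0], of n] by (simp_all add: u_def tinv)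
  have "(\<lambda>n. - mform (w n) (w n)) \<longlonglongrightarrow> - mform v v" by (intro tendsto_intros w)
  \<comment> \<open>As the limit \<open>v\<close> is null, the time coordinates \<open>t n\<close>
    tend to infinity.\<close>
  then have t0: "(\<lambda>n. (1 / t n)\<^sup>2) \<longlonglongrightarrow> 0" using v(1) by (simp add: wf celestial_def)
  obtain u0 r where r: "strict_mono (r :: nat \<Rightarrow> nat)" "(u \<circ> r) \<longlonglongrightarrow> u0"
    using uf(3) compact_imp_seq_compact[OF compact_cball, of "0 :: 'a mink" "sqrt 2"]
    by (metis seq_compactE)
  have ur: "(\<lambda>n. u (r n)) \<longlonglongrightarrow> u0" using r(2) by (simp add: comp_def)
  have t0r: "(\<lambda>n. (1 / t (r n))\<^sup>2) \<longlonglongrightarrow> 0"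
    using LIMSEQ_subseq_LIMSEQ[OF t0 r(1)] by (simp add: comp_def)
  have "u0 \<in> celestial"
  proof -
    have "(\<lambda>n. mform (u (r n)) (u (r n))) \<longlonglongrightarrow> mform u0 u0" by (intro tendsto_intros ur)
    moreover have "(\<lambda>n. mform (u (r n)) (u (r n))) \<longlonglongrightarrow> 0"
      unfolding uf using tendsto_minus[OF t0r] by simp
    ultimately have "mform u0 u0 = 0" by (rule LIMSEQ_unique)
    moreover have "(\<lambda>n. u (r n) $ Inr True) \<longlonglongrightarrow> u0 $ Inr True" by (intro tendsto_intros ur)
    then have "u0 $ Inr True = 1" unfolding uf by (simp add: LIMSEQ_const_iff)
    ultimately show ?thesis by (simp add: celestial_def)
  qed
  \<comment> \<open>If \<open>F\<close> seems to offer only the exceptional point \<open>u0\<close>,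
    some group element moves it within \<open>F\<close>.\<close>
  obtain s where s: "s \<in> F" "s \<noteq> u0"
  proof -
    obtain s0 where s0: "s0 \<in> F" using F by blast
    show ?thesis
    proof (cases "s0 = u0")
      case True
      obtain \<gamma> where "\<gamma> \<in> \<Gamma>" "tnorm (\<gamma> *v u0) \<noteq> u0" using nofix[OF \<open>u0 \<in> celestial\<close>] by blast
      then show ?thesis using that inv[of \<gamma> s0] s0 True by blast
    qed (use that s0 in blast)
  qed
  have sc: "s \<in> celestial" using s F by blast
  have su: "mform s u0 < 0" by (rule celestial_mform_neg) (use sc s \<open>u0 \<in> celestial\<close> in auto)
  define p where "p n = tnorm (g n *v s)" for n
  have pF: "p n \<in> F" for n unfolding p_def using inv s g by blast
  have pT: "(g n *v s) $ Inr True = - t n * mform s (u n)" for n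
  proof -
    have "- (g n *v s) $ Inr True = mform s (matrix_inv (g n) *v e_T)"
      using SO0_mform_inv[OF g0, of n s e_T] by (simp add: e_T_form)
    then show ?thesis using t1[of n] by (simp add: un mform_linear)
  qed
  \<comment> \<open>The product of \<open>g n *v s\<close> with \<open>g n *v e_T\<close> is -1 for
    all \<open>n\<close>. Normalising divides it by two factors of size \<open>t n\<close>, because
    \<open>mform s (u n)\<close> stays away from 0 along the subsequence.\<close>
  have pw: "(norm (p n - w n))\<^sup>2 = - 2 / mform s (u n) * (1 / t n)\<^sup>2 - (1 / t n)\<^sup>2" if nz: "mform s (u n) < 0" for n
  proof -
    have c: "p n \<in> celestial" using pF F by blast
    have "mform (p n) (w n) = mform (g n *v s) (g n *v e_T) / ((g n *v s) $ Inr True * t n)"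
      by (simp add: p_def tnorm_def wn mform_linear)
    also have "mform (g n *v s) (g n *v e_T) = - 1"
      using sc by (simp add: SO0_mform[OF g0] e_T_form celestial_def)
    finally have m: "mform (p n) (w n) = (1 / t n)\<^sup>2 / mform s (u n)"
      unfolding pT by (simp add: power2_eq_square)
    have "(norm (p n - w n))\<^sup>2 = mform (p n - w n) (p n - w n)"
      unfolding power2_norm_eq_inner using c wf(2)[of n] by (simp add: mform_def celestial_def)
    also have "\<dots> = - 2 * mform (p n) (w n) + mform (w n) (w n)"
      using c by (simp add: mform_linear mform_sym[of "w n" "p n"] celestial_def)
    finally show ?thesis by (simp add: m wf)
  qed
  have msu: "(\<lambda>n. mform s (u (r n))) \<longlonglongrightarrow> mform s u0" by (intro tendsto_intros ur)
  have "(\<lambda>n. (norm (p (r n) - w (r n)))\<^sup>2) \<longlonglongrightarrow> 0"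
  proof (rule Lim_transform_eventually)
    have "(\<lambda>n. - 2 / mform s (u (r n)) * (1 / t (r n))\<^sup>2 - (1 / t (r n))\<^sup>2) \<longlonglongrightarrow> - 2 / mform s u0 * 0 - 0"
      by (intro tendsto_intros msu t0r) (use su in auto)
    then show "(\<lambda>n. - 2 / mform s (u (r n)) * (1 / t (r n))\<^sup>2 - (1 / t (r n))\<^sup>2) \<longlonglongrightarrow> 0" by simp
    have "eventually (\<lambda>n. mform s (u (r n)) < 0) sequentially"
      using order_tendstoD(2)[OF msu su] .
    then show "eventually (\<lambda>n. - 2 / mform s (u (r n)) * (1 / t (r n))\<^sup>2 - (1 / t (r n))\<^sup>2 = (norm (p (r n) - w (r n)))\<^sup>2) sequentially"
      by eventually_elim (simp add: pw)
  qed
  then have "(\<lambda>n. norm (p (r n) - w (r n))) \<longlonglongrightarrow> 0" by simp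
  then have "(\<lambda>n. p (r n) - w (r n)) \<longlonglongrightarrow> 0" by (simp add: tendsto_norm_zero_iff)
  moreover have "(\<lambda>n. w (r n)) \<longlonglongrightarrow> v"
    using LIMSEQ_subseq_LIMSEQ[OF w(2) r(1)] by (simp add: comp_def)
  ultimately have "(\<lambda>n. p (r n) - w (r n) + w (r n)) \<longlonglongrightarrow> 0 + v" by (rule tendsto_add)
  then have "(\<lambda>n. p (r n)) \<longlonglongrightarrow> v" by simp
  then show "v \<in> F"
    by (rule Lim_in_closed_set[OF F(1), rotated 2]) (simp_all add: pF)
qed

lemma open_act_preimage:
  fixes \<gamma> :: "'d::finite mat"
  assumes W: "open W"
  shows "open {s. (\<gamma> *v s) $ Inr True > 0 \<and> tnorm (\<gamma> *v s) \<in> W}" (is "open ?U")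
proof -
  have o: "open {s. (\<gamma> *v s) $ Inr True > 0}" by (intro open_Collect_less continuous_intros)
  have "continuous_on {s. (\<gamma> *v s) $ Inr True > 0} (\<lambda>s. tnorm (\<gamma> *v s))"
    unfolding tnorm_def by (intro continuous_intros) auto
  then have "open ((\<lambda>s. tnorm (\<gamma> *v s)) -` W \<inter> {s. (\<gamma> *v s) $ Inr True > 0})"
    using continuous_on_open_vimage[OF o] W by blast
  moreover have "(\<lambda>s. tnorm (\<gamma> *v s)) -` W \<inter> {s. (\<gamma> *v s) $ Inr True > 0} = ?U"
    by auto
  ultimately show ?thesis by simp
qed

text \<open>Every orbit on \<open>celestial\<close> is dense in the limit set and hence enters
  \<open>W\<close>; by compactness finitely many elements \<open>\<Gamma>0\<close> suffice for all
  starting points. A hyperplane containing the piece in \<open>W\<close> would pull back to finitely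
  many hyperplanes covering the limit set, and Zariski density moves a limit point off all of
  them.\<close>

lemma limit_rays_not_in_hyperplane:
  assumes \<Gamma>: "subgroup \<Gamma> SO0" and zd: "zariski_dense \<Gamma>"
    and W: "open W" "limit_rays \<Gamma> \<inter> W \<noteq> {}" and n: "\<And>v. v \<in> limit_rays \<Gamma> \<inter> W \<Longrightarrow> mform n v = 0"
  shows "n = 0"
proof (rule ccontr)
  assume n0: "n \<noteq> 0"
  note G = subgroup_SO0D[OF \<Gamma>]
  have orbW: "\<exists>\<gamma>\<in>\<Gamma>. tnorm (\<gamma> *v s) \<in> W" if s: "s \<in> celestial" for s
  proof -
    let ?O = "(\<lambda>\<gamma>. tnorm (\<gamma> *v s)) ` \<Gamma>"
    have Oc: "?O \<subseteq> celestial" using tnorm_act_celestial s G(1) by blast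
    have cl: "closed (celestial :: 'a mink set)" by (rule compact_imp_closed[OF compact_celestial])
    have "limit_rays \<Gamma> \<subseteq> closure ?O"
    proof (rule limit_rays_minimal[OF \<Gamma>])
      show "closure ?O \<subseteq> celestial" using Oc cl by (rule closure_minimal)
      show "closure ?O \<noteq> {}" using G(2) by auto
      show "\<exists>\<gamma>\<in>\<Gamma>. tnorm (\<gamma> *v v) \<noteq> v" if "v \<in> celestial" for v
        by (rule no_fixed_point[OF zd that])
      fix \<gamma> v assume gv: "\<gamma> \<in> \<Gamma>" "v \<in> closure ?O"
      have g0: "\<gamma> \<in> carrier SO0" using gv G(1) by blast
      have vc: "v \<in> celestial" using gv Oc cl closure_minimal by blast
      show "tnorm (\<gamma> *v v) \<in> closure ?O"
      proof (rule act_closure[OF g0 vc gv(2)])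
        fix u assume "u \<in> ?O"
        then obtain h where h: "h \<in> \<Gamma>" "u = tnorm (h *v s)" by blast
        then have "h \<in> carrier SO0" using G(1) by blast
        then have "tnorm (\<gamma> *v u) = tnorm ((\<gamma> ** h) *v s)"
          using tnorm_act_mult[OF g0 _ s] h(2) by simp
        then show "tnorm (\<gamma> *v u) \<in> ?O" using G(3)[OF gv(1) h(1)] by blast
      qed
    qed simp
    then have "W \<inter> closure ?O \<noteq> {}" using W(2) by blast
    then have "W \<inter> ?O \<noteq> {}" using open_Int_closure_eq_empty[OF W(1)] by blast
    then show ?thesis by blast
  qed
  define U where "U \<gamma> = {s. (\<gamma> *v s) $ Inr True > 0 \<and> tnorm (\<gamma> *v s) \<in> W}" for \<gamma> :: "'a mat"
  have oU: "open (U \<gamma>)" for \<gamma>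
    unfolding U_def by (rule open_act_preimage[OF W(1)])
  have cover: "celestial \<subseteq> (\<Union>\<gamma>\<in>\<Gamma>. U \<gamma>)"
  proof
    fix s assume s: "s \<in> (celestial :: 'a mink set)"
    obtain \<gamma> where g: "\<gamma> \<in> \<Gamma>" "tnorm (\<gamma> *v s) \<in> W" using orbW[OF s] by blast
    have "(\<gamma> *v s) $ Inr True > 0" using SO0_forward[of \<gamma> s] g(1) G(1) s
      by (auto simp: celestial_def)
    then show "s \<in> (\<Union>\<gamma>\<in>\<Gamma>. U \<gamma>)" using g by (auto simp: U_def)
  qed
  obtain \<Gamma>0 where G0: "\<Gamma>0 \<subseteq> \<Gamma>" "finite \<Gamma>0" "celestial \<subseteq> (\<Union>\<gamma>\<in>\<Gamma>0. U \<gamma>)"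
    using compactE_image[OF compact_celestial oU cover] by metis
  define N where "N = (\<lambda>\<gamma>. matrix_inv \<gamma> *v n) ` \<Gamma>0"
  have "0 \<notin> N"
  proof
    assume "0 \<in> N"
    then obtain \<gamma> where g: "\<gamma> \<in> \<Gamma>0" "matrix_inv \<gamma> *v n = 0" by (auto simp: N_def)
    then have "\<gamma> \<in> carrier SO0" using G0 G(1) by blast
    then have "n = \<gamma> *v (matrix_inv \<gamma> *v n)" by (simp add: SO0_inv_cancel)
    then show False using g n0 by simp
  qed
  obtain s where s: "s \<in> limit_rays \<Gamma>" using W(2) by blast
  then have sc: "s \<in> celestial" by (simp add: limit_rays_def)
  obtain g where g: "g \<in> \<Gamma>" "\<forall>n\<in>N. mform n (g *v s) \<noteq> 0"
    using zariski_dense_prodD[OF zd _ \<open>0 \<notin> N\<close> sc] G0(2) by (auto simp: N_def)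
  define p where "p = tnorm (g *v s)"
  have pL: "p \<in> limit_rays \<Gamma>" unfolding p_def by (rule limit_rays_invariant[OF \<Gamma> g(1) s])
  then have "p \<in> celestial" by (simp add: limit_rays_def)
  then obtain \<gamma> where \<gamma>: "\<gamma> \<in> \<Gamma>0" "p \<in> U \<gamma>" using G0(3) by blast
  then have \<gamma>G: "\<gamma> \<in> \<Gamma>" using G0(1) by blast
  then have \<gamma>0: "\<gamma> \<in> carrier SO0" using G(1) by blast
  have "mform n (tnorm (\<gamma> *v p)) = 0"
    using n limit_rays_invariant[OF \<Gamma> \<gamma>G pL] \<gamma>(2) by (auto simp: U_def)
  then have "mform n (\<gamma> *v p) = 0" using \<gamma>(2) by (auto simp: tnorm_def mform_linear U_def)
  then have "mform (matrix_inv \<gamma> *v n) p = 0"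
    using SO0_mform_inv[OF \<gamma>0, of p n] by (simp add: mform_sym)
  moreover have "(g *v s) $ Inr True > 0" using SO0_forward[of g s] g(1) G(1) sc
    by (auto simp: celestial_def)
  ultimately have "mform (matrix_inv \<gamma> *v n) (g *v s) = 0"
    by (auto simp: p_def tnorm_def mform_linear)
  then show False using g(2) \<gamma>(1) by (auto simp: N_def)
qed

section \<open>Topology and measure on the boundary\<close>

lemma topspace_bdry_top [simp]: "topspace bdry_top = UNIV"
  by (simp add: bdry_top_def UNIV_option_conv)

lemma openin_bdry_Some: "open V \<Longrightarrow> openin bdry_top (Some ` V)"
  by (simp add: bdry_top_def open_openin[symmetric])

lemma ray_Some_alt: "ray (Some x) = (1 / (lift x $ Inr True)) *\<^sub>R lift x"
  by (simp add: ray_def bdry_vec_Some tnorm_def)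

text \<open>Continuity of \<open>ray\<close> on the one-point compactification. At \<infinity> it
  holds because the squared distance from \<open>ray (Some x)\<close> to \<open>qinf\<close> is 4 /
  (|x|^2 + 1), so that only bounded sets of \<open>x\<close> stay away from
  \<open>qinf\<close>.\<close>

lemma openin_ray:
  fixes W :: "'d::finite mink set"
  assumes "open W"
  shows "openin bdry_top {\<xi>. ray \<xi> \<in> W}"
proof -
  define V where "V = {x :: real^'d. ray (Some x) \<in> W}"
  have "continuous_on UNIV (\<lambda>x :: real^'d. ray (Some x))"
    unfolding ray_Some_alt by (intro continuous_intros ballI) (use lift_T in \<open>auto simp: less_le\<close>)
  then have oV: "open V" using open_vimage[OF assms] by (simp add: V_def vimage_def)
  show ?thesis
  proof (cases "qinf \<in> W")
    case False
    have "{\<xi>. ray \<xi> \<in> W} = Some ` V"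
    proof (rule Set.set_eqI)
      fix \<xi> show "\<xi> \<in> {\<xi>. ray \<xi> \<in> W} \<longleftrightarrow> \<xi> \<in> Some ` V"
        using False by (cases \<xi>) (auto simp: V_def ray_None)
    qed
    then show ?thesis using openin_bdry_Some[OF oV] by simp
  next
    case True
    obtain e where e: "e > 0" "ball qinf e \<subseteq> W" using assms True openE by blast
    have "- V \<subseteq> cball 0 (2 / e)"
    proof
      fix x assume "x \<in> - V"
      then have "ray (Some x) \<notin> ball qinf e" using e by (auto simp: V_def)
      then have "e \<le> norm (ray (Some x) - qinf)" by (simp add: dist_norm norm_minus_commute)
      then have "e\<^sup>2 \<le> (norm (ray (Some x) - qinf))\<^sup>2" using e(1) by (simp add: power_mono)
      also have "\<dots> = - 2 * mform (ray (Some x)) qinf"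
        using celestial_dist[OF ray_celestial ray_celestial, of "Some x" None]
        by (simp add: ray_None)
      also have "\<dots> = 4 / ((norm x)\<^sup>2 + 1)"
        using lc_b_mform[of "lift x"] by (simp add: ray_Some mform_linear)
      finally have "e\<^sup>2 * ((norm x)\<^sup>2 + 1) \<le> 4" using pos_sq1(1)[of x] by (simp add: field_simps)
      then have "(e * norm x)\<^sup>2 + e\<^sup>2 \<le> 4" by (simp add: power_mult_distrib distrib_left)
      with zero_le_power2[of e] have "(e * norm x)\<^sup>2 \<le> 4" by linarith
      then have "(e * norm x)\<^sup>2 \<le> 2\<^sup>2" by simp
      then have "e * norm x \<le> 2" by (rule power2_le_imp_le) simp
      then show "x \<in> cball 0 (2 / e)" using e(1) by (simp add: field_simps)
    qed
    then have "bounded (- V)" using bounded_cball bounded_subset by blast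
    then have "compact (- V)" using oV by (simp add: compact_eq_bounded_closed closed_Compl)
    moreover have "{\<xi>. ray \<xi> \<in> W} = insert None (Some ` (UNIV - (- V)))"
    proof (rule Set.set_eqI)
      fix \<xi> show "\<xi> \<in> {\<xi>. ray \<xi> \<in> W} \<longleftrightarrow> \<xi> \<in> insert None (Some ` (UNIV - (- V)))"
        using True by (cases \<xi>) (auto simp: V_def ray_None)
    qed
    ultimately show ?thesis
      using oV unfolding bdry_top_def openin_Alexandroff_compactification
      by (intro disjI2 exI[of _ "- V"]) (simp add: closed_Compl)
  qed
qed

text \<open>A continuous injection of a compact space into a Hausdorff space is an embedding.
  Topological questions on the boundary thus move to Minkowski space.\<close>

lemma openin_bdry_obtain:
  assumes "openin bdry_top U"
  obtains W where "open W" "U = {\<xi>. ray \<xi> \<in> W}"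
proof -
  have "continuous_map bdry_top euclidean ray"
    unfolding continuous_map_def using openin_ray by auto
  moreover have "closedin bdry_top (- U)" using assms by (simp add: closedin_def Diff_eq)
  moreover have "compact_space bdry_top"
    unfolding bdry_top_def by (rule compact_space_Alexandroff_compactification)
  ultimately have "compactin euclidean (ray ` (- U))"
    using closedin_compact_space image_compactin by blast
  then have c: "closed (ray ` (- U))" by (simp add: compact_imp_closed)
  have "U = {\<xi>. ray \<xi> \<in> - ray ` (- U)}" by (auto simp: ray_inj)
  then show ?thesis using that[of "- ray ` (- U)"] c by auto
qed

lemma closure_of_Some:
  assumes "Some x \<in> bdry_top closure_of (Some ` A)"
  shows "x \<in> closure A"
proof -
  have "\<exists>y\<in>A. dist y x < e" if "e > 0" for e
  proof -
    have "openin bdry_top (Some ` ball x e)" by (rule openin_bdry_Some) simp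
    moreover have "Some x \<in> Some ` ball x e" using that by simp
    ultimately obtain \<zeta> where "\<zeta> \<in> Some ` A" "\<zeta> \<in> Some ` ball x e"
      using assms unfolding in_closure_of by blast
    then show ?thesis by (auto simp: dist_commute)
  qed
  then show ?thesis by (simp add: closure_approachable)
qed

lemma bdry_borel_simps [simp]: "space bdry_borel = UNIV"
  "openin bdry_top U \<Longrightarrow> U \<in> sets bdry_borel"
  by (simp_all add: bdry_borel_def)

lemma bact_vimage:
  assumes "g \<in> carrier SO0"
  shows "bact g -` {\<xi>. ray \<xi> \<in> W} = {\<xi>. ray \<xi> \<in> {s. (g *v s) $ Inr True > 0 \<and> tnorm (g *v s) \<in> W}}"
proof -
  have "(g *v ray \<xi>) $ Inr True > 0" for \<xi>
    using SO0_forward[OF assms, of "ray \<xi>"] ray_celestial[of \<xi>] by (simp add: celestial_def)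
  then show ?thesis using ray_bact(2)[OF assms] by auto
qed

lemma bact_measurable:
  assumes "g \<in> carrier SO0"
  shows "bact g \<in> measurable bdry_borel bdry_borel"
proof -
  have "bact g \<in> measurable bdry_borel (sigma UNIV {U. openin bdry_top U})"
  proof (rule measurable_measure_of)
    fix U assume "U \<in> {U :: 'a bdry set. openin bdry_top U}"
    then obtain W where W: "open W" "U = {\<xi>. ray \<xi> \<in> W}" using openin_bdry_obtain by blast
    have "openin bdry_top (bact g -` U)"
      unfolding W(2) bact_vimage[OF assms] by (rule openin_ray[OF open_act_preimage[OF W(1)]])
    then show "bact g -` U \<inter> space bdry_borel \<in> sets bdry_borel" by simp
  qed auto
  then show ?thesis by (simp add: bdry_borel_def)
qed

lemma emeasure_density_null:
  assumes "emeasure M U = 0" "U \<in> sets M"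
  shows "emeasure (density M f) U = 0"
proof -
  have "(\<integral>\<^sup>+ x. f x * indicator U x \<partial>M) = 0"
  proof -
    have "AE x in M. x \<notin> U" using assms by (intro AE_not_in) (auto simp: null_sets_def)
    then have "AE x in M. f x * indicator U x = 0" by (auto elim!: eventually_mono)
    then have "(\<integral>\<^sup>+ x. f x * indicator U x \<partial>M) = (\<integral>\<^sup>+ x. 0 \<partial>M)" by (rule nn_integral_cong_AE)
    then show ?thesis by simp
  qed
  \<comment> \<open>No measurability of \<open>f\<close> is assumed: if the density defines no
    measure, its value is 0 by convention.\<close>
  then show ?thesis unfolding density_def by (simp add: emeasure_measure_of_conv)
qed

section \<open>The support of the Patterson-Sullivan measure\<close>

locale ps_group =
  fixes \<Gamma> :: "'d::finite mat set" and \<nu> :: "'d hpt \<Rightarrow> 'd bdry measure"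
  assumes subgroup: "subgroup \<Gamma> SO0" and zariski: "zariski_dense \<Gamma>" and ps: "ps_density \<Gamma> \<nu>"
begin

abbreviation "\<mu> \<equiv> \<nu> base_pt"

lemmas grp = subgroup_SO0D[OF subgroup]

lemma base: "base_pt \<in> half_space"
  by (simp add: base_pt_def half_space_def)

lemma sets_mu: "sets \<mu> = sets bdry_borel" and finite_mu: "finite_measure \<mu>"
  and mu_nonzero: "emeasure \<mu> UNIV \<noteq> 0"
  using ps base unfolding ps_density_def by blast+

lemma space_mu: "space \<mu> = UNIV"
  using sets_eq_imp_space_eq[OF sets_mu] by simp

lemma ray_sets: "open W \<Longrightarrow> {\<xi>. ray \<xi> \<in> W} \<in> sets \<mu>"
  by (simp add: sets_mu openin_ray)

lemma bact_image_sets: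
  assumes "g \<in> carrier SO0" "A \<in> sets \<mu>"
  shows "bact g ` A \<in> sets \<mu>"
  using measurable_sets[OF bact_measurable[OF SO0_inv[OF assms(1)]], of A] assms
  by (simp add: bact_image sets_mu)

text \<open>The image of \<open>\<mu>\<close> under \<open>\<gamma>\<close> is the conformal measure
  at another base point, which has a density with respect to \<open>\<mu>\<close>.\<close>

lemma quasi_invariant:
  assumes g: "\<gamma> \<in> \<Gamma>" and U: "U \<in> sets \<mu>" "emeasure \<mu> U = 0"
  shows "emeasure \<mu> (bact \<gamma> -` U) = 0" "bact \<gamma> -` U \<in> sets \<mu>"
proof -
  have g0: "\<gamma> \<in> carrier SO0" using g grp(1) by blast
  have h: "hact \<gamma> base_pt \<in> half_space" by (rule hact_half_space(1)[OF g0 base])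
  have "bact \<gamma> \<in> measurable \<mu> bdry_borel"
    using bact_measurable[OF g0] by (simp add: measurable_cong_sets[OF sets_mu refl])
  moreover have "U \<in> sets bdry_borel" using U sets_mu by simp
  ultimately have "emeasure (distr \<mu> bdry_borel (bact \<gamma>)) U = emeasure \<mu> (bact \<gamma> -` U \<inter> space \<mu>)"
    "bact \<gamma> -` U \<inter> space \<mu> \<in> sets \<mu>"
    by (auto intro: emeasure_distr measurable_sets)
  moreover have "distr \<mu> bdry_borel (bact \<gamma>) = \<nu> (hact \<gamma> base_pt)"
    using ps base g unfolding ps_density_def by blast
  moreover have "emeasure (\<nu> (hact \<gamma> base_pt)) U = 0"
  proof -
    obtain f where "\<nu> (hact \<gamma> base_pt) = density \<mu> f"
      using ps base h unfolding ps_density_def by blast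
    then show ?thesis using emeasure_density_null U by metis
  qed
  ultimately show "emeasure \<mu> (bact \<gamma> -` U) = 0" "bact \<gamma> -` U \<in> sets \<mu>"
    by (simp_all add: space_mu)
qed

text \<open>The support \<open>S\<close> of \<open>\<mu>\<close> is closed and, by quasi-invariance,
  invariant. It is nonempty because otherwise finitely many null sets would cover the sphere.
  Minimality puts the limit set inside it.\<close>

lemma limit_rays_charged:
  assumes W: "open W" "limit_rays \<Gamma> \<inter> W \<noteq> {}"
  shows "emeasure \<mu> {\<xi>. ray \<xi> \<in> W} \<noteq> 0"
proof
  assume null: "emeasure \<mu> {\<xi>. ray \<xi> \<in> W} = 0"
  define N where "N = {W. open W \<and> emeasure \<mu> {\<xi>. ray \<xi> \<in> W} = 0}"
  define S where "S = celestial - \<Union>N"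
  have "open (\<Union>N)" by (rule open_Union) (simp add: N_def)
  moreover have "closed (celestial :: 'd mink set)"
    by (rule compact_imp_closed[OF compact_celestial])
  ultimately have clS: "closed S" unfolding S_def by (rule closed_Diff[rotated])
  have "limit_rays \<Gamma> \<subseteq> S"
  proof (rule limit_rays_minimal[OF subgroup clS])
    show "S \<subseteq> celestial" by (auto simp: S_def)
    show "\<exists>\<gamma>\<in>\<Gamma>. tnorm (\<gamma> *v v) \<noteq> v" if "v \<in> celestial" for v
      by (rule no_fixed_point[OF zariski that])
    show "S \<noteq> {}"
    proof
      assume "S = {}"
      then have cov: "celestial \<subseteq> \<Union>N" by (auto simp: S_def)
      obtain N' where N': "N' \<subseteq> N" "finite N'" "celestial \<subseteq> \<Union>N'"
        by (rule compactE[OF compact_celestial cov]) (auto simp: N_def)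
      have "(\<Union>W\<in>N'. {\<xi>. ray \<xi> \<in> W}) \<in> null_sets \<mu>"
      proof (rule null_sets_UN')
        show "countable N'" using N'(2) by (rule countable_finite)
        show "{\<xi>. ray \<xi> \<in> W} \<in> null_sets \<mu>" if "W \<in> N'" for W
          using that N'(1) ray_sets by (auto simp: N_def null_sets_def)
      qed
      moreover have "(\<Union>W\<in>N'. {\<xi>. ray \<xi> \<in> W}) = UNIV" using N'(3) ray_celestial by blast
      ultimately show False using mu_nonzero by (simp add: null_sets_def)
    qed
    fix \<gamma> v assume g: "\<gamma> \<in> \<Gamma>" and v: "v \<in> S"
    then have g0: "\<gamma> \<in> carrier SO0" using grp(1) by blast
    have vc: "v \<in> celestial" using v by (simp add: S_def)
    show "tnorm (\<gamma> *v v) \<in> S"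
    proof (rule ccontr)
      assume "tnorm (\<gamma> *v v) \<notin> S"
      then obtain W where W: "W \<in> N" "tnorm (\<gamma> *v v) \<in> W"
        using tnorm_act_celestial[OF g0 vc] by (auto simp: S_def)
      define W' where "W' = {s. (\<gamma> *v s) $ Inr True > 0 \<and> tnorm (\<gamma> *v s) \<in> W}"
      have "open W'" unfolding W'_def by (rule open_act_preimage) (use W in \<open>simp add: N_def\<close>)
      moreover have "emeasure \<mu> {\<xi>. ray \<xi> \<in> W'} = 0"
        unfolding W'_def bact_vimage[OF g0, symmetric]
        by (rule quasi_invariant[OF g]) (use W ray_sets in \<open>auto simp: N_def\<close>)
      ultimately have "W' \<in> N" by (simp add: N_def)
      moreover have "v \<in> W'" using W(2) SO0_forward[OF g0, of v] vc
        by (simp add: W'_def celestial_def)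
      ultimately show False using v by (auto simp: S_def)
    qed
  qed
  moreover have "W \<in> N" using W null by (simp add: N_def)
  ultimately show False using W(2) by (auto simp: S_def)
qed

lemma limit_rays_hyperplane_charged:
  assumes W: "open W" "limit_rays \<Gamma> \<inter> W \<noteq> {}" and n: "n \<noteq> 0"
  shows "emeasure \<mu> {\<xi>. ray \<xi> \<in> W \<and> mform n (ray \<xi>) \<noteq> 0} \<noteq> 0"
proof -
  have "open {v. mform n v \<noteq> 0}" by (intro open_Collect_neq continuous_intros)
  then have o: "open (W \<inter> {v. mform n v \<noteq> 0})" using W(1) by (rule open_Int[rotated])
  have "limit_rays \<Gamma> \<inter> (W \<inter> {v. mform n v \<noteq> 0}) \<noteq> {}"
    using limit_rays_not_in_hyperplane[OF subgroup zariski W, of n] n by blast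
  then show ?thesis using limit_rays_charged[OF o] by simp
qed

end

section \<open>Fundamental regions and discreteness\<close>

lemma subspace_direction:
  assumes "affine Z" "a \<in> Z"
  shows "subspace (direction Z)" "int (dim (direction Z)) = aff_dim Z"
proof -
  let ?V = "(\<lambda>x. - a + x) ` Z"
  have V: "subspace ?V" using affine_diffs_subspace[OF assms] .
  have eq: "direction Z = ?V"
  proof (intro equalityI subsetI)
    fix v assume "v \<in> direction Z"
    then obtain z z' where z: "z \<in> Z" "z' \<in> Z" "v = z - z'" by (auto simp: direction_def)
    have "(- a + z) - (- a + z') \<in> ?V" using z by (intro subspace_diff[OF V] imageI)
    then show "v \<in> ?V" using z by simp
  next
    fix v assume "v \<in> ?V"
    then obtain z where "z \<in> Z" "v = z - a" by auto
    then show "v \<in> direction Z" using assms(2) by (auto simp: direction_def)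
  qed
  show "subspace (direction Z)" using V eq by simp
  show "int (dim (direction Z)) = aff_dim Z"
    unfolding eq using aff_dim_eq_dim[of a Z] hull_inc[OF assms(2), of affine] by simp
qed

lemma parallelotope_in_span:
  assumes "affine Z" "parallelotope_in Z a E"
  shows "finite E" "span E = direction Z"
proof -
  have p: "a \<in> Z" "independent E" "E \<subseteq> direction Z" "int (card E) = aff_dim Z"
    using assms(2) by (auto simp: parallelotope_in_def)
  note d = subspace_direction[OF assms(1) p(1)]
  show "finite E" using p(2) by (rule independent_imp_finite)
  have "card E = dim (direction Z)" using p(4) d(2) by simp
  then have "direction Z \<subseteq> span E" using card_ge_dim_independent[OF p(3,2)] by simp
  moreover have "span E \<subseteq> direction Z" using span_minimal[OF p(3) d(1)] .
  ultimately show "span E = direction Z" by simp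
qed

text \<open>The dual vector of \<open>v\<close> is its component orthogonal to the other basis
  vectors, rescaled.\<close>

lemma exists_dual_basis:
  fixes E :: "'a::euclidean_space set"
  assumes "independent E"
  shows "\<exists>c. \<forall>v\<in>E. c v \<in> span E \<and> (\<forall>w\<in>E. c v \<bullet> w = (if w = v then 1 else 0))"
proof (rule bchoice, rule ballI)
  fix v assume v: "v \<in> E"
  obtain y z where yz: "y \<in> span (E - {v})" "\<And>w. w \<in> span (E - {v}) \<Longrightarrow> orthogonal z w" "v = y + z"
    using orthogonal_subspace_decomp_exists[of "E - {v}" v] by blast
  have z0: "z \<noteq> 0"
  proof
    assume "z = 0"
    then have "v \<in> span (E - {v})" using yz by simp
    then show False using assms v by (auto simp: dependent_def)
  qed
  have "y \<in> span E" using yz(1) span_mono[of "E - {v}" E] by blast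
  then have zs: "z \<in> span E" using yz(3) span_diff[OF span_base[OF v]]
    by (metis add_diff_cancel_left')
  have "z \<bullet> v = z \<bullet> z"
    using yz(2)[OF yz(1)] unfolding yz(3) by (simp add: orthogonal_def inner_add_right)
  moreover have "z \<bullet> w = 0" if "w \<in> E" "w \<noteq> v" for w
    using yz(2)[OF span_base] that by (auto simp: orthogonal_def)
  ultimately show "\<exists>c. c \<in> span E \<and> (\<forall>w\<in>E. c \<bullet> w = (if w = v then 1 else 0))"
    using z0 span_scale[OF zs] by (intro exI[of _ "(1 / (z \<bullet> z)) *\<^sub>R z"]) auto
qed

text \<open>Dual coordinates describe the cylinder by finitely many strict inequalities, from which
  openness and the faces can be read off. The vector in the norm is the component along Y.\<close>

lemma cyl_parallelotope_eq:
  assumes Z: "affine Z" and P: "parallelotope_in Z a E"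
    and c: "\<forall>v\<in>E. c v \<in> span E \<and> (\<forall>w\<in>E. c v \<bullet> w = (if w = v then 1 else 0))"
  shows "cyl Z s (parallelotope a E) =
    {x. norm (x - a - (\<Sum>v\<in>E. (c v \<bullet> (x - a)) *\<^sub>R v)) < s \<and> (\<forall>v\<in>E. 0 < c v \<bullet> (x - a) \<and> c v \<bullet> (x - a) < 1)}"
    (is "_ = ?R")
proof -
  note E = parallelotope_in_span[OF Z P]
  have coord: "c v \<bullet> (y + (\<Sum>w\<in>E. t w *\<^sub>R w)) = t v"
    if "y \<in> orthogonal_comp (direction Z)" "v \<in> E" for y t v
  proof -
    have "c v \<bullet> y = 0" using that c E(2)
      by (auto simp: orthogonal_comp_def orthogonal_def inner_commute)
    moreover have "c v \<bullet> (\<Sum>w\<in>E. t w *\<^sub>R w) = (\<Sum>w\<in>E. t w * (if w = v then 1 else 0))"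
      unfolding inner_sum_right using c that(2) by (intro sum.cong) auto
    moreover have "\<dots> = t v"
      using E(1) that(2) by (simp add: if_distrib sum.delta cong: if_cong)
    ultimately show ?thesis by (simp add: inner_add_right)
  qed
  show ?thesis
  proof (intro equalityI subsetI)
    fix x assume "x \<in> cyl Z s (parallelotope a E)"
    then obtain y t where y: "y \<in> orthogonal_comp (direction Z)" "norm y < s"
      "x = y + (a + (\<Sum>v\<in>E. t v *\<^sub>R v))" "\<forall>v\<in>E. 0 < t v \<and> t v < 1"
      by (auto simp: cyl_def parallelotope_def)
    have xa: "x - a = y + (\<Sum>v\<in>E. t v *\<^sub>R v)" using y(3) by simp
    have cv: "c v \<bullet> (x - a) = t v" if "v \<in> E" for v unfolding xa by (rule coord[OF y(1) that])
    have "(\<Sum>v\<in>E. (c v \<bullet> (x - a)) *\<^sub>R v) = (\<Sum>v\<in>E. t v *\<^sub>R v)" by (intro sum.cong) (simp_all add: cv)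
    then show "x \<in> ?R" using xa y cv by simp
  next
    fix x assume x: "x \<in> ?R"
    obtain z y where zy: "z \<in> span E" "\<And>w. w \<in> span E \<Longrightarrow> orthogonal y w" "x - a = z + y"
      using orthogonal_subspace_decomp_exists[of E "x - a"] by blast
    obtain t where t: "z = (\<Sum>v\<in>E. t v *\<^sub>R v)" using zy(1) span_finite[OF E(1)] by auto
    have yo: "y \<in> orthogonal_comp (direction Z)"
      using zy(2) unfolding E(2)[symmetric] by (auto simp: orthogonal_comp_def orthogonal_commute)
    have cv: "c v \<bullet> (x - a) = t v" if "v \<in> E" for v
      using coord[OF yo that, of t] zy(3) t by (simp add: add.commute)
    have "(\<Sum>v\<in>E. (c v \<bullet> (x - a)) *\<^sub>R v) = z" unfolding t by (intro sum.cong) (simp_all add: cv)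
    then have "norm y < s" using x zy(3) by auto
    moreover have "a + z \<in> parallelotope a E"
      using x cv unfolding parallelotope_def t by auto
    moreover have "x = y + (a + z)" using zy(3) by (metis add.assoc add.commute diff_add_cancel)
    ultimately show "x \<in> cyl Z s (parallelotope a E)" using yo unfolding cyl_def by blast
  qed
qed

lemma open_cyl_parallelotope:
  assumes Z: "affine Z" and P: "parallelotope_in Z a E"
  shows "open (cyl Z s (parallelotope a E))"
proof -
  have "independent E" using P by (simp add: parallelotope_in_def)
  then obtain c where c: "\<forall>v\<in>E. c v \<in> span E \<and> (\<forall>w\<in>E. c v \<bullet> w = (if w = v then 1 else 0))"
    using exists_dual_basis by blast
  have "open {x. \<forall>v\<in>E. 0 < c v \<bullet> (x - a) \<and> c v \<bullet> (x - a) < 1}"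
  proof -
    have "{x. \<forall>v\<in>E. 0 < c v \<bullet> (x - a) \<and> c v \<bullet> (x - a) < 1} =
       (\<Inter>v\<in>E. {x. 0 < c v \<bullet> (x - a) \<and> c v \<bullet> (x - a) < 1})" by auto
    also have "open \<dots>"
      by (intro open_INT ballI parallelotope_in_span(1)[OF Z P] open_Collect_conj open_Collect_less continuous_intros)
    finally show ?thesis .
  qed
  then show ?thesis
    unfolding cyl_parallelotope_eq[OF Z P c]
    by (intro open_Collect_conj open_Collect_less continuous_intros)
qed

lemma bounded_cyl_parallelotope:
  assumes Z: "affine Z" and P: "parallelotope_in Z a E"
  shows "bounded (cyl Z s (parallelotope a E))"
proof (rule boundedI)
  fix x assume "x \<in> cyl Z s (parallelotope a E)"
  then obtain y t where y: "norm y < s"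
    "x = y + (a + (\<Sum>v\<in>E. t v *\<^sub>R v))" "\<forall>v\<in>E. 0 < t v \<and> t v < 1"
    by (auto simp: cyl_def parallelotope_def)
  have "norm (\<Sum>v\<in>E. t v *\<^sub>R v) \<le> (\<Sum>v\<in>E. norm v)"
  proof (rule sum_norm_le)
    fix v assume "v \<in> E"
    then have "\<bar>t v\<bar> \<le> 1" using y(3) by (auto simp: abs_if)
    then show "norm (t v *\<^sub>R v) \<le> norm v" by (simp add: mult_left_le_one_le)
  qed
  then show "norm x \<le> s + (norm a + (\<Sum>v\<in>E. norm v))"
    unfolding y(2) using y(1) norm_triangle_ineq[of y "a + (\<Sum>v\<in>E. t v *\<^sub>R v)"]
      norm_triangle_ineq[of a "\<Sum>v\<in>E. t v *\<^sub>R v"] by linarith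
qed

text \<open>The halved radius leaves slack in the Y direction, so a point of the small closed
  cylinder outside the large open one must lie on a face of the parallelotope. The face c \<bullet>
  x = \<delta> is a Euclidean hyperplane, encoded by a vector with \<open>lc_b\<close> equal to
  0.\<close>

lemma closure_cyl_faces:
  fixes Z :: "(real^'d::finite) set"
  assumes Z: "affine Z" and P: "parallelotope_in Z a E" and w: "0 < w"
  obtains N :: "'d mink set" where "finite N" "0 \<notin> N"
    "\<And>x. x \<in> closure (cyl Z (w / 2) (parallelotope a E)) \<Longrightarrow> x \<notin> cyl Z w (parallelotope a E) \<Longrightarrow>
      \<exists>n\<in>N. mform n (ray (Some x)) = 0"
proof -
  have "independent E" using P by (simp add: parallelotope_in_def)
  then obtain c where c: "\<forall>v\<in>E. c v \<in> span E \<and> (\<forall>w\<in>E. c v \<bullet> w = (if w = v then 1 else 0))"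
    using exists_dual_basis by blast
  define N where "N = (\<lambda>v. mink_of (c v) (c v \<bullet> a) (c v \<bullet> a)) ` E \<union> (\<lambda>v. mink_of (c v) (c v \<bullet> a + 1) (c v \<bullet> a + 1)) ` E"
  have finE: "finite E" by (rule parallelotope_in_span(1)[OF Z P])
  have c0: "c v \<noteq> 0" if "v \<in> E" for v
  proof
    assume "c v = 0"
    then have "c v \<bullet> v = 0" by simp
    then show False using c that by auto
  qed
  show ?thesis
  proof
    show "finite N" using finE by (simp add: N_def)
    show "0 \<notin> N"
    proof
      assume "0 \<in> N"
      then obtain v \<delta> where "v \<in> E" "0 = mink_of (c v) \<delta> \<delta>" by (auto simp: N_def)
      then have "c v = 0" by (metis mink_of_simps(1) spart_linear(4))
      then show False using c0 \<open>v \<in> E\<close> by blast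
    qed
    fix x assume x: "x \<in> closure (cyl Z (w / 2) (parallelotope a E))" "x \<notin> cyl Z w (parallelotope a E)"
    let ?C = "{x. norm (x - a - (\<Sum>v\<in>E. (c v \<bullet> (x - a)) *\<^sub>R v)) \<le> w / 2 \<and> (\<forall>v\<in>E. 0 \<le> c v \<bullet> (x - a) \<and> c v \<bullet> (x - a) \<le> 1)}"
    have "closed {x. \<forall>v\<in>E. 0 \<le> c v \<bullet> (x - a) \<and> c v \<bullet> (x - a) \<le> 1}"
    proof -
      have "{x. \<forall>v\<in>E. 0 \<le> c v \<bullet> (x - a) \<and> c v \<bullet> (x - a) \<le> 1} =
        (\<Inter>v\<in>E. {x. 0 \<le> c v \<bullet> (x - a) \<and> c v \<bullet> (x - a) \<le> 1})" by auto
      also have "closed \<dots>"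
        by (intro closed_INT ballI closed_Collect_conj closed_Collect_le continuous_intros)
      finally show ?thesis .
    qed
    then have clC: "closed ?C"
      by (intro closed_Collect_conj closed_Collect_le continuous_intros)
    have "cyl Z (w / 2) (parallelotope a E) \<subseteq> ?C"
      unfolding cyl_parallelotope_eq[OF Z P c] by (auto simp: less_imp_le)
    then have "x \<in> ?C" using closure_minimal[OF _ clC] x(1) by blast
    then obtain v where v: "v \<in> E" "c v \<bullet> (x - a) = 0 \<or> c v \<bullet> (x - a) = 1"
      using x(2) w unfolding cyl_parallelotope_eq[OF Z P c] by force
    have m: "mform (mink_of (c v) \<delta> \<delta>) (ray (Some x)) = 2 / ((norm x)\<^sup>2 + 1) * (c v \<bullet> x - \<delta>)" for \<delta>
    proof -
      have "lc_b (mink_of (c v) \<delta> \<delta>) = 0" by (simp add: lc_b_def)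
      then have "mform (mink_of (c v) \<delta> \<delta>) (lift x) = c v \<bullet> x - \<delta>"
        unfolding mform_lightcone by simp
      then show ?thesis by (simp add: ray_Some mform_linear)
    qed
    show "\<exists>n\<in>N. mform n (ray (Some x)) = 0"
      using v(2)
    proof
      assume "c v \<bullet> (x - a) = 0"
      then show ?thesis using m[of "c v \<bullet> a"] v(1)
        by (intro bexI[of _ "mink_of (c v) (c v \<bullet> a) (c v \<bullet> a)"]) (auto simp: N_def inner_diff_right)
    next
      assume "c v \<bullet> (x - a) = 1"
      then have "c v \<bullet> x - (c v \<bullet> a + 1) = 0" by (simp add: inner_diff_right)
      then show ?thesis using m[of "c v \<bullet> a + 1"] v(1)
        by (intro bexI[of _ "mink_of (c v) (c v \<bullet> a + 1) (c v \<bullet> a + 1)"]) (auto simp: N_def)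
    qed
  qed
qed

section \<open>Discrete subgroups\<close>

lemma mform_bound: "\<bar>mform u v\<bar> \<le> 3 * (norm u * norm v)"
proof -
  have "\<bar>u $ Inr True * v $ Inr True\<bar> \<le> norm u * norm v"
    unfolding abs_mult by (intro mult_mono component_le_norm_cart) auto
  then show ?thesis using Cauchy_Schwarz_ineq2[of u v] unfolding mform_def by linarith
qed

text \<open>The time coordinate of \<open>g *v e_T\<close> is cosh of the displacement of the base
  point. It bounds \<open>matrix_inv g *v e_T\<close>, hence the time coordinate of
  \<open>g *v w\<close>; invariance of the form bounds the rest. The constant 9 K + 2 is chosen so
  that its square exceeds 3 + 72 K^2.\<close>

lemma SO0_norm_bound:
  assumes g: "g \<in> carrier SO0" and K: "(g *v e_T) $ Inr True \<le> K"
  shows "norm (g *v w) \<le> (9 * K + 2) * norm w"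
proof -
  have gi: "matrix_inv g \<in> carrier SO0" by (rule SO0_inv[OF g])
  let ?e = "matrix_inv g *v e_T"
  have K1: "K \<ge> 1" using SO0_TT[OF g] K by linarith
  have T: "?e $ Inr True = (g *v e_T) $ Inr True"
    using SO0_mform_inv[OF g, of e_T e_T] by (simp add: e_T_form)
  have "?e \<bullet> ?e = mform ?e ?e + 2 * (?e $ Inr True * ?e $ Inr True)" by (simp add: mform_def)
  also have "\<dots> = 2 * (?e $ Inr True * ?e $ Inr True) - 1" by (simp add: SO0_mform[OF gi] e_T_form)
  also have "\<dots> \<le> 2 * (K * K)" 
    using mult_mono[OF K K] SO0_TT[OF g] K1 unfolding T by simp
  also have "\<dots> \<le> (2 * K) * (2 * K)" by simp
  finally have "norm ?e ^ 2 \<le> (2 * K) ^ 2"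
    unfolding power2_norm_eq_inner power2_eq_square[of "2 * K"] .
  then have ne: "norm ?e \<le> 2 * K" by (rule power2_le_imp_le) (use K1 in simp)
  have "(g *v w) $ Inr True = - mform w ?e"
    using SO0_mform_inv[OF g, of w e_T] by (simp add: e_T_form)
  then have "\<bar>(g *v w) $ Inr True\<bar> \<le> 3 * (norm w * norm ?e)" using mform_bound[of w ?e] by simp
  also have "\<dots> \<le> 3 * (norm w * (2 * K))" using ne by (intro mult_left_mono) auto
  finally have t: "\<bar>(g *v w) $ Inr True\<bar> \<le> 6 * K * norm w" by (simp add: mult_ac)
  have "(g *v w) \<bullet> (g *v w) = mform w w + 2 * ((g *v w) $ Inr True)\<^sup>2"
    using SO0_mform[OF g, of w w] by (simp add: mform_def power2_eq_square)
  also have "\<dots> \<le> 3 * (norm w)\<^sup>2 + 2 * (6 * K * norm w)\<^sup>2"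
    using mform_bound[of w w] power_mono[OF t, of 2] by (simp add: power2_eq_square)
  also have "\<dots> \<le> ((9 * K + 2) * norm w)\<^sup>2"
  proof -
    have "3 + 72 * K\<^sup>2 \<le> (9 * K + 2)\<^sup>2" using K1 by (simp add: power2_eq_square algebra_simps)
    then have "(3 + 72 * K\<^sup>2) * (norm w)\<^sup>2 \<le> (9 * K + 2)\<^sup>2 * (norm w)\<^sup>2"
      by (intro mult_right_mono) auto
    moreover have "3 * (norm w)\<^sup>2 + 2 * (6 * K * norm w)\<^sup>2 = (3 + 72 * K\<^sup>2) * (norm w)\<^sup>2"
      by (simp add: power_mult_distrib distrib_right)
    ultimately show ?thesis unfolding power_mult_distrib[of "9 * K + 2" "norm w"] by simp
  qed
  finally show ?thesis unfolding power2_norm_eq_inner[symmetric]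
    by (rule power2_le_imp_le) (use K1 in simp)
qed

text \<open>Bounded displacement bounds the matrix entries. Along a convergent subsequence the
  quotients of consecutive elements tend to the identity, which is isolated in
  \<open>\<Gamma>\<close>.\<close>

lemma discrete_subgroup_repeats:
  fixes f :: "nat \<Rightarrow> 'd::finite mat"
  assumes \<Gamma>: "subgroup \<Gamma> SO0" "discrete \<Gamma>" and f: "\<And>n. f n \<in> \<Gamma>"
    and K: "\<And>n. (f n *v e_T) $ Inr True \<le> K"
  shows "\<exists>n m. n < m \<and> f n = f m"
proof -
  note G = subgroup_SO0D[OF \<Gamma>(1)]
  have f0: "f n \<in> carrier SO0" for n using f G(1) by blast
  have K1: "K \<ge> 1" using SO0_TT[OF f0] K by (meson order_trans)
  define B where "B = (9 * K + 2)"
  have ent: "\<bar>f n $ i $ j\<bar> \<le> B" for n i j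
  proof -
    have "f n $ i $ j = (f n *v axis j 1) $ i" by (simp add: matrix_vector_mult_basis column_def)
    moreover have "\<bar>(f n *v axis j 1) $ i\<bar> \<le> norm (f n *v axis j 1)"
      by (rule component_le_norm_cart)
    moreover have "norm (f n *v axis j 1) \<le> B * norm (axis j (1::real) :: 'd mink)"
      unfolding B_def by (rule SO0_norm_bound[OF f0 K])
    ultimately show ?thesis by simp
  qed
  have "bounded (range f)"
  proof (rule boundedI)
    fix A assume "A \<in> range f"
    then obtain n where A: "A = f n" by blast
    have "norm A \<le> (\<Sum>i\<in>UNIV. norm (A $ i))" unfolding norm_vec_def by (rule L2_set_le_sum) simp
    also have "\<dots> \<le> (\<Sum>i\<in>(UNIV :: ('d + bool) set). \<Sum>j\<in>(UNIV :: ('d + bool) set). B)"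
    proof (rule sum_mono)
      fix i
      have "norm (A $ i) \<le> (\<Sum>j\<in>UNIV. \<bar>A $ i $ j\<bar>)" by (rule norm_le_l1_cart)
      also have "\<dots> \<le> (\<Sum>j\<in>(UNIV :: ('d + bool) set). B)" by (rule sum_mono) (simp add: A ent)
      finally show "norm (A $ i) \<le> (\<Sum>j\<in>(UNIV :: ('d + bool) set). B)" .
    qed
    finally show "norm A \<le> (\<Sum>i\<in>(UNIV :: ('d + bool) set). \<Sum>j\<in>(UNIV :: ('d + bool) set). B)" .
  qed
  then have "compact (closure (range f))" by (simp add: compact_closure)
  then have sc: "seq_compact (closure (range f))" by (rule compact_imp_seq_compact)
  have "\<forall>n. f n \<in> closure (range f)" using closure_subset[of "range f"] by blast
  then obtain A r where A: "strict_mono (r :: nat \<Rightarrow> nat)" "(f \<circ> r) \<longlonglongrightarrow> A"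
    using seq_compactE[OF sc] by blast
  have lim: "(\<lambda>n. f (r n)) \<longlonglongrightarrow> A" using A(2) by (simp add: comp_def)
  have lim1: "(\<lambda>n. f (r (Suc n))) \<longlonglongrightarrow> A" by (rule LIMSEQ_Suc[OF lim])
  have cont: "continuous_on UNIV (\<lambda>p :: 'd mat \<times> 'd mat. linv (fst p) ** snd p)"
    unfolding linv_def by (intro continuous_intros)
  have conv: "(\<lambda>n. linv (f (r n)) ** g n) \<longlonglongrightarrow> linv A ** C" if "g \<longlonglongrightarrow> C" for g and C :: "'d mat"
    using continuous_on_tendsto_compose[OF cont tendsto_Pair[OF lim that]] by simp
  have "linv (f (r n)) ** f (r n) = mat 1" for n by (rule linv_left[OF SO0_SO[OF f0]])
  then have "linv A ** A = mat 1" using conv[OF lim] by (simp add: LIMSEQ_const_iff)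
  then have h: "(\<lambda>n. linv (f (r n)) ** f (r (Suc n))) \<longlonglongrightarrow> mat 1" using conv[OF lim1] by simp
  obtain T where T: "open T" "mat 1 \<in> T" "T \<inter> \<Gamma> = {mat 1}"
    using \<Gamma>(2) G(2) unfolding discrete_def isolated_in_def by blast
  have "eventually (\<lambda>n. linv (f (r n)) ** f (r (Suc n)) \<in> T) sequentially"
    using h T(1,2) by (rule topological_tendstoD)
  then obtain n where n: "linv (f (r n)) ** f (r (Suc n)) \<in> T"
    unfolding eventually_sequentially by blast
  have "linv (f (r n)) \<in> \<Gamma>" using G(4)[OF f[of "r n"]]
    by (simp add: matrix_inv_SO[OF SO0_SO[OF f0]])
  then have "linv (f (r n)) ** f (r (Suc n)) = mat 1" using G(3) f n T(3) by blast
  then have "f (r n) ** (linv (f (r n)) ** f (r (Suc n))) = f (r n)" by simp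
  then have "f (r (Suc n)) = f (r n)"
    by (simp add: matrix_mul_assoc linv_right[OF SO0_SO[OF f0]])
  moreover have "r n < r (Suc n)" using A(1) by (simp add: strict_mono_Suc_iff)
  ultimately show ?thesis by metis
qed

lemma countable_discrete:
  fixes S :: "'a::second_countable_topology set"
  assumes "discrete S"
  shows "countable S"
proof -
  obtain B :: "'a set set" where B: "countable B" "\<And>C. C \<in> B \<Longrightarrow> open C"
    "\<And>U. open U \<Longrightarrow> \<exists>V. V \<subseteq> B \<and> U = \<Union>V"
    using univ_second_countable by blast
  have "\<forall>x\<in>S. \<exists>C. C \<in> B \<and> C \<inter> S = {x}"
  proof
    fix x assume x: "x \<in> S"
    then obtain T where T: "open T" "T \<inter> S = {x}"
      using assms unfolding discrete_def isolated_in_def by blast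
    obtain V where V: "V \<subseteq> B" "T = \<Union>V" using B(3)[OF T(1)] by blast
    then obtain C where C: "C \<in> V" "x \<in> C" using T(2) by blast
    then have "C \<inter> S = {x}" using T(2) V(2) x by blast
    then show "\<exists>C. C \<in> B \<and> C \<inter> S = {x}" using C V by blast
  qed
  then obtain h where h: "\<forall>x\<in>S. h x \<in> B \<and> h x \<inter> S = {x}" by (rule bchoice[THEN exE])
  have "inj_on h S" by (rule inj_onI) (use h in blast)
  moreover have "h ` S \<subseteq> B" using h by blast
  ultimately show ?thesis by (meson B(1) countable_image_inj_on countable_subset)
qed

section \<open>Limit points inside the fundamental region\<close>

context ps_group
begin

lemma limit_rays_nonempty: "limit_rays \<Gamma> \<noteq> {}"
proof
  assume "limit_rays \<Gamma> = {}"
  then have "limit_set \<Gamma> = {}" using limit_set_iff[OF grp(1)] by blast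
  moreover have "emeasure \<mu> (- limit_set \<Gamma>) = 0" using ps base unfolding ps_density_def by blast
  ultimately show False using mu_nonzero by simp
qed

text \<open>By Baire's theorem, a limit set avoiding the interior of every tile would have a piece in one face.\<close>

lemma limit_rays_meets_region:
  assumes disc: "discrete \<Gamma>" and L: "L \<subseteq> \<Gamma>"
    and Z: "affine Z" and P: "parallelotope_in Z a E" and w: "0 < w"
    and cover: "limit_set \<Gamma> \<subseteq> insert None
          (\<Union>\<gamma>\<in>L. bact \<gamma> ` Some ` closure (cyl Z (w / 2) (parallelotope a E)))"
  shows "\<exists>x\<in>cyl Z w (parallelotope a E). ray (Some x) \<in> limit_rays \<Gamma>"
proof (rule ccontr)
  assume none: "\<not> ?thesis"
  obtain N :: "'d mink set" where N: "finite N" "0 \<notin> N"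
    "\<And>x. x \<in> closure (cyl Z (w / 2) (parallelotope a E)) \<Longrightarrow> x \<notin> cyl Z w (parallelotope a E) \<Longrightarrow>
      \<exists>n\<in>N. mform n (ray (Some x)) = 0"
    using closure_cyl_faces[OF Z P w] by blast
  \<comment> \<open>Countably many hyperplanes: all translates of the faces, and the one of
    \<open>qinf\<close>, which meets \<open>celestial\<close> in \<open>qinf\<close> alone and
    accounts for \<infinity>.\<close>
  define M where "M = insert qinf ((\<lambda>(\<gamma>, n). \<gamma> *v n) ` (L \<times> N))"
  have "countable L" using countable_discrete[OF disc] L countable_subset by blast
  then have cM: "countable M" unfolding M_def
    by (intro countable_insert countable_image countable_SIGMA) (use N(1) countable_finite in auto)
  have M0: "m \<noteq> 0" if "m \<in> M" for m
  proof -
    have "qinf \<noteq> (0 :: 'd mink)" by (metis mink_of_simps(2) zero_index zero_neq_one)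
    moreover have "\<gamma> *v n \<noteq> 0" if "\<gamma> \<in> L" "n \<in> N" for \<gamma> n
    proof
      assume z: "\<gamma> *v n = 0"
      have "\<gamma> \<in> carrier SO0" using that L grp(1) by blast
      then have "n = matrix_inv \<gamma> *v (\<gamma> *v n)" by (simp add: SO0_inv_cancel)
      then show False using z that N(2) by simp
    qed
    ultimately show ?thesis using that by (auto simp: M_def)
  qed
  have cov: "\<exists>m\<in>M. mform m v = 0" if v: "v \<in> limit_rays \<Gamma>" for v
  proof -
    obtain \<xi> where \<xi>: "v = ray \<xi>" using v celestial_surj by (auto simp: limit_rays_def)
    then have "\<xi> \<in> limit_set \<Gamma>" using limit_set_iff[OF grp(1)] v by simp
    then consider "\<xi> = None" | \<gamma> x where "\<gamma> \<in> L" "x \<in> closure (cyl Z (w / 2) (parallelotope a E))" "\<xi> = bact \<gamma> (Some x)"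
      using cover by blast
    then show ?thesis
    proof cases
      case 1
      then show ?thesis using \<xi> by (intro bexI[of _ qinf]) (simp_all add: M_def ray_None)
    next
      case (2 \<gamma> x)
      have g: "\<gamma> \<in> \<Gamma>" "\<gamma> \<in> carrier SO0" using 2(1) L grp(1) by blast+
      have "ray (Some x) = ray (bact (matrix_inv \<gamma>) \<xi>)" using 2(3) bact_inv(1)[OF g(2)] by simp
      also have "\<dots> = tnorm (matrix_inv \<gamma> *v v)" using ray_bact(2)[OF SO0_inv[OF g(2)]] \<xi> by simp
      finally have "ray (Some x) \<in> limit_rays \<Gamma>"
        using limit_rays_invariant[OF subgroup grp(4)[OF g(1)] v] by simp
      then have "x \<notin> cyl Z w (parallelotope a E)" using none by blast
      then obtain n where n: "n \<in> N" "mform n (ray (Some x)) = 0" using N(3) 2(2) by blast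
      have "v = tnorm (\<gamma> *v ray (Some x))" using \<xi> 2(3) ray_bact(2)[OF g(2)] by simp
      then have "mform (\<gamma> *v n) v = 0" using n(2)
        by (simp add: tnorm_def mform_linear SO0_mform[OF g(2)])
      moreover have "\<gamma> *v n \<in> M" using 2(1) n(1) by (force simp: M_def)
      ultimately show ?thesis by blast
    qed
  qed
  define \<G> where "\<G> = (\<lambda>m. limit_rays \<Gamma> \<inter> {v. mform m v \<noteq> 0}) ` M"
  have "limit_rays \<Gamma> \<subseteq> closure (\<Inter>\<G>)"
  proof (rule Baire[OF closed_limit_rays])
    show "countable \<G>" unfolding \<G>_def using cM by (rule countable_image)
    fix T assume "T \<in> \<G>"
    then obtain m where m: "m \<in> M" "T = limit_rays \<Gamma> \<inter> {v. mform m v \<noteq> 0}" by (auto simp: \<G>_def)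
    have "open {v. mform m v \<noteq> 0}" by (intro open_Collect_neq continuous_intros)
    then have "openin (top_of_set (limit_rays \<Gamma>)) T" unfolding m(2) by (rule openin_open_Int)
    moreover have "limit_rays \<Gamma> \<subseteq> closure T"
    proof
      fix v assume v: "v \<in> limit_rays \<Gamma>"
      show "v \<in> closure T"
      proof (rule ccontr)
        assume "v \<notin> closure T"
        then have "m = 0"
          using closure_subset[of T] v m(2)
          by (intro limit_rays_not_in_hyperplane[OF subgroup zariski, of "- closure T"]) auto
        then show False using M0 m(1) by blast
      qed
    qed
    ultimately show "openin (top_of_set (limit_rays \<Gamma>)) T \<and> limit_rays \<Gamma> \<subseteq> closure T" ..
  qed
  moreover have "\<Inter>\<G> = {}"
  proof -
    \<comment> \<open>\<open>qinf\<close> also ensures that \<open>M\<close> is nonempty, so the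
      intersection is not the whole space.\<close>
    have "\<Inter>\<G> \<subseteq> limit_rays \<Gamma>" by (auto simp: \<G>_def M_def)
    moreover have "v \<notin> \<Inter>\<G>" if "v \<in> limit_rays \<Gamma>" for v using cov[OF that] by (auto simp: \<G>_def)
    ultimately show ?thesis by blast
  qed
  ultimately show False using limit_rays_nonempty by simp
qed

end

section \<open>Conformal derivatives\<close>

lemma matrix_inv_mult_SO0:
  assumes "g \<in> carrier SO0" "h \<in> carrier SO0"
  shows "matrix_inv (g ** h) = matrix_inv h ** matrix_inv g"
proof -
  have "matrix_inv (g ** h) = linv (g ** h)"
    using SO0_mult[OF assms] by (simp add: matrix_inv_SO SO0_SO)
  moreover have "matrix_inv h ** matrix_inv g = linv h ** linv g"
    using assms by (simp add: matrix_inv_SO SO0_SO)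
  moreover have "linv (g ** h) = linv h ** (lorentz_form ** lorentz_form) ** linv g"
    unfolding lorentz_form_sq by (simp add: linv_def matrix_transpose_mul matrix_mul_assoc)
      (metis lorentz_form_sq matrix_mul_assoc matrix_mul_rid)
  ultimately show ?thesis by (simp add: lorentz_form_sq)
qed

text \<open>The null vector of \<open>g\<close>-inverse of \<infinity>, left unnormalised so that
  \<open>bfac_pole\<close> holds without a factor.\<close>

definition pole :: "'d::finite mat \<Rightarrow> 'd mink" where
  "pole g = matrix_inv g *v qinf"

text \<open>Turns out to be the gradient of \<open>bfac g\<close>, and \<open>tgrad g\<close> that
  of \<open>tau g\<close>, the logarithm of \<open>bfac g\<close>.\<close>

definition bgrad :: "'d::finite mat \<Rightarrow> real^'d \<Rightarrow> real^'d" where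
  "bgrad g x = lc_b (pole g) *\<^sub>R x - spart (pole g)"

definition tgrad :: "'d::finite mat \<Rightarrow> real^'d \<Rightarrow> real^'d" where
  "tgrad g x = (1 / bfac g x) *\<^sub>R bgrad g x"

definition dlift :: "real^'d::finite \<Rightarrow> real^'d \<Rightarrow> 'd mink" where
  "dlift x e = mink_of e (x \<bullet> e) (x \<bullet> e)"

lemma bfac_pole: "g \<in> carrier SO0 \<Longrightarrow> bfac g x = - mform (lift x) (pole g)"
  by (simp add: pole_def bfac_mform_inv)

lemma bgrad_inner: "bgrad g x \<bullet> e = - mform (dlift x e) (pole g)"
  by (simp add: bgrad_def dlift_def mform_mink lc_b_def inner_simps inner_commute) (simp add: algebra_simps)

lemma tgrad_inner:
  "g \<in> carrier SO0 \<Longrightarrow> tgrad g x \<bullet> e = mform (dlift x e) (pole g) / mform (lift x) (pole g)"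
  by (simp add: tgrad_def bgrad_inner bfac_pole)

lemma pole_null:
  assumes "g \<in> carrier SO0"
  shows "mform (pole g) (pole g) = 0" "pole g $ Inr True > 0" "tnorm (pole g) \<in> celestial"
proof -
  show 1: "mform (pole g) (pole g) = 0" by (simp add: pole_def SO0_mform[OF SO0_inv[OF assms]])
  show 2: "pole g $ Inr True > 0" unfolding pole_def
    by (rule SO0_forward[OF SO0_inv[OF assms]]) simp_all
  show "tnorm (pole g) \<in> celestial" using 1 2 by (intro tnorm_celestial) auto
qed

text \<open>Expresses that \<open>tgrad\<close> has norm 2 / |x - \<xi>|, in a form that remains
  valid for the pole \<xi> = \<infinity>.\<close>

lemma norm_bgrad_sq:
  assumes "g \<in> carrier SO0"
  shows "(norm (bgrad g x))\<^sup>2 = 2 * lc_b (pole g) * bfac g x"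
proof -
  let ?u = "pole g"
  let ?F = "?u $ Inr False" and ?T = "?u $ Inr True"
  have U: "spart ?u \<bullet> spart ?u = ?T * ?T - ?F * ?F"
    using pole_null(1)[OF assms] by (simp add: mform_mink)
  have b: "bfac g x = - (x \<bullet> spart ?u + (x \<bullet> x - 1) / 2 * ?F - (x \<bullet> x + 1) / 2 * ?T)"
    unfolding bfac_pole[OF assms] mform_lift_mink_vec power2_norm_eq_inner by simp
  have "(norm (bgrad g x))\<^sup>2 = lc_b ?u * lc_b ?u * (x \<bullet> x) - 2 * lc_b ?u * (x \<bullet> spart ?u) + spart ?u \<bullet> spart ?u"
    unfolding power2_norm_eq_inner bgrad_def
    by (simp only: inner_diff_left inner_diff_right inner_scaleR_left inner_scaleR_right inner_commute[of "spart ?u" x])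
       (simp add: algebra_simps)
  then show ?thesis unfolding U b lc_b_def by (simp add: field_simps)
qed

lemma has_derivative_lift: "((\<lambda>x. lift x) has_derivative dlift x) (at x)"
proof (subst has_derivative_componentwise_within, rule ballI)
  fix i :: "'a mink" assume "i \<in> Basis"
  then obtain k where k: "i = axis k 1" by (auto simp: Basis_vec_def)
  have sq: "((\<lambda>x :: real^'a. (norm x)\<^sup>2) has_derivative (\<lambda>e. 2 * (x \<bullet> e))) (at x)"
    unfolding power2_norm_eq_inner by (rule derivative_eq_intros refl | simp add: inner_commute)+
  show "((\<lambda>x. lift x \<bullet> i) has_derivative (\<lambda>e. dlift x e \<bullet> i)) (at x)"
  proof (cases k)
    case (Inl j)
    have "(\<lambda>x :: real^'a. lift x \<bullet> i) = (\<lambda>x. x $ j)" "(\<lambda>e. dlift x e \<bullet> i) = (\<lambda>e. e $ j)"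
      by (simp_all add: k Inl inner_axis mink_vec_def dlift_def)
    then show ?thesis by (simp add: bounded_linear_imp_has_derivative bounded_linear_vec_nth)
  next
    case (Inr s)
    show ?thesis
    proof (cases s)
      case True
      have "(\<lambda>x :: real^'a. lift x \<bullet> i) = (\<lambda>x. ((norm x)\<^sup>2 + 1) / 2)" "(\<lambda>e. dlift x e \<bullet> i) = (\<lambda>e. x \<bullet> e)"
        by (simp_all add: k Inr True inner_axis dlift_def)
      then show ?thesis by (auto intro!: derivative_eq_intros sq)
    next
      case False
      have "(\<lambda>x :: real^'a. lift x \<bullet> i) = (\<lambda>x. ((norm x)\<^sup>2 - 1) / 2)" "(\<lambda>e. dlift x e \<bullet> i) = (\<lambda>e. x \<bullet> e)"
        by (simp_all add: k Inr False inner_axis dlift_def)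
      then show ?thesis by (auto intro!: derivative_eq_intros sq)
    qed
  qed
qed

lemma has_derivative_bfac:
  assumes "g \<in> carrier SO0"
  shows "(bfac g has_derivative (\<lambda>e. bgrad g x \<bullet> e)) (at x)"
proof -
  have "bounded_linear (\<lambda>v. - mform v (pole g))"
    unfolding linear_conv_bounded_linear[symmetric] by (rule linearI) (simp_all add: mform_linear)
  from bounded_linear.has_derivative[OF this has_derivative_lift, of x]
  have "((\<lambda>x. - mform (lift x) (pole g)) has_derivative (\<lambda>e. bgrad g x \<bullet> e)) (at x)"
    unfolding bgrad_inner .
  then show ?thesis unfolding bfac_pole[OF assms, symmetric] by simp
qed

lemma isCont_bfac: "g \<in> carrier SO0 \<Longrightarrow> isCont (bfac g) x"
  using has_derivative_bfac has_derivative_continuous by blast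

lemma continuous_on_bfac: "g \<in> carrier SO0 \<Longrightarrow> continuous_on S (bfac g)"
  by (simp add: continuous_at_imp_continuous_on isCont_bfac)

lemma bfac_ne_open: "g \<in> carrier SO0 \<Longrightarrow> open {x. bfac g x \<noteq> 0}"
  using continuous_on_bfac[of g UNIV] by (intro open_Collect_neq continuous_intros) auto

text \<open>Differentiability is clear from the formula. That the derivative is a similarity follows
  from \<open>emap_dist\<close>, which gives the norm of every difference quotient along a
  line.\<close>

lemma emap_has_derivative:
  assumes g: "g \<in> carrier SO0" and x: "bfac g x \<noteq> 0"
  obtains E where "(emap g has_derivative E) (at x)" "\<And>v. norm (E v) = norm v / bfac g x"
proof -
  have bl: "bounded_linear (\<lambda>v. spart (g *v v))"
    unfolding linear_conv_bounded_linear[symmetric]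
    by (rule linearI) (simp_all add: matrix_vector_right_distrib matrix_vector_mult_scaleR)
  have 1: "((\<lambda>x. spart (g *v lift x)) has_derivative (\<lambda>e. spart (g *v dlift x e))) (at x)"
    by (rule bounded_linear.has_derivative[OF bl has_derivative_lift])
  have "(\<lambda>x. inverse (bfac g x)) differentiable (at x)"
    using has_derivative_bfac[OF g, of x] x
    by (intro differentiable_inverse) (auto simp: differentiable_def)
  then have "(\<lambda>x. inverse (bfac g x) *\<^sub>R spart (g *v lift x)) differentiable (at x)"
    using 1 by (intro differentiable_scaleR) (auto simp: differentiable_def)
  moreover have "(\<lambda>x. inverse (bfac g x) *\<^sub>R spart (g *v lift x)) = emap g"
    by (simp add: emap_def fun_eq_iff inverse_eq_divide)
  ultimately obtain E where E: "(emap g has_derivative E) (at x)" by (auto simp: differentiable_def)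
  have pos: "bfac g x > 0" using bfac_nonneg[OF g, of x] x by simp
  have "norm (E v) = norm v / bfac g x" for v
  proof -
    have line: "((\<lambda>t. x + t *\<^sub>R v) has_derivative (\<lambda>t. t *\<^sub>R v)) (at (0::real))"
      by (auto intro!: derivative_eq_intros)
    have "(emap g has_derivative E) (at (x + 0 *\<^sub>R v))" using E by simp
    from has_derivative_compose[OF line this]
    have "((\<lambda>t. emap g (x + t *\<^sub>R v)) has_derivative (\<lambda>t. E (t *\<^sub>R v))) (at (0::real))" .
    moreover have "(\<lambda>t. E (t *\<^sub>R v)) = (\<lambda>t. t *\<^sub>R E v)"
      using has_derivative_bounded_linear[OF E]
      by (simp add: linear_simps fun_eq_iff bounded_linear.linear linear_scale)
    ultimately have "((\<lambda>t. emap g (x + t *\<^sub>R v)) has_derivative (\<lambda>t. t *\<^sub>R E v)) (at 0)" by simp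
    then have n0: "((\<lambda>t. norm (emap g (x + t *\<^sub>R v) - emap g x - t *\<^sub>R E v) / norm t) \<longlongrightarrow> 0) (at 0)"
      by (simp add: has_derivative_at)
    have "((\<lambda>t. norm ((emap g (x + t *\<^sub>R v) - emap g x) /\<^sub>R t - E v)) \<longlongrightarrow> 0) (at 0)"
    proof (rule Lim_transform_eventually[OF n0])
      have "norm (emap g (x + t *\<^sub>R v) - emap g x - t *\<^sub>R E v) / norm t =
          norm ((emap g (x + t *\<^sub>R v) - emap g x) /\<^sub>R t - E v)" if "t \<noteq> 0" for t
      proof -
        have "(emap g (x + t *\<^sub>R v) - emap g x) /\<^sub>R t - E v =
            (emap g (x + t *\<^sub>R v) - emap g x - t *\<^sub>R E v) /\<^sub>R t"
          using that by (simp add: scaleR_right_diff_distrib)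
        then show ?thesis by (simp add: divide_inverse mult.commute)
      qed
      then show "eventually (\<lambda>t. norm (emap g (x + t *\<^sub>R v) - emap g x - t *\<^sub>R E v) / norm t =
          norm ((emap g (x + t *\<^sub>R v) - emap g x) /\<^sub>R t - E v)) (at 0)"
        by (auto simp: eventually_at_filter)
    qed
    then have "((\<lambda>t. (emap g (x + t *\<^sub>R v) - emap g x) /\<^sub>R t - E v) \<longlongrightarrow> 0) (at 0)"
      by (rule tendsto_norm_zero_cancel)
    then have "((\<lambda>t. (emap g (x + t *\<^sub>R v) - emap g x) /\<^sub>R t) \<longlongrightarrow> E v) (at 0)"
      by (rule LIM_zero_cancel)
    then have L1: "((\<lambda>t. (norm ((emap g (x + t *\<^sub>R v) - emap g x) /\<^sub>R t))\<^sup>2) \<longlongrightarrow> (norm (E v))\<^sup>2) (at 0)"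
      by (intro tendsto_intros)
    have cb: "((\<lambda>t. bfac g (x + t *\<^sub>R v)) \<longlongrightarrow> bfac g x) (at 0)"
    proof -
      have "((\<lambda>t. x + t *\<^sub>R v) \<longlongrightarrow> x + 0 *\<^sub>R v) (at (0::real))" by (intro tendsto_intros)
      then show ?thesis using isCont_tendsto_compose[OF isCont_bfac[OF g]] by simp
    qed
    have L2: "((\<lambda>t. (norm v)\<^sup>2 / (bfac g (x + t *\<^sub>R v) * bfac g x)) \<longlongrightarrow> (norm v)\<^sup>2 / (bfac g x * bfac g x)) (at 0)"
      by (intro tendsto_intros cb) (use x in auto)
    have "eventually (\<lambda>t. bfac g (x + t *\<^sub>R v) > 0) (at 0)" using order_tendstoD(1)[OF cb pos] .
    then have "eventually (\<lambda>t. (norm v)\<^sup>2 / (bfac g (x + t *\<^sub>R v) * bfac g x) =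
        (norm ((emap g (x + t *\<^sub>R v) - emap g x) /\<^sub>R t))\<^sup>2) (at (0::real))"
      using eventually_neq_at_within[of "0::real" 0 UNIV]
    proof eventually_elim
      case (elim t)
      then have "(norm (emap g (x + t *\<^sub>R v) - emap g x))\<^sup>2 = (norm (t *\<^sub>R v))\<^sup>2 / (bfac g (x + t *\<^sub>R v) * bfac g x)"
        using emap_dist[OF g, of "x + t *\<^sub>R v" x] x by simp
      then show ?case using elim by (simp add: power_mult_distrib power_divide divide_simps)
    qed
    then have "((\<lambda>t. (norm ((emap g (x + t *\<^sub>R v) - emap g x) /\<^sub>R t))\<^sup>2) \<longlongrightarrow> (norm v)\<^sup>2 / (bfac g x * bfac g x)) (at 0)"
      by (rule Lim_transform_eventually[OF L2])
    then have "(norm (E v))\<^sup>2 = (norm v / bfac g x)\<^sup>2"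
      using tendsto_unique[OF _ L1] by (simp add: power_divide power2_eq_square[of "bfac g x"])
    then show ?thesis using pos by (simp add: power2_eq_iff_nonneg)
  qed
  then show ?thesis using E that by blast
qed

lemma the_bact_Some:
  assumes g: "g \<in> carrier SO0" and x: "bfac g x \<noteq> 0" and E: "(emap g has_derivative E) (at x)"
  shows "((\<lambda>y. the (bact g (Some y))) has_derivative E) (at x)"
  by (rule has_derivative_transform_within_open[OF E bfac_ne_open[OF g]]) (use x in \<open>auto simp: bact_Some\<close>)

lemma lin_dist_bact:
  assumes g: "g \<in> carrier SO0" and x: "bfac g x \<noteq> 0"
  shows "lin_dist (bact g) x = 1 / bfac g x"
proof -
  obtain E where E: "(emap g has_derivative E) (at x)" "\<And>v. norm (E v) = norm v / bfac g x"
    using emap_has_derivative[OF g x] by blast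
  have "frechet_derivative (\<lambda>y. the (bact g (Some y))) (at x) = E"
    using frechet_derivative_at[OF the_bact_Some[OF g x E(1)]] by simp
  moreover have "onorm E = 1 / bfac g x"
  proof (rule antisym)
    have pos: "bfac g x > 0" using bfac_nonneg[OF g, of x] x by simp
    show "onorm E \<le> 1 / bfac g x" by (rule onorm_bound) (use E(2) pos in auto)
    obtain v :: "real^'a" where v: "norm v = 1" using vector_choose_size[of 1] by auto
    have "norm (E v) \<le> onorm E * norm v" by (rule onorm[OF has_derivative_bounded_linear[OF E(1)]])
    then show "1 / bfac g x \<le> onorm E" using E(2)[of v] v by simp
  qed
  ultimately show ?thesis by (simp add: lin_dist_def)
qed

lemma has_derivative_ln_bfac:
  assumes g: "g \<in> carrier SO0" and x: "bfac g x \<noteq> 0"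
  shows "((\<lambda>y. ln (bfac g y)) has_derivative (\<lambda>e. tgrad g x \<bullet> e)) (at x)"
proof -
  have pos: "bfac g x > 0" using bfac_nonneg[OF g, of x] x by simp
  have "((\<lambda>y. ln (bfac g y)) has_derivative (\<lambda>e. (bgrad g x \<bullet> e) * inverse (bfac g x))) (at x)"
    using has_derivative_ln[OF pos has_derivative_bfac[OF g]] by (simp add: divide_inverse)
  moreover have "(\<lambda>e. (bgrad g x \<bullet> e) * inverse (bfac g x)) = (\<lambda>e. tgrad g x \<bullet> e)"
    by (simp add: tgrad_def divide_inverse mult.commute fun_eq_iff)
  ultimately show ?thesis by simp
qed

lemma has_derivative_tau:
  assumes g: "g \<in> carrier SO0" and x: "bfac g x \<noteq> 0"
  shows "(tau g has_derivative (\<lambda>e. tgrad g x \<bullet> e)) (at x)"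
proof (rule has_derivative_transform_within_open[OF has_derivative_ln_bfac[OF g x] bfac_ne_open[OF g]])
  show "x \<in> {x. bfac g x \<noteq> 0}" using x by simp
  fix y assume "y \<in> {x. bfac g x \<noteq> 0}"
  then have y: "bfac g y \<noteq> 0" by simp
  then have "bfac g y > 0" using bfac_nonneg[OF g, of y] by simp
  then show "ln (bfac g y) = tau g y"
    by (simp add: tau_def lin_dist_bact[OF g y] ln_div)
qed

lemma onorm_inner: "onorm (\<lambda>e. v \<bullet> e) = norm (v :: 'a::euclidean_space)"
proof (rule antisym)
  show "onorm (\<lambda>e. v \<bullet> e) \<le> norm v"
    by (rule onorm_bound) (simp_all add: Cauchy_Schwarz_ineq2)
  show "norm v \<le> onorm (\<lambda>e. v \<bullet> e)"
  proof (cases "v = 0")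
    case False
    have "norm (v \<bullet> v) \<le> onorm (\<lambda>e. v \<bullet> e) * norm v"
      by (rule onorm) (rule bounded_linear_inner_right)
    moreover have "norm (v \<bullet> v) = norm v * norm v" by (simp add: dot_square_norm power2_eq_square)
    ultimately show ?thesis using False by simp
  qed (simp add: onorm_zero)
qed

text \<open>Differentiate the logarithm of the cocycle \<open>bfac_mult\<close>; since
  \<open>h\<close> is conformal, the gradient of the outer factor is scaled by exactly 1 /
  \<open>bfac h x\<close>.\<close>

lemma tgrad_mult:
  assumes g: "g \<in> carrier SO0" and h: "h \<in> carrier SO0" and x: "bfac h x \<noteq> 0" "bfac g (emap h x) \<noteq> 0"
  shows "norm (tgrad (g ** h) x) \<le> norm (tgrad g (emap h x)) / bfac h x + norm (tgrad h x)"
proof -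
  obtain E where E: "(emap h has_derivative E) (at x)" "\<And>v. norm (E v) = norm v / bfac h x"
    using emap_has_derivative[OF h x(1)] by blast
  have gh: "g ** h \<in> carrier SO0" by (rule SO0_mult[OF g h])
  have nz: "bfac (g ** h) x \<noteq> 0" using bfac_mult(1)[OF g h x(1)] x by simp
  have d: "((\<lambda>y. ln (bfac g (emap h y)) + ln (bfac h y)) has_derivative
      (\<lambda>e. tgrad g (emap h x) \<bullet> E e + tgrad h x \<bullet> e)) (at x)"
    by (intro has_derivative_add has_derivative_ln_bfac[OF h x(1)]
      has_derivative_compose[OF E(1) has_derivative_ln_bfac[OF g x(2)]])
  have cont: "isCont (emap h) x" using E(1) has_derivative_continuous by blast
  have "((\<lambda>y. ln (bfac (g ** h) y)) has_derivative
      (\<lambda>e. tgrad g (emap h x) \<bullet> E e + tgrad h x \<bullet> e)) (at x)"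
  proof (rule has_derivative_transform_eventually[OF d])
    have 1: "eventually (\<lambda>y. bfac h y \<noteq> 0) (at x)"
      using isCont_bfac[OF h, of x] x(1)
      by (intro tendsto_imp_eventually_ne) (auto simp: isCont_def)
    have 2: "eventually (\<lambda>y. bfac g (emap h y) \<noteq> 0) (at x)"
      using isCont_o2[OF cont isCont_bfac[OF g]] x(2)
      by (intro tendsto_imp_eventually_ne) (auto simp: isCont_def)
    have *: "ln (bfac g (emap h y)) + ln (bfac h y) = ln (bfac (g ** h) y)"
      if "bfac h y \<noteq> 0" "bfac g (emap h y) \<noteq> 0" for y
      using that bfac_nonneg[OF h, of y] bfac_nonneg[OF g, of "emap h y"]
      by (simp add: bfac_mult(1)[OF g h] ln_mult)
    show "eventually (\<lambda>y. ln (bfac g (emap h y)) + ln (bfac h y) = ln (bfac (g ** h) y)) (at x)"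
      using 1 2 by eventually_elim (rule *)
    show "ln (bfac g (emap h x)) + ln (bfac h x) = ln (bfac (g ** h) x)" using * x by blast
  qed simp
  from has_derivative_unique[OF this has_derivative_ln_bfac[OF gh nz]]
  have eq: "tgrad g (emap h x) \<bullet> E e + tgrad h x \<bullet> e = tgrad (g ** h) x \<bullet> e" for e by metis
  have "onorm (\<lambda>e. tgrad (g ** h) x \<bullet> e) \<le> norm (tgrad g (emap h x)) / bfac h x + norm (tgrad h x)"
  proof (rule onorm_bound)
    fix e
    have "\<bar>tgrad (g ** h) x \<bullet> e\<bar> \<le> \<bar>tgrad g (emap h x) \<bullet> E e\<bar> + \<bar>tgrad h x \<bullet> e\<bar>"
      unfolding eq[symmetric] by (rule abs_triangle_ineq)
    also have "\<dots> \<le> norm (tgrad g (emap h x)) * norm (E e) + norm (tgrad h x) * norm e"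
      by (intro add_mono Cauchy_Schwarz_ineq2)
    finally show "norm (tgrad (g ** h) x \<bullet> e) \<le> (norm (tgrad g (emap h x)) / bfac h x + norm (tgrad h x)) * norm e"
      by (simp add: E(2) algebra_simps)
  qed (use bfac_nonneg[OF h, of x] in simp)
  then show ?thesis by (simp add: onorm_inner)
qed

section \<open>Inverse branches and the dual limit set\<close>

lemma closure_bounds_continuous:
  fixes f :: "'a::topological_space \<Rightarrow> real"
  assumes "continuous_on UNIV f" "\<And>x. x \<in> S \<Longrightarrow> c \<le> f x" "x \<in> closure S"
  shows "c \<le> f x"
proof -
  have "closed {x. c \<le> f x}" by (intro closed_Collect_le continuous_intros assms)
  moreover have "S \<subseteq> {x. c \<le> f x}" using assms(2) by auto
  ultimately show ?thesis using closure_minimal assms(3) by blast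
qed

lemma lift_nonzero: "lift (x :: real^'d::finite) \<noteq> 0"
proof
  assume "lift x = 0"
  then have "lc_b (lift x) = lc_b (0 :: 'd mink)" by (rule arg_cong)
  then show False by (simp add: lc_b_def[of 0])
qed

text \<open>What the argument takes from the coding, in terms of \<open>bfac\<close> and
  \<open>tgrad\<close>: \<open>\<Delta>\<close> is the Euclidean region and \<open>H\<close> the set
  of inverse branches. \<open>H_contract\<close> is the contraction by \<open>lam\<close>,
  \<open>H_grad\<close> the bounded distortion, and \<open>H_full\<close> says that the branch
  images fill \<open>\<Delta>\<close> up to a null set.\<close>

locale coding = ps_group \<Gamma> \<nu>
  for \<Gamma> :: "'d::finite mat set" and \<nu> :: "'d hpt \<Rightarrow> 'd bdry measure" +
  fixes \<Delta> :: "(real^'d) set" and H :: "'d mat set" and C1 lam :: real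
  assumes open_Delta: "open \<Delta>" and bounded_Delta: "bounded \<Delta>"
    and meets: "\<exists>x\<in>\<Delta>. ray (Some x) \<in> limit_rays \<Gamma>"
    and disc: "discrete \<Gamma>"
    and H_sub: "H \<subseteq> \<Gamma>"
    and H_maps: "\<gamma> \<in> H \<Longrightarrow> x \<in> \<Delta> \<Longrightarrow> bfac \<gamma> x \<noteq> 0 \<and> emap \<gamma> x \<in> \<Delta>"
    and lam: "0 < lam" "lam < 1" and C1: "0 < C1"
    and H_contract: "\<gamma> \<in> H \<Longrightarrow> x \<in> \<Delta> \<Longrightarrow> 1 / lam \<le> bfac \<gamma> x"
    and H_grad: "\<gamma> \<in> H \<Longrightarrow> x \<in> \<Delta> \<Longrightarrow> norm (tgrad \<gamma> x) \<le> C1"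
    and H_full: "emeasure \<mu> (Some ` \<Delta> - (\<Union>\<gamma>\<in>H. bact \<gamma> ` Some ` \<Delta>)) = 0"
begin

lemma H_SO0: "\<gamma> \<in> H \<Longrightarrow> \<gamma> \<in> carrier SO0"
  using H_sub grp(1) by blast

lemma words_in: "w \<in> words H n \<Longrightarrow> w \<in> \<Gamma>"
proof (induction n arbitrary: w)
  case 0
  then show ?case using grp(2) by simp
next
  case (Suc n)
  then show ?case using grp(3) H_sub by auto
qed

lemma words_SO0: "w \<in> words H n \<Longrightarrow> w \<in> carrier SO0"
  using words_in grp(1) by blast

lemma words_append: "v \<in> words H m \<Longrightarrow> w \<in> words H n \<Longrightarrow> v ** w \<in> words H (m + n)"
proof (induction m arbitrary: v)
  case (Suc m)
  then obtain \<gamma> v' where v: "v = \<gamma> ** v'" "\<gamma> \<in> H" "v' \<in> words H m" by auto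
  have "v ** w = \<gamma> ** (v' ** w)" using v(1) by (simp add: matrix_mul_assoc)
  then show ?case using Suc.IH[OF v(3) Suc.prems(2)] v(2) by auto
qed simp

lemma words_1: "\<gamma> \<in> H \<Longrightarrow> \<gamma> \<in> words H 1"
  by (auto intro!: exI[of _ \<gamma>])

abbreviation "rho \<equiv> 1 / lam"

lemma rho: "rho > 1"
  using lam by simp

lemma bfac_one: "bfac (mat 1) x = 1" "emap (mat 1) x = x"
  by (simp_all add: bfac_def emap_def)

lemma words_maps:
  assumes "w \<in> words H n" "x \<in> \<Delta>"
  shows "rho ^ n \<le> bfac w x \<and> emap w x \<in> \<Delta>"
  using assms(1)
proof (induction n arbitrary: w)
  case 0
  then show ?case using assms(2) by (simp add: bfac_one)
next
  case (Suc n)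
  then obtain \<gamma> v where v: "w = \<gamma> ** v" "\<gamma> \<in> H" "v \<in> words H n" by auto
  have IH: "rho ^ n \<le> bfac v x" "emap v x \<in> \<Delta>" using Suc.IH[OF v(3)] by auto
  have p: "rho ^ n > 0" using lam by simp
  then have nz: "bfac v x \<noteq> 0" using IH(1) by linarith
  note m = bfac_mult[OF H_SO0[OF v(2)] words_SO0[OF v(3)] nz]
  have "rho * rho ^ n \<le> bfac \<gamma> (emap v x) * bfac v x"
    using H_contract[OF v(2) IH(2)] IH(1) p bfac_nonneg[OF H_SO0[OF v(2)]] by (intro mult_mono) auto
  then show ?case using m v(1) H_maps[OF v(2) IH(2)] by simp
qed

lemma words_bfac_pos: "w \<in> words H n \<Longrightarrow> x \<in> \<Delta> \<Longrightarrow> 0 < bfac w x"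
proof -
  assume "w \<in> words H n" "x \<in> \<Delta>"
  then have "rho ^ n \<le> bfac w x" using words_maps by blast
  moreover have "0 < rho ^ n" using lam by simp
  ultimately show ?thesis by linarith
qed

lemma words_bfac_closure:
  assumes "w \<in> words H n" "x \<in> closure \<Delta>"
  shows "rho ^ n \<le> bfac w x"
  using closure_bounds_continuous[OF continuous_on_bfac[OF words_SO0[OF assms(1)]] _ assms(2)]
    words_maps[OF assms(1)] by blast

text \<open>The leftmost letter acts after a word of length n, so its distortion is damped by
  \<open>lam ^ n\<close>. The geometric series is the origin of C2 = C1 / (1 - lam).\<close>

lemma words_tgrad:
  assumes "w \<in> words H n" "x \<in> \<Delta>"
  shows "norm (tgrad w x) \<le> C1 * (\<Sum>k<n. lam ^ k)"
  using assms(1)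
proof (induction n arbitrary: w)
  case 0
  have "pole w = qinf" using 0 SO0_inv_cancel(3)[OF SO0_one, of qinf] by (simp add: pole_def)
  then show ?case using 0 by (simp add: tgrad_def bgrad_def lc_b_def)
next
  case (Suc n)
  then obtain \<gamma> v where v: "w = \<gamma> ** v" "\<gamma> \<in> H" "v \<in> words H n" by auto
  have ev: "emap v x \<in> \<Delta>" "rho ^ n \<le> bfac v x" using words_maps[OF v(3) assms(2)] by auto
  have p: "0 < bfac v x" by (rule words_bfac_pos[OF v(3) assms(2)])
  have "norm (tgrad w x) \<le> norm (tgrad \<gamma> (emap v x)) / bfac v x + norm (tgrad v x)"
    unfolding v(1) using H_maps[OF v(2) ev(1)] p
    by (intro tgrad_mult H_SO0 v words_SO0[OF v(3)]) auto
  also have "\<dots> \<le> C1 / rho ^ n + C1 * (\<Sum>k<n. lam ^ k)"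
    using H_grad[OF v(2) ev(1)] Suc.IH[OF v(3)] C1 ev(2) lam by (intro add_mono frac_le) auto
  finally show ?case using lam by (simp add: power_divide algebra_simps)
qed

lemma words_tgrad_bound:
  assumes "w \<in> words H n" "x \<in> \<Delta>"
  shows "norm (tgrad w x) \<le> C1 / (1 - lam)"
proof -
  have "(\<Sum>k<n. lam ^ k) = (1 - lam ^ n) / (1 - lam)" using lam by (simp add: sum_gp_strict)
  also have "\<dots> \<le> 1 / (1 - lam)" using lam by (intro divide_right_mono) auto
  finally have "C1 * (\<Sum>k<n. lam ^ k) \<le> C1 * (1 / (1 - lam))" using C1 by (intro mult_left_mono) auto
  then show ?thesis using words_tgrad[OF assms] by simp
qed

section \<open>Poles of words\<close>

definition K2 :: real where "K2 = C1 / (1 - lam)"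

definition upole :: "'d mat \<Rightarrow> 'd mink" where
  "upole w = tnorm (pole w)"

text \<open>\<open>Q\<close> consists of the boundary points \<open>\<xi>\<close> at which the gradient bound \<open>2 / |x - \<xi>| \<le> K2\<close>
  holds on \<open>\<Delta>\<close>; in terms of null vectors this is a closed condition that includes \<open>\<infinity>\<close>.\<close>

definition Q :: "'d mink set" where
  "Q = {u \<in> celestial. \<forall>x\<in>\<Delta>. 2 * lc_b u \<le> K2\<^sup>2 * (- mform (lift x) u)}"

text \<open>The squared gradient bound contains \<open>bfac\<close> on the left once and on the
  right twice, by \<open>norm_bgrad_sq\<close>; one factor cancels.\<close>

lemma upole_Q: assumes "w \<in> words H n" shows "upole w \<in> Q"
proof -
  note g = words_SO0[OF assms]
  have T: "pole w $ Inr True > 0" by (rule pole_null(2)[OF g])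
  have "2 * lc_b (upole w) \<le> K2\<^sup>2 * (- mform (lift x) (upole w))" if x: "x \<in> \<Delta>" for x
  proof -
    have b: "bfac w x > 0" by (rule words_bfac_pos[OF assms x])
    have "(norm (tgrad w x))\<^sup>2 \<le> K2\<^sup>2"
      using words_tgrad_bound[OF assms x] by (intro power_mono) (auto simp: K2_def)
    moreover have "(norm (tgrad w x))\<^sup>2 = (norm (bgrad w x))\<^sup>2 / (bfac w x)\<^sup>2"
      by (simp add: tgrad_def power_divide)
    ultimately have "(norm (bgrad w x))\<^sup>2 \<le> K2\<^sup>2 * (bfac w x)\<^sup>2" using b by (simp add: field_simps)
    then have "(2 * lc_b (pole w)) * bfac w x \<le> (K2\<^sup>2 * bfac w x) * bfac w x"
      unfolding norm_bgrad_sq[OF g] by (simp add: power2_eq_square mult.assoc)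
    then have "2 * lc_b (pole w) \<le> K2\<^sup>2 * bfac w x" using b by simp
    then have "2 * lc_b (pole w) \<le> K2\<^sup>2 * (- mform (lift x) (pole w))" unfolding bfac_pole[OF g] .
    then have "(1 / pole w $ Inr True) * (2 * lc_b (pole w)) \<le>
        (1 / pole w $ Inr True) * (K2\<^sup>2 * (- mform (lift x) (pole w)))"
      using T by (intro mult_left_mono) auto
    then show ?thesis by (simp add: upole_def tnorm_def lc_b_linear mform_linear)
  qed
  then show ?thesis using pole_null(3)[OF g] by (simp add: Q_def upole_def)
qed

lemma Q_celestial: "u \<in> Q \<Longrightarrow> u \<in> celestial"
  by (simp add: Q_def)

lemma qinf_Q: "qinf \<in> Q"
proof -
  have "mform (lift x) qinf = - 1" for x :: "real^'d" using lc_b_mform[of "lift x"] by simp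
  then show ?thesis by (simp add: Q_def celestial_def lc_b_def[of qinf])
qed

lemma compact_Q: "compact Q"
proof -
  have "Q = celestial \<inter> (\<Inter>x\<in>\<Delta>. {u. 2 * lc_b u \<le> K2\<^sup>2 * (- mform (lift x) u)})"
    by (auto simp: Q_def)
  also have "compact \<dots>"
    unfolding lc_b_mform
    by (intro compact_Int_closed compact_celestial closed_INT ballI closed_Collect_le continuous_intros)
  finally show ?thesis .
qed

text \<open>If a product were not positive, the inequality defining \<open>Q\<close> would force
  \<open>lc_b u\<close> to be 0, so \<open>u\<close> would be \<open>qinf\<close>, whose product
  with every lift is -1. Compactness makes the gap uniform.\<close>

lemma Q_separated: "\<exists>\<beta>>0. \<forall>x\<in>closure \<Delta>. \<forall>u\<in>Q. \<beta> \<le> - mform (lift x) u"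
proof -
  let ?f = "\<lambda>p. - mform (lift (fst p)) (snd p) :: real"
  have comp: "compact (closure \<Delta> \<times> Q)"
    using bounded_Delta compact_Q by (intro compact_Times) (simp_all add: compact_closure)
  have ne: "closure \<Delta> \<times> Q \<noteq> {}" using meets qinf_Q closure_subset by fastforce
  have "continuous_on (closure \<Delta> \<times> Q) ?f"
    by (intro continuous_intros)
  then obtain p where p: "p \<in> closure \<Delta> \<times> Q" "\<forall>p'\<in>closure \<Delta> \<times> Q. ?f p \<le> ?f p'"
    using continuous_attains_inf[OF comp ne] by blast
  obtain x u where xu: "p = (x, u)" "x \<in> closure \<Delta>" "u \<in> Q" using p(1) by auto
  have uc: "u \<in> celestial" using xu(3) by (rule Q_celestial)
  have "?f p > 0"
  proof (rule ccontr)
    assume "\<not> ?f p > 0"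
    then have le: "- mform (lift x) u \<le> 0" by (simp add: xu)
    have "0 \<le> K2\<^sup>2 * (- mform (lift x) u) - 2 * lc_b u"
      by (rule closure_bounds_continuous[OF _ _ xu(2), where f = "\<lambda>x. K2\<^sup>2 * (- mform (lift x) u) - 2 * lc_b u"])
        (use xu(3) in \<open>auto simp: Q_def intro!: continuous_intros\<close>)
    moreover have "K2\<^sup>2 * (- mform (lift x) u) \<le> 0" using le by (intro mult_nonneg_nonpos) auto
    ultimately have "lc_b u \<le> 0" by linarith
    moreover have "lc_b u \<ge> 0" using null_lc_b_nonneg[of u] uc by (auto simp: celestial_def)
    ultimately have "u = qinf" using null_cases(1)[of u] uc by (auto simp: celestial_def)
    then have "- mform (lift x) u = 1" using lc_b_mform[of "lift x"] by simp
    then show False using le by simp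
  qed
  then show ?thesis using p(2) by (intro exI[of _ "?f p"]) auto
qed

definition \<beta> :: real where
  "\<beta> = (SOME \<beta>. \<beta> > 0 \<and> (\<forall>x\<in>closure \<Delta>. \<forall>u\<in>Q. \<beta> \<le> - mform (lift x) u))"

lemma \<beta>: "\<beta> > 0" "x \<in> closure \<Delta> \<Longrightarrow> u \<in> Q \<Longrightarrow> \<beta> \<le> - mform (lift x) u"
  using someI_ex[OF Q_separated] unfolding \<beta>_def[symmetric] by auto

lemma \<beta>': "x \<in> \<Delta> \<Longrightarrow> u \<in> Q \<Longrightarrow> \<beta> \<le> - mform (lift x) u"
  using \<beta>(2) closure_subset by blast

lemma bounded_lift: "bounded (lift ` \<Delta>)"
proof -
  have "compact (lift ` closure \<Delta>)"
    using bounded_Delta by (intro compact_continuous_image continuous_intros) (simp add: compact_closure)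
  then show ?thesis
    using bounded_subset[OF compact_imp_bounded] closure_subset by (metis image_mono)
qed

lemma celestial_norm: "u \<in> celestial \<Longrightarrow> norm u = sqrt 2"
  by (simp add: celestial_def mform_def norm_eq_sqrt_inner)

lemma mform_celestial_bound: "u \<in> celestial \<Longrightarrow> v \<in> celestial \<Longrightarrow> \<bar>mform u v\<bar> \<le> 6"
  using mform_bound[of u v] by (simp add: celestial_norm)

lemma lift_bound: "\<exists>B>0. \<forall>x\<in>\<Delta>. \<forall>u. \<bar>mform (lift x) u\<bar> \<le> B * norm u"
proof -
  obtain B where B: "B > 0" "\<forall>v\<in>lift ` \<Delta>. norm v \<le> B" using bounded_lift bounded_pos by blast
  have "\<bar>mform (lift x) u\<bar> \<le> (3 * B) * norm u" if "x \<in> \<Delta>" for x u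
  proof -
    have "\<bar>mform (lift x) u\<bar> \<le> 3 * (norm (lift x) * norm u)" by (rule mform_bound)
    also have "\<dots> \<le> 3 * (B * norm u)" using B that by (intro mult_left_mono mult_right_mono) auto
    finally show ?thesis by simp
  qed
  then show ?thesis using B(1) by (intro exI[of _ "3 * B"]) auto
qed

text \<open>The product of \<open>lift x\<close> with \<open>matrix_inv w *v u\<close> equals the
  conformal factor at \<open>x\<close> times the product of \<open>u\<close> with a lift from
  \<open>\<Delta>\<close>; the first factor grows like \<open>rho ^ n\<close>, the second is bounded
  below by \<open>\<beta>\<close>. Growth of time coordinates is contraction after
  normalisation.\<close>

lemma backward_contraction:
  "\<exists>c>0. \<forall>n. \<forall>w\<in>words H n. \<forall>u\<in>Q. c * rho ^ n \<le> (matrix_inv w *v u) $ Inr True"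
proof -
  obtain x where x: "x \<in> \<Delta>" using meets by blast
  obtain B where B: "B > 0" "\<forall>x\<in>\<Delta>. \<forall>u. \<bar>mform (lift x) u\<bar> \<le> B * norm u" using lift_bound by blast
  define c where "c = \<beta> / (B * sqrt 2)"
  have c: "c > 0" using B(1) \<beta>(1) by (simp add: c_def)
  have "c * rho ^ n \<le> (matrix_inv w *v u) $ Inr True" if w: "w \<in> words H n" and u: "u \<in> Q" for n w u
  proof -
    note g = words_SO0[OF w]
    let ?v = "matrix_inv w *v u"
    have m: "rho ^ n \<le> bfac w x" "emap w x \<in> \<Delta>" using words_maps[OF w x] by auto
    have nz: "bfac w x \<noteq> 0" using words_bfac_pos[OF w x] by simp
    have T: "?v $ Inr True > 0"
      by (rule SO0_forward[OF SO0_inv[OF g]]) (use Q_celestial[OF u] in \<open>auto simp: celestial_def\<close>)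
    have "tnorm ?v \<in> celestial" by (rule tnorm_act_celestial[OF SO0_inv[OF g] Q_celestial[OF u]])
    have "rho ^ n * \<beta> \<le> bfac w x * (- mform (lift (emap w x)) u)"
      using m \<beta>'[OF m(2) u] \<beta>(1) lam words_bfac_pos[OF w x] by (intro mult_mono) auto
    also have "\<dots> = - mform (w *v lift x) u" by (simp add: emap_lift[OF g nz] mform_linear)
    also have "\<dots> = - mform (lift x) ?v" by (simp add: SO0_mform_inv[OF g])
    also have "\<dots> \<le> B * norm ?v" using B(2) x by (metis abs_le_D2)
    also have "norm ?v = norm (tnorm ?v) * ?v $ Inr True" using T by (simp add: tnorm_def)
    also have "norm (tnorm ?v) = sqrt 2" by (rule celestial_norm[OF \<open>tnorm ?v \<in> celestial\<close>])
    finally have "rho ^ n * \<beta> \<le> B * sqrt 2 * ?v $ Inr True" by (simp add: mult.assoc)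
    moreover have "rho ^ n * \<beta> = B * sqrt 2 * (c * rho ^ n)" using B(1) by (simp add: c_def)
    moreover have "B * sqrt 2 > 0" using B(1) by simp
    ultimately show ?thesis by (metis mult_le_cancel_left_pos)
  qed
  then show ?thesis using c by blast
qed

text \<open>Inverse words preserve \<open>mform u u'\<close>, while normalising divides it by two
  time coordinates of size at least \<open>c * rho ^ n\<close>.\<close>

lemma upole_close:
  "\<exists>K>0. \<forall>n. \<forall>w\<in>words H n. \<forall>u\<in>Q. \<forall>u'\<in>Q.
     norm (tnorm (matrix_inv w *v u) - tnorm (matrix_inv w *v u')) \<le> K * lam ^ n"
proof -
  obtain c where c: "c > 0" "\<forall>n. \<forall>w\<in>words H n. \<forall>u\<in>Q. c * rho ^ n \<le> (matrix_inv w *v u) $ Inr True"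
    using backward_contraction by blast
  have "norm (tnorm (matrix_inv w *v u) - tnorm (matrix_inv w *v u')) \<le> (4 / c) * lam ^ n"
    if w: "w \<in> words H n" and u: "u \<in> Q" "u' \<in> Q" for n w u u'
  proof -
    note g = SO0_inv[OF words_SO0[OF w]]
    let ?v = "matrix_inv w *v u" and ?v' = "matrix_inv w *v u'"
    let ?T = "?v $ Inr True" and ?T' = "?v' $ Inr True"
    have T: "c * rho ^ n \<le> ?T" "c * rho ^ n \<le> ?T'" using c(2) w u by blast+
    have p: "c * rho ^ n > 0" using c(1) lam by simp
    have "(norm (tnorm ?v - tnorm ?v'))\<^sup>2 = - 2 * mform (tnorm ?v) (tnorm ?v')"
      using celestial_dist[OF tnorm_act_celestial[OF g Q_celestial[OF u(1)]] tnorm_act_celestial[OF g Q_celestial[OF u(2)]]]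
      by simp
    also have "\<dots> = - 2 * mform u u' / (?T * ?T')"
      by (simp add: tnorm_def mform_linear SO0_mform[OF g])
    \<comment> \<open>Products on the sphere are at most 6 in absolute value; 16 is a perfect square
      above twice that.\<close>
    also have "\<dots> \<le> 16 / ((c * rho ^ n) * (c * rho ^ n))"
    proof (rule frac_le)
      show "- 2 * mform u u' \<le> 16"
        using mform_celestial_bound[OF Q_celestial[OF u(1)] Q_celestial[OF u(2)]] by linarith
      show "(c * rho ^ n) * (c * rho ^ n) \<le> ?T * ?T'" using T p by (intro mult_mono) auto
    qed (use p in auto)
    also have "\<dots> = ((4 / c) * lam ^ n)\<^sup>2"
      by (simp add: power2_eq_square power_divide)
    finally show ?thesis by (rule power2_le_imp_le) (use c(1) lam in simp)
  qed
  then show ?thesis using c(1) by (intro exI[of _ "4 / c"]) auto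
qed

section \<open>The dual limit set\<close>

lemma H_nonempty: "H \<noteq> {}"
proof
  assume "H = {}"
  then have z: "emeasure \<mu> (Some ` \<Delta>) = 0" using H_full by simp
  obtain W where W: "open W" "Some ` \<Delta> = {\<xi>. ray \<xi> \<in> W}"
    using openin_bdry_obtain[OF openin_bdry_Some[OF open_Delta]] by blast
  obtain x where x: "x \<in> \<Delta>" "ray (Some x) \<in> limit_rays \<Gamma>" using meets by blast
  then have "ray (Some x) \<in> W" using W(2) by blast
  then have "limit_rays \<Gamma> \<inter> W \<noteq> {}" using x by blast
  then show False using limit_rays_charged[OF W(1)] z W(2) by simp
qed

lemma words_nonempty: "words H n \<noteq> {}"
proof (induction n)
  case (Suc n)
  then show ?case using H_nonempty by auto
qed simp

text \<open>Approximation is demanded at all large word lengths, not just infinitely many, because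
  the theorem asks for words of every large length \<open>n0\<close>.\<close>

definition dual_limit :: "'d mink set" where
  "dual_limit = {p. \<forall>e>0. \<exists>n0. \<forall>n\<ge>n0. \<exists>w\<in>words H n. norm (upole w - p) < e}"

lemma upole_mult:
  assumes "v \<in> words H m" "w \<in> words H n"
  shows "upole (v ** w) = tnorm (matrix_inv w *v upole v)"
proof -
  note v = words_SO0[OF assms(1)] and w = words_SO0[OF assms(2)]
  have "pole (v ** w) = matrix_inv w *v pole v"
    by (simp add: pole_def matrix_inv_mult_SO0[OF v w] matrix_vector_mul_assoc)
  then show ?thesis unfolding upole_def
    using tnorm_mult[OF SO0_inv[OF w], of "pole v"] pole_null[OF v] by simp
qed

lemma upole_eq: "upole w = tnorm (matrix_inv w *v qinf)"
  by (simp add: upole_def pole_def)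

lemma dual_limit_Q: "p \<in> dual_limit \<Longrightarrow> p \<in> Q"
proof -
  assume p: "p \<in> dual_limit"
  have "p \<in> closure Q"
    unfolding closure_approachable
  proof (intro allI impI)
    fix e :: real assume "e > 0"
    then obtain n0 where n0: "\<forall>n\<ge>n0. \<exists>w\<in>words H n. norm (upole w - p) < e"
      using p unfolding dual_limit_def by blast
    then obtain w where "w \<in> words H n0" "norm (upole w - p) < e" by blast
    then show "\<exists>y\<in>Q. dist y p < e" using upole_Q by (auto simp: dist_norm)
  qed
  then show "p \<in> Q" using compact_Q by (simp add: compact_imp_closed closure_closed)
qed

text \<open>Any word put in front of \<open>w k\<close> moves the pole by at most K * lam ^ r k, so
  a single good \<open>w k\<close> provides approximations at all greater lengths.\<close>

lemma cluster_in_dual_limit: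
  assumes w: "\<And>k. w k \<in> words H (r k)" and r: "strict_mono (r :: nat \<Rightarrow> nat)"
    and lim: "(\<lambda>k. upole (w k)) \<longlonglongrightarrow> p"
  shows "p \<in> dual_limit"
  unfolding dual_limit_def
proof (intro CollectI allI impI)
  fix e :: real assume e: "e > 0"
  obtain K where K: "K > 0" "\<forall>n. \<forall>w\<in>words H n. \<forall>u\<in>Q. \<forall>u'\<in>Q.
     norm (tnorm (matrix_inv w *v u) - tnorm (matrix_inv w *v u')) \<le> K * lam ^ n"
    using upole_close by blast
  have "(\<lambda>n. K * lam ^ n) \<longlonglongrightarrow> K * 0" using lam by (intro tendsto_intros LIMSEQ_power_zero) auto
  then have "(\<lambda>k. K * lam ^ r k) \<longlonglongrightarrow> 0" using LIMSEQ_subseq_LIMSEQ[OF _ r] by (force simp: comp_def)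
  then have 1: "eventually (\<lambda>k. K * lam ^ r k < e / 2) sequentially" using e
    by (intro order_tendstoD(2)) auto
  have 2: "eventually (\<lambda>k. dist (upole (w k)) p < e / 2) sequentially" using lim e
    by (intro tendstoD) auto
  obtain k where k: "K * lam ^ r k < e / 2" "dist (upole (w k)) p < e / 2"
    using eventually_happens[OF eventually_conj[OF 1 2]] by auto
  show "\<exists>n0. \<forall>n\<ge>n0. \<exists>w\<in>words H n. norm (upole w - p) < e"
  proof (intro exI allI impI)
    fix n assume n: "r k \<le> n"
    obtain v where v: "v \<in> words H (n - r k)" using words_nonempty by blast
    have "norm (upole (v ** w k) - upole (w k)) \<le> K * lam ^ r k"
      unfolding upole_mult[OF v w] upole_eq[of "w k"] using K(2) w upole_Q[OF v] qinf_Q by blast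
    then have "norm (upole (v ** w k) - p) < e"
      using k norm_triangle_ineq[of "upole (v ** w k) - upole (w k)" "upole (w k) - p"]
      by (simp add: dist_norm)
    moreover have "v ** w k \<in> words H n" using words_append[OF v w[of k]] n by simp
    ultimately show "\<exists>w\<in>words H n. norm (upole w - p) < e" by blast
  qed
qed

lemma word_seq_cluster:
  assumes w: "\<And>n. w n \<in> words H n"
  obtains r p where "strict_mono (r :: nat \<Rightarrow> nat)" "(\<lambda>k. upole (w (r k))) \<longlonglongrightarrow> p" "p \<in> dual_limit"
proof -
  have "seq_compact Q" by (rule compact_imp_seq_compact[OF compact_Q])
  moreover have "\<forall>n. upole (w n) \<in> Q" using upole_Q w by blast
  ultimately obtain p r where r: "strict_mono (r :: nat \<Rightarrow> nat)" "((\<lambda>n. upole (w n)) \<circ> r) \<longlonglongrightarrow> p"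
    by (rule seq_compactE)
  have l: "(\<lambda>k. upole (w (r k))) \<longlonglongrightarrow> p" using r(2) by (simp add: comp_def)
  show ?thesis by (rule that[OF r(1) l cluster_in_dual_limit[of "\<lambda>k. w (r k)" r, OF w r(1) l]])
qed

lemma dual_limit_nonempty: "dual_limit \<noteq> {}"
proof -
  have "\<forall>n. \<exists>w. w \<in> words H n" using words_nonempty by blast
  then obtain w where "\<forall>n. w n \<in> words H n" by (rule choice[THEN exE])
  then show ?thesis using word_seq_cluster[of w] by blast
qed

text \<open>Appending \<open>\<gamma>\<close> to a word on the right applies its inverse to the
  pole; the extra letter shifts the length threshold by one.\<close>

lemma dual_limit_invariant:
  assumes g: "\<gamma> \<in> H" and p: "p \<in> dual_limit"
  shows "tnorm (matrix_inv \<gamma> *v p) \<in> dual_limit"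
  unfolding dual_limit_def
proof (intro CollectI allI impI)
  fix e :: real assume e: "e > 0"
  note g0 = SO0_inv[OF H_SO0[OF g]]
  have pc: "p \<in> celestial" using p dual_limit_Q Q_celestial by blast
  have "(matrix_inv \<gamma> *v p) $ Inr True > 0"
    by (rule SO0_forward[OF g0]) (use pc in \<open>auto simp: celestial_def\<close>)
  then have "((\<lambda>u. tnorm (matrix_inv \<gamma> *v u)) \<longlongrightarrow> tnorm (matrix_inv \<gamma> *v p)) (nhds p)"
    by (intro tendsto_tnorm tendsto_matrix_vector filterlim_ident) simp
  then have "eventually (\<lambda>u. dist (tnorm (matrix_inv \<gamma> *v u)) (tnorm (matrix_inv \<gamma> *v p)) < e) (nhds p)"
    using e by (rule tendstoD)
  then obtain d where d: "d > 0" "\<And>u. dist u p < d \<Longrightarrow> dist (tnorm (matrix_inv \<gamma> *v u)) (tnorm (matrix_inv \<gamma> *v p)) < e"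
    unfolding eventually_nhds_metric by blast
  obtain n0 where n0: "\<forall>n\<ge>n0. \<exists>w\<in>words H n. norm (upole w - p) < d"
    using p d(1) unfolding dual_limit_def by blast
  show "\<exists>n0. \<forall>n\<ge>n0. \<exists>w\<in>words H n. norm (upole w - tnorm (matrix_inv \<gamma> *v p)) < e"
  proof (intro exI allI impI)
    fix n assume n: "Suc n0 \<le> n"
    then have "n0 \<le> n - 1" by simp
    then obtain w where w: "w \<in> words H (n - 1)" "norm (upole w - p) < d" using n0 by blast
    have "norm (upole (w ** \<gamma>) - tnorm (matrix_inv \<gamma> *v p)) < e"
      using d(2)[of "upole w"] w(2) upole_mult[OF w(1) words_1[OF g]] by (simp add: dist_norm)
    moreover have "w ** \<gamma> \<in> words H n" using words_append[OF w(1) words_1[OF g]] n by simp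
    ultimately show "\<exists>w\<in>words H n. norm (upole w - tnorm (matrix_inv \<gamma> *v p)) < e" by blast
  qed
qed

section \<open>Coded points\<close>

definition coded_set :: "nat \<Rightarrow> 'd bdry set" where
  "coded_set n = (\<Union>w\<in>words H n. bact w ` Some ` \<Delta>)"

lemma countable_H: "countable H"
  using countable_discrete[OF disc] H_sub countable_subset by blast

lemma countable_words: "countable (words H n)"
  by (rule countable_subset[OF _ countable_discrete[OF disc]]) (use words_in in blast)

lemma Delta_sets: "Some ` \<Delta> \<in> sets \<mu>"
  by (simp add: sets_mu openin_bdry_Some open_Delta)

lemma coded_set_sets: "coded_set n \<in> sets \<mu>"
  unfolding coded_set_def
  by (intro sets.countable_UN'' countable_words bact_image_sets Delta_sets) (use words_SO0 in blast)+

text \<open>A point missing at level n + 1 is missing at level 1 or is the image under a branch of a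
  point missing at level n. There are countably many branches, and each preserves null sets.\<close>

lemma coded_set_null: "Some ` \<Delta> - coded_set n \<in> null_sets \<mu>"
proof (induction n)
  case 0
  have e: "Some ` \<Delta> - coded_set 0 = {}" by (auto simp: coded_set_def)
  show ?case by (subst e) simp
next
  case (Suc n)
  let ?F = "Some ` \<Delta> - (\<Union>\<gamma>\<in>H. bact \<gamma> ` Some ` \<Delta>)"
  have F: "?F \<in> null_sets \<mu>"
  proof -
    have "(\<Union>\<gamma>\<in>H. bact \<gamma> ` Some ` \<Delta>) \<in> sets \<mu>"
      by (intro sets.countable_UN'' countable_H bact_image_sets Delta_sets) (use H_SO0 in blast)+
    then show ?thesis using H_full Delta_sets by (simp add: null_sets_def sets.Diff)
  qed
  have G: "(\<Union>\<gamma>\<in>H. bact \<gamma> ` (Some ` \<Delta> - coded_set n)) \<in> null_sets \<mu>"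
  proof (rule null_sets_UN'[OF countable_H])
    fix \<gamma> assume g: "\<gamma> \<in> H"
    have gi: "matrix_inv \<gamma> \<in> \<Gamma>" using g H_sub grp(4) by blast
    have "bact (matrix_inv \<gamma>) -` (Some ` \<Delta> - coded_set n) \<in> null_sets \<mu>"
      using quasi_invariant[OF gi, of "Some ` \<Delta> - coded_set n"] Suc.IH by (simp add: null_sets_def)
    then show "bact \<gamma> ` (Some ` \<Delta> - coded_set n) \<in> null_sets \<mu>"
      by (simp add: bact_image[OF H_SO0[OF g]])
  qed
  have "Some ` \<Delta> - coded_set (Suc n) \<subseteq> ?F \<union> (\<Union>\<gamma>\<in>H. bact \<gamma> ` (Some ` \<Delta> - coded_set n))"
  proof
    fix \<xi> assume \<xi>: "\<xi> \<in> Some ` \<Delta> - coded_set (Suc n)"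
    show "\<xi> \<in> ?F \<union> (\<Union>\<gamma>\<in>H. bact \<gamma> ` (Some ` \<Delta> - coded_set n))"
    proof (cases "\<xi> \<in> ?F")
      case False
      then obtain \<gamma> \<zeta> where g: "\<gamma> \<in> H" "\<zeta> \<in> Some ` \<Delta>" "\<xi> = bact \<gamma> \<zeta>" using \<xi> by blast
      have "\<zeta> \<notin> coded_set n"
      proof
        assume "\<zeta> \<in> coded_set n"
        then obtain w z where w: "w \<in> words H n" "z \<in> Some ` \<Delta>" "\<zeta> = bact w z"
          unfolding coded_set_def by blast
        then have "\<xi> = bact (\<gamma> ** w) z" using g(3) bact_mult[OF H_SO0[OF g(1)] words_SO0[OF w(1)]]
          by simp
        moreover have "\<gamma> ** w \<in> words H (Suc n)" using g(1) w(1) by auto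
        ultimately have "\<xi> \<in> coded_set (Suc n)" using w(2) unfolding coded_set_def by blast
        then show False using \<xi> by blast
      qed
      then show ?thesis using g by blast
    qed simp
  qed
  moreover have "?F \<union> (\<Union>\<gamma>\<in>H. bact \<gamma> ` (Some ` \<Delta> - coded_set n)) \<in> null_sets \<mu>" using F G
    by (rule null_sets.Un)
  moreover have "Some ` \<Delta> - coded_set (Suc n) \<in> sets \<mu>" using Delta_sets coded_set_sets
    by (rule sets.Diff)
  ultimately show ?case by (rule null_sets_subset[rotated 2])
qed

text \<open>Points coded to all depths have full measure in \<open>\<Delta>\<close>, whereas
  \<open>\<mu>\<close> charges the part of \<open>\<Delta>\<close> off any hyperplane.\<close>

lemma coded_points_not_in_hyperplane:
  assumes n: "n \<noteq> 0"
  obtains x where "x \<in> \<Delta>" "\<And>k. Some x \<in> coded_set k" "mform n (ray (Some x)) \<noteq> 0"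
proof (rule ccontr)
  assume "\<not> thesis"
  then have *: "\<And>x. x \<in> \<Delta> \<Longrightarrow> \<forall>k. Some x \<in> coded_set k \<Longrightarrow> mform n (ray (Some x)) = 0" using that
    by blast
  obtain W where W: "open W" "Some ` \<Delta> = {\<xi>. ray \<xi> \<in> W}"
    using openin_bdry_obtain[OF openin_bdry_Some[OF open_Delta]] by blast
  obtain x where x: "x \<in> \<Delta>" "ray (Some x) \<in> limit_rays \<Gamma>" using meets by blast
  then have "ray (Some x) \<in> W" using W(2) by blast
  then have ne: "limit_rays \<Gamma> \<inter> W \<noteq> {}" using x by blast
  let ?A = "{\<xi>. ray \<xi> \<in> W \<and> mform n (ray \<xi>) \<noteq> 0}"
  have "open {v. mform n v \<noteq> 0}" by (intro open_Collect_neq continuous_intros)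
  then have "open (W \<inter> {v. mform n v \<noteq> 0})" using W(1) by (rule open_Int[rotated])
  then have A: "?A \<in> sets \<mu>" using ray_sets[of "W \<inter> {v. mform n v \<noteq> 0}"] by simp
  have "?A \<subseteq> (\<Union>k. Some ` \<Delta> - coded_set k)"
  proof
    fix \<xi> assume \<xi>: "\<xi> \<in> ?A"
    then have "\<xi> \<in> Some ` \<Delta>" using W(2) by blast
    then obtain x where "x \<in> \<Delta>" "\<xi> = Some x" by blast
    then show "\<xi> \<in> (\<Union>k. Some ` \<Delta> - coded_set k)" using * \<xi> by blast
  qed
  moreover have "(\<Union>k. Some ` \<Delta> - coded_set k) \<in> null_sets \<mu>" using coded_set_null
    by (intro null_sets_UN) auto
  ultimately have "?A \<in> null_sets \<mu>" using A null_sets_subset by blast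
  then show False using limit_rays_hyperplane_charged[OF W(1) ne n] by (simp add: null_sets_def)
qed

text \<open>The words are chosen independently for each \<open>k\<close> and need not extend one
  another; their lengths are what matters.\<close>

lemma coded_word:
  assumes "\<And>k. Some x \<in> coded_set k"
  obtains w y where "\<And>k. w k \<in> words H k" "\<And>k. y k \<in> \<Delta>"
    "\<And>k. lift x = (1 / bfac (w k) (y k)) *\<^sub>R (w k *v lift (y k))"
proof -
  have "\<forall>k. \<exists>p. fst p \<in> words H k \<and> snd p \<in> \<Delta> \<and> Some x = bact (fst p) (Some (snd p))"
    using assms unfolding coded_set_def by fastforce
  then obtain p where p: "\<forall>k. fst (p k) \<in> words H k \<and> snd (p k) \<in> \<Delta> \<and> Some x = bact (fst (p k)) (Some (snd (p k)))"
    by (rule choice[THEN exE])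
  have "lift x = (1 / bfac (fst (p k)) (snd (p k))) *\<^sub>R (fst (p k) *v lift (snd (p k)))" for k
  proof -
    have 1: "bfac (fst (p k)) (snd (p k)) \<noteq> 0" "x = emap (fst (p k)) (snd (p k))"
      using p bact_SomeD[of "fst (p k)" "snd (p k)" x] by metis+
    then show ?thesis using emap_lift[OF words_SO0, of "fst (p k)" k] p by simp
  qed
  then show ?thesis using that[of "\<lambda>k. fst (p k)" "\<lambda>k. snd (p k)"] p by blast
qed

end

section \<open>The dual limit set spans\<close>

context coding
begin

lemma inv_power_lam: "1 / rho ^ k = lam ^ k"
  using lam by (simp add: power_divide)

text \<open>The Lorentz complement of the span of the dual limit set.\<close>

definition annihilator :: "'d mink set" where
  "annihilator = {n. \<forall>p\<in>dual_limit. mform n p = 0}"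

text \<open>Invariance of the dual limit set under inverse branches makes \<open>\<gamma>\<close>
  map the annihilator into itself. A dimension count turns inclusion into equality, and so gives
  invariance in the other direction, which pushing dual limit points forward requires.\<close>

lemma annihilator_inverse:
  assumes g: "\<gamma> \<in> H" and n: "n \<in> annihilator"
  shows "matrix_inv \<gamma> *v n \<in> annihilator"
proof -
  note g0 = H_SO0[OF g]
  have fwd: "\<gamma> *v n \<in> annihilator" if "n \<in> annihilator" for n
    unfolding annihilator_def
  proof (intro CollectI ballI)
    fix p assume p: "p \<in> dual_limit"
    have pc: "p \<in> celestial" using p dual_limit_Q Q_celestial by blast
    have "(matrix_inv \<gamma> *v p) $ Inr True > 0"
      by (rule SO0_forward[OF SO0_inv[OF g0]]) (use pc in \<open>auto simp: celestial_def\<close>)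
    moreover have "mform n (tnorm (matrix_inv \<gamma> *v p)) = 0"
      using that dual_limit_invariant[OF g p] by (auto simp: annihilator_def)
    ultimately have "mform n (matrix_inv \<gamma> *v p) = 0" by (simp add: tnorm_def mform_linear)
    then show "mform (\<gamma> *v n) p = 0" by (simp add: SO0_mform_inv[OF g0])
  qed
  have sub: "subspace annihilator"
    by (rule subspaceI) (auto simp: annihilator_def mform_linear)
  have lin: "linear (\<lambda>n. \<gamma> *v n)" by (rule matrix_vector_mul_linear)
  have inj: "inj_on (\<lambda>n. \<gamma> *v n) (span annihilator)"
    by (rule inj_on_inverseI[of _ "\<lambda>n. matrix_inv \<gamma> *v n"]) (simp add: SO0_inv_cancel[OF g0])
  have "dim annihilator = dim ((\<lambda>n. \<gamma> *v n) ` annihilator)"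
    using dim_image_eq[OF lin inj] by simp
  moreover have "(\<lambda>n. \<gamma> *v n) ` annihilator \<subseteq> annihilator" using fwd by blast
  ultimately have "(\<lambda>n. \<gamma> *v n) ` annihilator = annihilator"
    by (intro subspace_dim_equal linear_subspace_image[OF lin] sub) auto
  then obtain n' where "n' \<in> annihilator" "n = \<gamma> *v n'" using n by blast
  then show ?thesis by (simp add: SO0_inv_cancel[OF g0])
qed

lemma annihilator_words_inverse:
  "w \<in> words H k \<Longrightarrow> n \<in> annihilator \<Longrightarrow> matrix_inv w *v n \<in> annihilator"
proof (induction k arbitrary: w n)
  case 0
  then show ?case using SO0_inv_cancel(3)[OF SO0_one, of n] by simp
next
  case (Suc k)
  then obtain \<gamma> v where v: "w = \<gamma> ** v" "\<gamma> \<in> H" "v \<in> words H k" by auto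
  have "matrix_inv w *v n = matrix_inv v *v (matrix_inv \<gamma> *v n)"
    unfolding v(1) by (simp add: matrix_inv_mult_SO0[OF H_SO0[OF v(2)] words_SO0[OF v(3)]] matrix_vector_mul_assoc)
  then show ?case using Suc.IH[OF v(3) annihilator_inverse[OF v(2) Suc.prems(2)]] by simp
qed

text \<open>A coded point \<open>x\<close> is the limit of \<open>w\<^sub>k \<eta>\<close> for every \<open>\<eta>\<close> other than a cluster point of the poles
  \<open>w\<^sub>k\<^sup>-\<^sup>1 \<infinity>\<close>, and \<open>w\<^sub>k \<eta>\<close> stays in every invariant subspace that contains \<open>\<eta>\<close>.\<close>

lemma coded_point_annihilated:
  assumes p12: "p1 \<in> dual_limit" "p2 \<in> dual_limit" "p1 \<noteq> p2"
    and x: "\<And>k. Some x \<in> coded_set k" and n: "n \<in> annihilator"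
  shows "mform n (ray (Some x)) = 0"
proof -
  obtain w y where w: "\<And>k. w k \<in> words H k" and y: "\<And>k. y k \<in> \<Delta>"
    and xw: "\<And>k. lift x = (1 / bfac (w k) (y k)) *\<^sub>R (w k *v lift (y k))"
    using coded_word[OF x] by blast
  obtain r p where r: "strict_mono (r :: nat \<Rightarrow> nat)" "(\<lambda>k. upole (w (r k))) \<longlonglongrightarrow> p" "p \<in> dual_limit"
    using word_seq_cluster[OF w] by blast
  obtain \<eta> where \<eta>: "\<eta> \<in> dual_limit" "\<eta> \<noteq> p" using p12 by blast
  have c: "\<eta> \<in> celestial" "p \<in> celestial" using \<eta> r(3) dual_limit_Q Q_celestial by blast+
  have neg: "mform \<eta> p < 0" by (rule celestial_mform_neg[OF c \<eta>(2)])
  obtain B where B: "B > 0" "\<forall>x\<in>\<Delta>. \<forall>u. \<bar>mform (lift x) u\<bar> \<le> B * norm u" using lift_bound by blast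
  obtain a where a: "a > 0" "\<forall>n. \<forall>w\<in>words H n. \<forall>u\<in>Q. a * rho ^ n \<le> (matrix_inv w *v u) $ Inr True"
    using backward_contraction by blast
  note w0 = words_SO0[OF w]
  define z where "z k = w k *v \<eta>" for k
  define s where "s k = tnorm (z k)" for k
  have zT: "z k $ Inr True > 0" for k
    unfolding z_def by (rule SO0_forward[OF w0]) (use c in \<open>auto simp: celestial_def\<close>)
  have sc: "s k \<in> celestial" for k
    unfolding s_def z_def by (rule tnorm_act_celestial[OF w0 c(1)])
  have sn: "mform n (s k) = 0" for k
  proof -
    have "matrix_inv (w k) *v n \<in> annihilator" by (rule annihilator_words_inverse[OF w n])
    then have "mform \<eta> (matrix_inv (w k) *v n) = 0" using \<eta>(1)
      by (auto simp: annihilator_def mform_sym[of \<eta>])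
    then have "mform (z k) n = 0" by (simp add: z_def SO0_mform_inv[OF w0])
    then show ?thesis by (simp add: s_def tnorm_def mform_linear mform_sym[of n])
  qed
  \<comment> \<open>Up to scaling both \<open>lift x\<close> and \<open>z k\<close> are images under
    \<open>w k\<close>. Their product is therefore a bounded product divided by a conformal factor
    of at least \<open>rho ^ k\<close>.\<close>
  have up: "\<bar>mform (lift x) (z k)\<bar> \<le> (B * sqrt 2) * lam ^ k" for k
  proof -
    have b: "rho ^ k \<le> bfac (w k) (y k)" using words_maps[OF w y] by blast
    have p: "0 < rho ^ k" using lam by simp
    have "mform (lift x) (z k) = mform (lift (y k)) \<eta> / bfac (w k) (y k)"
      unfolding xw[of k] z_def by (simp add: mform_linear SO0_mform[OF w0])
    then have "\<bar>mform (lift x) (z k)\<bar> = \<bar>mform (lift (y k)) \<eta>\<bar> / bfac (w k) (y k)"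
      using b p by (simp add: abs_div)
    also have "\<dots> \<le> (B * sqrt 2) / rho ^ k"
    proof (rule frac_le)
      show "\<bar>mform (lift (y k)) \<eta>\<bar> \<le> B * sqrt 2"
        using B(2) y celestial_norm[OF c(1)] by metis
    qed (use B(1) b p in auto)
    also have "\<dots> = (B * sqrt 2) * lam ^ k" using inv_power_lam[of k] by (simp add: divide_inverse)
    finally show ?thesis .
  qed
  \<comment> \<open>The light-cone coordinate of \<open>z k\<close> is the product of
    \<open>\<eta>\<close> with the pole of \<open>w k\<close>, up to sign. Poles have time
    coordinate at least \<open>a\<close>, and along the subsequence they tend to \<open>p\<close>,
    which differs from \<open>\<eta>\<close>.\<close>
  have low: "z k $ Inr True \<ge> (a / 2) * (- mform \<eta> (upole (w k)))" for k
  proof -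
    have F: "lc_b (z k) \<le> 2 * z k $ Inr True"
    proof -
      have "(z k $ Inr False)\<^sup>2 \<le> (z k $ Inr True)\<^sup>2"
      proof -
        have "mform (z k) (z k) = 0" using c(1) by (simp add: z_def SO0_mform[OF w0] celestial_def)
        then show ?thesis using inner_ge_zero[of "spart (z k)"]
          unfolding mform_mink power2_eq_square by linarith
      qed
      then have "\<bar>z k $ Inr False\<bar> \<le> z k $ Inr True"
        using zT[of k] by (metis abs_le_square_iff abs_of_pos)
      then show ?thesis by (simp add: lc_b_def)
    qed
    have aT: "a * rho ^ k \<le> pole (w k) $ Inr True" using a(2) w qinf_Q unfolding pole_def by blast
    have "rho ^ k \<ge> 1" using rho by (intro one_le_power) simp
    then have aT': "a \<le> pole (w k) $ Inr True" 
    proof -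
      have "a * 1 \<le> a * rho ^ k" using \<open>rho ^ k \<ge> 1\<close> a(1) by (intro mult_left_mono) auto
      then show ?thesis using aT by linarith
    qed
    have uc: "upole (w k) \<in> celestial" using upole_Q[OF w] Q_celestial by blast
    have nn: "- mform \<eta> (upole (w k)) \<ge> 0" 
      unfolding celestial_dist[OF c(1) uc] by simp
    have "lc_b (z k) = - mform \<eta> (pole (w k))"
      by (simp add: lc_b_mform z_def SO0_mform_inv[OF w0] pole_def)
    also have "\<dots> = pole (w k) $ Inr True * (- mform \<eta> (upole (w k)))"
      using pole_null(2)[OF w0, of k] by (simp add: upole_def tnorm_def mform_linear)
    also have "\<dots> \<ge> a * (- mform \<eta> (upole (w k)))" using aT' nn by (rule mult_right_mono)
    finally show ?thesis using F by simp
  qed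
  have mlim: "(\<lambda>k. (a / 2) * (- mform \<eta> (upole (w (r k))))) \<longlonglongrightarrow> (a / 2) * (- mform \<eta> p)"
    by (intro tendsto_intros r)
  \<comment> \<open>Half of the limit in \<open>mlim\<close>, hence an eventual lower bound.\<close>
  define c0 where "c0 = (a / 4) * (- mform \<eta> p)"
  have c0: "c0 > 0" using a(1) neg by (simp add: c0_def mult_pos_neg)
  have "c0 < (a / 2) * (- mform \<eta> p)" using c0 by (simp add: c0_def)
  then have ev: "eventually (\<lambda>k. c0 < (a / 2) * (- mform \<eta> (upole (w (r k))))) sequentially"
    by (rule order_tendstoD(1)[OF mlim])
  let ?b = "ray (Some x)"
  have bc: "?b \<in> celestial" by (rule ray_celestial)
  obtain m where m: "m > 0" "?b = m *\<^sub>R lift x"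
    using pos_sq1(1)[of x] by (intro that[of "2 / ((norm x)\<^sup>2 + 1)"]) (simp_all add: ray_Some)
  have "(\<lambda>k. (norm (?b - s (r k)))\<^sup>2) \<longlonglongrightarrow> 0"
  proof (rule Lim_null_comparison)
    show "eventually (\<lambda>k. norm ((norm (?b - s (r k)))\<^sup>2) \<le> (2 * m * (B * sqrt 2) / c0) * lam ^ r k) sequentially"
      using ev
    proof eventually_elim
      case (elim k)
      then have T: "c0 \<le> z (r k) $ Inr True" using low[of "r k"] by linarith
      have "(norm (?b - s (r k)))\<^sup>2 = - 2 * mform ?b (s (r k))"
        using celestial_dist[OF bc sc, of "r k"] by linarith
      also have "\<dots> = 2 * m * (- mform (lift x) (z (r k))) / z (r k) $ Inr True"
        by (simp add: m(2) s_def tnorm_def mform_linear)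
      also have "\<dots> \<le> 2 * m * ((B * sqrt 2) * lam ^ r k) / c0"
      proof (rule frac_le)
        show "0 \<le> 2 * m * (B * sqrt 2 * lam ^ r k)" using m(1) B(1) lam by simp
        show "2 * m * (- mform (lift x) (z (r k))) \<le> 2 * m * (B * sqrt 2 * lam ^ r k)"
          using up[of "r k"] m(1) by (intro mult_left_mono) auto
      qed (use T c0 in auto)
      finally show ?case by simp
    qed
    have "(\<lambda>k. (2 * m * (B * sqrt 2) / c0) * lam ^ k) \<longlonglongrightarrow> (2 * m * (B * sqrt 2) / c0) * 0"
      using lam by (intro tendsto_intros LIMSEQ_power_zero) auto
    then show "(\<lambda>k. (2 * m * (B * sqrt 2) / c0) * lam ^ r k) \<longlonglongrightarrow> 0"
      using LIMSEQ_subseq_LIMSEQ[OF _ r(1)] by (force simp: comp_def)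
  qed
  then have "(\<lambda>k. norm (?b - s (r k))) \<longlonglongrightarrow> 0" by simp
  then have d0: "(\<lambda>k. ?b - s (r k)) \<longlonglongrightarrow> 0" by (simp add: tendsto_norm_zero_iff)
  have "(\<lambda>k. mform n (?b - s (r k))) \<longlonglongrightarrow> mform n 0" by (intro tendsto_intros d0)
  then have "(\<lambda>k. mform n ?b) \<longlonglongrightarrow> 0" by (simp add: mform_linear sn)
  then show ?thesis by (simp add: LIMSEQ_const_iff)
qed

text \<open>By \<open>emap_dist\<close> and the bound on \<open>bfac\<close>,
  \<open>\<gamma>\<close> contracts by \<open>lam\<close>. Banach's theorem needs the closure, and
  the fixed point may lie on the boundary of \<open>\<Delta>\<close>.\<close>

lemma exists_attracting_point:
  assumes g: "\<gamma> \<in> H"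
  obtains a where "a \<in> closure \<Delta>" "\<gamma> *v lift a = bfac \<gamma> a *\<^sub>R lift a" "bfac \<gamma> a > 1"
proof -
  note g0 = H_SO0[OF g]
  have b: "rho \<le> bfac \<gamma> x" if "x \<in> closure \<Delta>" for x
    using words_bfac_closure[OF words_1[OF g] that] by simp
  have nz: "bfac \<gamma> x \<noteq> 0" if "x \<in> closure \<Delta>" for x using b[OF that] rho by linarith
  have con: "dist (emap \<gamma> x) (emap \<gamma> y) \<le> lam * dist x y" if "x \<in> closure \<Delta>" "y \<in> closure \<Delta>" for x y
  proof -
    have "(dist (emap \<gamma> x) (emap \<gamma> y))\<^sup>2 = (dist x y)\<^sup>2 / (bfac \<gamma> x * bfac \<gamma> y)"
      using emap_dist[OF g0 nz nz] that by (simp add: dist_norm)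
    also have "\<dots> \<le> (dist x y)\<^sup>2 / (rho * rho)"
    proof -
      have pos: "0 < rho" "0 < bfac \<gamma> x" "0 < bfac \<gamma> y" using b[OF that(1)] b[OF that(2)] rho
        by linarith+
      then show ?thesis using b that lam
        by (intro divide_left_mono mult_mono mult_pos_pos) (auto simp del: zero_less_divide_1_iff)
    qed
    also have "\<dots> = (lam * dist x y)\<^sup>2" by (simp add: power2_eq_square)
    finally show ?thesis by (rule power2_le_imp_le) (use lam in simp)
  qed
  have "emap \<gamma> ` closure \<Delta> \<subseteq> closure \<Delta>"
  proof (rule image_closure_subset)
    show "continuous_on (closure \<Delta>) (emap \<gamma>)"
    proof (rule continuous_at_imp_continuous_on, rule ballI)
      fix x assume "x \<in> closure \<Delta>"
      then obtain E where "(emap \<gamma> has_derivative E) (at x)" using emap_has_derivative[OF g0 nz]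
        by blast
      then show "isCont (emap \<gamma>) x" by (rule has_derivative_continuous)
    qed
    show "emap \<gamma> ` \<Delta> \<subseteq> closure \<Delta>" using H_maps[OF g] closure_subset by blast
  qed simp
  then have "\<exists>!a\<in>closure \<Delta>. emap \<gamma> a = a"
    using meets closure_subset lam con
    by (intro Banach_fix[where c = lam]) (auto simp: complete_eq_closed)
  then obtain a where a: "a \<in> closure \<Delta>" "emap \<gamma> a = a" by blast
  show ?thesis
    using that[of a] a emap_lift[OF g0 nz[OF a(1)]] b[OF a(1)] rho by simp
qed

section \<open>The dual limit set is not a single point\<close>

lemma forward_null_parallel:
  assumes "mform u u = 0" "u $ Inr True > 0" "mform v v = 0" "v $ Inr True > 0" "mform u v = 0"
  obtains c where "c > 0" "u = c *\<^sub>R v"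
proof -
  have "tnorm u \<in> celestial" "tnorm v \<in> celestial" using assms by (auto intro: tnorm_celestial)
  moreover have "mform (tnorm u) (tnorm v) = 0" using assms by (simp add: tnorm_def mform_linear)
  ultimately have "tnorm u = tnorm v" by (simp add: celestial_mform_eq0)
  then have "u $ Inr True *\<^sub>R tnorm u = u $ Inr True *\<^sub>R tnorm v" by simp
  then have "u = (u $ Inr True / v $ Inr True) *\<^sub>R v" using assms by (simp add: tnorm_def)
  then show ?thesis using that assms by (metis divide_pos_pos)
qed

text \<open>If \<open>\<gamma>\<close> has fixed points \<open>a\<close> (attracting) and \<open>p\<close>, and \<open>h\<close> fixes the null vector \<open>p\<close>, then the
  conjugates \<open>\<gamma>\<^sup>n h \<gamma>\<^sup>-\<^sup>n\<close> stay bounded. By discreteness two of them coincide, and so \<open>h\<close> fixes \<open>a\<close>.\<close>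

lemma stabilizer_fixes_attractor:
  assumes g: "\<gamma> \<in> \<Gamma>" and h: "h \<in> \<Gamma>"
    and A: "mform A A = 0" "A $ Inr True > 0" "\<gamma> *v A = \<kappa> *\<^sub>R A" "\<kappa> > 1"
    and P: "mform P P = 0" "P $ Inr True > 0" "\<gamma> *v P = (1 / \<kappa>) *\<^sub>R P" "h *v P = P"
    and AP: "mform A P < 0"
  shows "mform A (h *v A) = 0"
proof -
  have g0: "\<gamma> \<in> carrier SO0" using g grp(1) by blast
  have gi: "matrix_inv \<gamma> *v A = (1 / \<kappa>) *\<^sub>R A" "matrix_inv \<gamma> *v P = \<kappa> *\<^sub>R P"
    using SO0_eigenvector_inv[OF g0 A(3)] SO0_eigenvector_inv[OF g0 P(3)] A(4) by simp_all
  define f where "f n = ((\<lambda>M. \<gamma> ** M ** matrix_inv \<gamma>) ^^ n) h" for n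
  define X where "X = mform A (h *v A)"
  have f: "f n \<in> \<Gamma> \<and> f n *v P = P \<and> mform A (f n *v A) = (1 / \<kappa>\<^sup>2) ^ n * X" for n
  proof (induction n)
    case 0
    then show ?case using h P(4) by (simp add: f_def X_def)
  next
    case (Suc n)
    have fS: "f (Suc n) = \<gamma> ** f n ** matrix_inv \<gamma>" by (simp add: f_def)
    have v: "f (Suc n) *v u = \<gamma> *v (f n *v (matrix_inv \<gamma> *v u))" for u
      by (simp add: fS matrix_vector_mul_assoc matrix_mul_assoc)
    have "f (Suc n) *v P = P"
      using Suc.IH A(4) unfolding v gi by (simp add: matrix_vector_mult_scaleR P(3))
    moreover have "mform A (f (Suc n) *v A) = mform (matrix_inv \<gamma> *v A) (f n *v (matrix_inv \<gamma> *v A))"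
      unfolding v using SO0_mform_inv[OF SO0_inv[OF g0], of A] by (simp add: matrix_inv_inv[OF g0])
    then have "mform A (f (Suc n) *v A) = (1 / \<kappa>\<^sup>2) ^ Suc n * X"
      unfolding gi using Suc.IH
      by (simp add: matrix_vector_mult_scaleR mform_linear power2_eq_square)
    moreover have "f (Suc n) \<in> \<Gamma>" unfolding fS using Suc.IH g grp(3,4) by blast
    ultimately show ?case by blast
  qed
  have f0: "f n \<in> carrier SO0" for n using f grp(1) by blast
  \<comment> \<open>A timelike vector on the axis of \<open>\<gamma>\<close>; it replaces the base
    point because its displacement under \<open>f n\<close> can be computed exactly.\<close>
  define o' where "o' = A + P"
  define \<sigma> where "\<sigma> = mform A P"
  have \<sigma>: "\<sigma> < 0" using AP by (simp add: \<sigma>_def)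
  have oo: "mform o' o' = 2 * \<sigma>" using A(1) P(1)
    by (simp add: o'_def mform_linear \<sigma>_def mform_sym[of P A])
  have oT: "o' $ Inr True > 0" using A(2) P(2) by (simp add: o'_def)
  have fo: "mform o' (f n *v o') = (1 / \<kappa>\<^sup>2) ^ n * X + 2 * \<sigma>" for n
  proof -
    have "mform P (f n *v A) = \<sigma>"
      using SO0_mform[OF f0, of n P A] f[of n] by (simp add: \<sigma>_def mform_sym[of P A])
    then show ?thesis
      using f[of n] P(1) by (simp add: o'_def matrix_vector_right_distrib mform_linear \<sigma>_def)
  qed
  \<comment> \<open>With this \<open>k\<close> the vector \<open>D\<close> is forward timelike, of
    form value -1. Writing \<open>k *\<^sub>R o'\<close> as \<open>e_T + D\<close>, all mixed
    products are negative, so the displacement of \<open>e_T\<close> is bounded by that of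
    \<open>o'\<close>.\<close>
  define k where "k = o' $ Inr True / (- \<sigma>)"
  define D where "D = k *\<^sub>R o' - e_T"
  have k: "k > 0" unfolding k_def by (rule divide_pos_pos) (use oT \<sigma> in auto)
  have kT: "k * (- \<sigma>) = o' $ Inr True" using \<sigma> by (simp add: k_def)
  have DD: "mform D D < 0"
  proof -
    have "mform D D = k * (k * (2 * \<sigma>)) + 2 * k * o' $ Inr True - 1"
      by (simp add: D_def mform_linear oo e_T_form distrib_left)
    also have "\<dots> = -1"
      unfolding kT[symmetric] by (simp add: algebra_simps)
    finally show ?thesis by simp
  qed
  have DT: "D $ Inr True > 0"
  proof -
    have "- (2 * \<sigma>) \<le> o' $ Inr True * o' $ Inr True"
      using oo inner_ge_zero[of "spart o'"] zero_le_square[of "o' $ Inr False"] unfolding mform_mink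
      by linarith
    then have "2 \<le> k * o' $ Inr True" using \<sigma> by (simp add: k_def field_simps)
    then show ?thesis by (simp add: D_def)
  qed
  have TT: "(f n *v e_T) $ Inr True \<le> k * k * (\<bar>X\<bar> - 2 * \<sigma>)" for n
  proof -
    have eT: "mform e_T (e_T :: 'd mink) < 0" "(e_T :: 'd mink) $ Inr True > 0"
      by (simp_all add: e_T_form)
    have 1: "mform e_T (f n *v D) < 0"
      by (rule mform_timelike_neg) (use eT DD DT SO0_forward[OF f0] in \<open>auto simp: SO0_mform[OF f0]\<close>)
    have 2: "mform D (f n *v e_T) < 0"
      by (rule mform_timelike_neg) (use eT DD DT SO0_forward[OF f0] in \<open>auto simp: SO0_mform[OF f0]\<close>)
    have 3: "mform D (f n *v D) < 0"
      by (rule mform_timelike_neg) (use eT DD DT SO0_forward[OF f0] in \<open>auto simp: SO0_mform[OF f0]\<close>)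
    have "k *\<^sub>R o' = e_T + D" by (simp add: D_def)
    then have "mform (k *\<^sub>R o') (f n *v (k *\<^sub>R o')) = mform (e_T + D) (f n *v (e_T + D))" by simp
    then have "k * (k * mform o' (f n *v o')) = - (f n *v e_T) $ Inr True + mform e_T (f n *v D) + mform D (f n *v e_T) + mform D (f n *v D)"
      by (simp add: mform_linear matrix_vector_mult_scaleR matrix_vector_right_distrib e_T_form)
    then have "(f n *v e_T) $ Inr True \<le> k * k * (- mform o' (f n *v o'))" using 1 2 3 by simp
    also have "\<dots> \<le> k * k * (\<bar>X\<bar> - 2 * \<sigma>)"
    proof (rule mult_left_mono)
      have "(1 / \<kappa>\<^sup>2) ^ n \<le> 1" using A(4) by (intro power_le_one) auto
      then have "\<bar>(1 / \<kappa>\<^sup>2) ^ n * X\<bar> \<le> \<bar>X\<bar>" using A(4) by (simp add: abs_mult mult_left_le_one_le)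
      then show "- mform o' (f n *v o') \<le> \<bar>X\<bar> - 2 * \<sigma>" unfolding fo by linarith
    qed (use k in simp)
    finally show ?thesis .
  qed
  \<comment> \<open>A repetition is incompatible with the strictly decreasing factors of
    \<open>X\<close> unless \<open>X = 0\<close>.\<close>
  obtain n m where nm: "n < m" "f n = f m"
    using discrete_subgroup_repeats[OF subgroup disc _ TT] f by blast
  then have "(1 / \<kappa>\<^sup>2) ^ n * X = (1 / \<kappa>\<^sup>2) ^ m * X" using f[of n] f[of m] by metis
  moreover have "(1 / \<kappa>\<^sup>2) ^ m < (1 / \<kappa>\<^sup>2) ^ n" using nm(1) A(4)
    by (intro power_strict_decreasing) auto
  ultimately show ?thesis unfolding X_def[symmetric] by simp
qed

text \<open>Discreteness is brought in through commutators of branches: from them every branch,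
  hence every word, inherits the attracting fixed point \<open>a\<close> of one chosen branch. All
  coded points then lie in the hyperplane of \<open>lift a\<close>.\<close>

lemma dual_limit_not_singleton:
  assumes Lp: "dual_limit = {p}"
  shows False
proof -
  have pc: "p \<in> celestial" "p \<in> Q" using Lp dual_limit_Q Q_celestial by blast+
  have p: "mform p p = 0" "p $ Inr True > 0" using pc by (auto simp: celestial_def)
  have pfix: "\<exists>c>0. \<gamma> *v p = c *\<^sub>R p" if "\<gamma> \<in> H" for \<gamma>
  proof -
    note g0 = H_SO0[OF that]
    have T: "(matrix_inv \<gamma> *v p) $ Inr True > 0"
      by (rule SO0_forward[OF SO0_inv[OF g0]]) (use p in auto)
    have tp: "tnorm (matrix_inv \<gamma> *v p) = p" using dual_limit_invariant[OF that, of p] Lp by simp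
    define t where "t = (matrix_inv \<gamma> *v p) $ Inr True"
    have t: "t > 0" using T by (simp add: t_def)
    have "t *\<^sub>R ((1 / t) *\<^sub>R (matrix_inv \<gamma> *v p)) = t *\<^sub>R p"
      using tp by (simp add: tnorm_def t_def)
    then have "matrix_inv \<gamma> *v p = t *\<^sub>R p" using t by simp
    then have "\<gamma> *v p = (1 / t) *\<^sub>R p"
      using SO0_eigenvector_inv[OF SO0_inv[OF g0], of p t] t by (simp add: matrix_inv_inv[OF g0])
    moreover have "1 / t > 0" using t by simp
    ultimately show ?thesis by blast
  qed
  obtain \<gamma> where g: "\<gamma> \<in> H" using H_nonempty by blast
  note g0 = H_SO0[OF g]
  obtain a where a: "a \<in> closure \<Delta>" "\<gamma> *v lift a = bfac \<gamma> a *\<^sub>R lift a" "bfac \<gamma> a > 1"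
    using exists_attracting_point[OF g] by blast
  define A where "A = lift a"
  define \<kappa> where "\<kappa> = bfac \<gamma> a"
  have A: "mform A A = 0" "A $ Inr True > 0" "\<gamma> *v A = \<kappa> *\<^sub>R A" "\<kappa> > 1"
    using a lift_T[of a] unfolding A_def \<kappa>_def by (simp_all del: spart_mink_vec)
  have AP: "mform A p < 0" using \<beta>(2)[OF a(1) pc(2)] \<beta>(1) by (simp add: A_def)
  have gp: "\<gamma> *v p = (1 / \<kappa>) *\<^sub>R p"
  proof -
    obtain c where c: "\<gamma> *v p = c *\<^sub>R p" using pfix[OF g] by blast
    have "mform A p = mform (\<gamma> *v A) (\<gamma> *v p)" by (simp add: SO0_mform[OF g0])
    also have "\<dots> = \<kappa> * c * mform A p" by (simp add: A(3) c mform_linear)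
    finally have "\<kappa> * c = 1" using AP by simp
    then have "c = 1 / \<kappa>" using A(4) by (simp add: field_simps)
    then show ?thesis using c by simp
  qed
  have par: "\<exists>c>0. \<gamma>' *v A = c *\<^sub>R A" if g': "\<gamma>' \<in> H" for \<gamma>'
  proof -
    note g'0 = H_SO0[OF g']
    obtain c where c: "c > 0" "\<gamma>' *v p = c *\<^sub>R p" using pfix[OF g'] by blast
    have cinv: "matrix_inv \<gamma>' *v p = (1 / c) *\<^sub>R p"
      by (rule SO0_eigenvector_inv[OF g'0 c(2)]) (use c(1) in simp)
    have ginv: "matrix_inv \<gamma> *v p = \<kappa> *\<^sub>R p" "matrix_inv \<gamma> *v A = (1 / \<kappa>) *\<^sub>R A"
      using SO0_eigenvector_inv[OF g0 gp] SO0_eigenvector_inv[OF g0 A(3)] A(4) by simp_all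
    \<comment> \<open>In a commutator the eigenvalues at \<open>p\<close> cancel, so
      \<open>h\<close> fixes the vector \<open>p\<close> and not just its line, as
      \<open>stabilizer_fixes_attractor\<close> requires.\<close>
    define h where "h = \<gamma>' ** \<gamma> ** matrix_inv \<gamma>' ** matrix_inv \<gamma>"
    have hG: "h \<in> \<Gamma>" unfolding h_def
      by (intro grp(3) grp(4)) (use g g' H_sub in blast)+
    have h0: "h \<in> carrier SO0" using hG grp(1) by blast
    have hv: "h *v u = \<gamma>' *v (\<gamma> *v (matrix_inv \<gamma>' *v (matrix_inv \<gamma> *v u)))" for u
      by (simp add: h_def matrix_vector_mul_assoc matrix_mul_assoc)
    have hp: "h *v p = p"
      unfolding hv ginv using c A(4) by (simp add: matrix_vector_mult_scaleR cinv gp)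
    have "mform A (h *v A) = 0"
      by (rule stabilizer_fixes_attractor[OF _ hG A p gp hp AP]) (use g H_sub in blast)
    moreover have "(h *v A) $ Inr True > 0" by (rule SO0_forward[OF h0]) (use A in auto)
    ultimately obtain e where e: "e > 0" "h *v A = e *\<^sub>R A"
      using forward_null_parallel[of "h *v A" A] A
      by (auto simp: SO0_mform[OF h0] mform_sym[of "h *v A" A])
    \<comment> \<open>As \<open>h\<close> preserves the line of \<open>A\<close>, \<open>u\<close>
      is an eigenvector of \<open>\<gamma>\<close>. Pairing with \<open>p\<close> shows that its
      eigenvalue is \<open>\<kappa>\<close>, as for \<open>A\<close>; two null eigenvectors with the
      same eigenvalue greater than 1 are orthogonal, hence parallel.\<close>
    define u where "u = matrix_inv \<gamma>' *v A"
    have "\<gamma>' *v (\<gamma> *v u) = (\<kappa> * e) *\<^sub>R A"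
    proof -
      have "e *\<^sub>R A = (1 / \<kappa>) *\<^sub>R (\<gamma>' *v (\<gamma> *v u))"
        using e(2) unfolding hv ginv u_def by (simp add: matrix_vector_mult_scaleR)
      then have "\<kappa> *\<^sub>R (e *\<^sub>R A) = \<kappa> *\<^sub>R ((1 / \<kappa>) *\<^sub>R (\<gamma>' *v (\<gamma> *v u)))" by (rule arg_cong)
      then show ?thesis using A(4) by simp
    qed
    then have "matrix_inv \<gamma>' *v (\<gamma>' *v (\<gamma> *v u)) = matrix_inv \<gamma>' *v ((\<kappa> * e) *\<^sub>R A)"
      by (rule arg_cong)
    then have gu: "\<gamma> *v u = (\<kappa> * e) *\<^sub>R u"
      by (simp add: SO0_inv_cancel(3)[OF g'0] matrix_vector_mult_scaleR u_def)
    have uP: "mform u p = c * mform A p"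
      using SO0_mform_inv[OF SO0_inv[OF g'0], of A p]
      by (simp add: u_def matrix_inv_inv[OF g'0] c(2) mform_linear)
    have "mform u p = mform (\<gamma> *v u) (\<gamma> *v p)" by (simp add: SO0_mform[OF g0])
    also have "\<dots> = e * mform u p" using A(4) by (simp add: gu gp mform_linear)
    finally have e1: "e = 1" using uP c(1) AP by simp
    have "mform u A = mform (\<gamma> *v u) (\<gamma> *v A)" by (simp add: SO0_mform[OF g0])
    also have "\<dots> = (\<kappa> * \<kappa>) * mform u A" by (simp add: gu A(3) e1 mform_linear)
    finally have "(\<kappa> * \<kappa> - 1) * mform u A = 0" by (simp add: algebra_simps)
    moreover have "\<kappa> * \<kappa> > 1" using A(4) less_1_mult by blast
    ultimately have "mform u A = 0" by simp
    moreover have "u $ Inr True > 0" unfolding u_def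
      by (rule SO0_forward[OF SO0_inv[OF g'0]]) (use A in auto)
    moreover have "mform u u = 0" using A(1) by (simp add: u_def SO0_mform[OF SO0_inv[OF g'0]])
    ultimately obtain t where t: "t > 0" "A = t *\<^sub>R u"
      using forward_null_parallel[of A u] A(1,2) mform_sym[of A u] by metis
    have "\<gamma>' *v A = \<gamma>' *v (t *\<^sub>R u)" using t(2) by (rule arg_cong)
    also have "\<dots> = t *\<^sub>R A" by (simp add: u_def SO0_inv_cancel(4)[OF g'0] matrix_vector_mult_scaleR)
    finally have "\<gamma>' *v A = t *\<^sub>R A" .
    then show ?thesis using t(1) by blast
  qed
  have wA: "\<exists>c>0. w *v A = c *\<^sub>R A" if "w \<in> words H k" for w k
    using that
  proof (induction k arbitrary: w)
    case 0
    then show ?case by (auto intro!: exI[of _ 1])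
  next
    case (Suc k)
    then obtain \<gamma>' v where v: "w = \<gamma>' ** v" "\<gamma>' \<in> H" "v \<in> words H k" by auto
    obtain c where c: "c > 0" "v *v A = c *\<^sub>R A" using Suc.IH[OF v(3)] by blast
    obtain c' where c': "c' > 0" "\<gamma>' *v A = c' *\<^sub>R A" using par[OF v(2)] by blast
    have "w *v A = (c * c') *\<^sub>R A"
      by (simp add: v(1) matrix_vector_mul_assoc[symmetric] c c' matrix_vector_mult_scaleR)
    then show ?case using c c' mult_pos_pos by blast
  qed
  obtain x where x: "x \<in> \<Delta>" "\<And>k. Some x \<in> coded_set k" "mform A (ray (Some x)) \<noteq> 0"
    using coded_points_not_in_hyperplane[of A] lift_nonzero unfolding A_def by blast
  obtain w y where w: "\<And>k. w k \<in> words H k" and y: "\<And>k. y k \<in> \<Delta>"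
    and xw: "\<And>k. lift x = (1 / bfac (w k) (y k)) *\<^sub>R (w k *v lift (y k))"
    using coded_word[OF x(2)] by blast
  obtain B where B: "B > 0" "\<forall>x\<in>\<Delta>. \<forall>u. \<bar>mform (lift x) u\<bar> \<le> B * norm u" using lift_bound by blast
  \<comment> \<open>\<open>A\<close> is an eigenvector of \<open>w k\<close> with eigenvalue at
    least 1, so its product with the image of \<open>lift (y k)\<close> is bounded, and dividing by
    the conformal factor makes it of order \<open>lam ^ k\<close>.\<close>
  have "\<bar>mform A (lift x)\<bar> \<le> (B * norm A) * lam ^ k" for k
  proof -
    note w0 = words_SO0[OF w, of k]
    have b: "rho ^ k \<le> bfac (w k) (y k)" using words_maps[OF w y] by blast
    have ba: "rho ^ k \<le> bfac (w k) a" by (rule words_bfac_closure[OF w a(1)])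
    have p: "1 \<le> rho ^ k" using rho by (intro one_le_power) simp
    obtain c where c: "c > 0" "w k *v A = c *\<^sub>R A" using wA[OF w] by blast
    have "bfac (w k) a = c" using c(2) by (simp add: bfac_def A_def lc_b_linear)
    then have c1: "c \<ge> 1" using ba p by simp
    have "mform A (lift x) = mform A (w k *v lift (y k)) / bfac (w k) (y k)"
      unfolding xw[of k] by (simp add: mform_linear)
    also have "mform A (w k *v lift (y k)) = mform (w k *v A) (w k *v lift (y k)) / c"
      using c by (simp add: mform_linear)
    also have "\<dots> = mform (lift (y k)) A / c" by (simp add: SO0_mform[OF w0] mform_sym[of A])
    finally have "\<bar>mform A (lift x)\<bar> = \<bar>mform (lift (y k)) A\<bar> / (c * bfac (w k) (y k))"
      using c(1) b p by (simp add: abs_mult)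
    also have "\<dots> \<le> (B * norm A) / rho ^ k"
    proof (rule frac_le)
      show "rho ^ k \<le> c * bfac (w k) (y k)" using mult_mono[OF c1 b] c1 p by simp
    qed (use B y p in auto)
    also have "\<dots> = (B * norm A) * lam ^ k" using inv_power_lam[of k] by (simp add: divide_inverse)
    finally show ?thesis .
  qed
  moreover have "(\<lambda>k. (B * norm A) * lam ^ k) \<longlonglongrightarrow> (B * norm A) * 0"
    using lam by (intro tendsto_intros LIMSEQ_power_zero) auto
  ultimately have "\<bar>mform A (lift x)\<bar> \<le> (B * norm A) * 0"
    by (intro LIMSEQ_le_const) auto
  then have "mform A (lift x) = 0" by simp
  then show False using x(3) by (simp add: ray_Some mform_linear)
qed

lemma dual_limit_not_in_hyperplane:
  assumes "\<And>p. p \<in> dual_limit \<Longrightarrow> mform n p = 0"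
  shows "n = 0"
proof (rule ccontr)
  assume n: "n \<noteq> 0"
  obtain p1 where p1: "p1 \<in> dual_limit" using dual_limit_nonempty by blast
  then obtain p2 where p2: "p2 \<in> dual_limit" "p1 \<noteq> p2" using dual_limit_not_singleton[of p1]
    by blast
  obtain x where x: "x \<in> \<Delta>" "\<And>k. Some x \<in> coded_set k" "mform n (ray (Some x)) \<noteq> 0"
    using coded_points_not_in_hyperplane[OF n] by blast
  have "n \<in> annihilator" using assms by (simp add: annihilator_def)
  then show False using coded_point_annihilated[OF p1 p2 x(2)] x(3) by blast
qed

section \<open>Separation of gradients\<close>

lemma tgrad_inner_upole:
  assumes "w \<in> carrier SO0"
  shows "tgrad w y \<bullet> e = mform (dlift y e) (upole w) / mform (lift y) (upole w)"
  using pole_null(2)[OF assms] by (simp add: tgrad_inner[OF assms] upole_def tnorm_def mform_linear)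

lemma bfac_upole:
  assumes "w \<in> carrier SO0"
  shows "bfac w y = - (pole w $ Inr True) * mform (lift y) (upole w)"
  using pole_null(2)[OF assms] by (simp add: bfac_pole[OF assms] upole_def tnorm_def mform_linear)

text \<open>\<open>z\<close> pairs a point with a direction. By \<open>tgrad_inner_upole\<close> the
  quotients are components of \<open>tgrad\<close> when \<open>u\<close> and \<open>u'\<close> are
  normalised poles. Quantifying over all vectors near \<open>p\<close> and \<open>p'\<close> allows
  words to be inserted after the constants are fixed.\<close>

definition separates :: "(real^'d) \<times> (real^'d) \<Rightarrow> 'd mink \<Rightarrow> 'd mink \<Rightarrow> real \<Rightarrow> real \<Rightarrow> bool" where
  "separates z p p' d \<epsilon> \<longleftrightarrow>
    (\<forall>y e u u'. dist y (fst z) < d \<longrightarrow> dist e (snd z) < d \<longrightarrow> dist u p < d \<longrightarrow> dist u' p' < d \<longrightarrow>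
      mform (lift y) u \<noteq> 0 \<and> mform (lift y) u' \<noteq> 0 \<and>
      \<epsilon> \<le> \<bar>mform (dlift y e) u / mform (lift y) u - mform (dlift y e) u' / mform (lift y) u'\<bar>)"

text \<open>Null vectors whose quotient equals that of \<open>p\<close> lie in the hyperplane of
  \<open>n\<close>, which the dual limit set must leave. The resulting gap persists nearby by
  continuity.\<close>

lemma local_nonintegrability:
  assumes x: "x \<in> closure \<Delta>" and e: "norm e = 1"
  obtains p p' d \<epsilon> where "p \<in> dual_limit" "p' \<in> dual_limit" "0 < d" "0 < \<epsilon>" "separates (x, e) p p' d \<epsilon>"
proof -
  have nz: "mform (lift x) p \<noteq> 0" if "p \<in> dual_limit" for p
    using \<beta>(2)[OF x dual_limit_Q[OF that]] \<beta>(1) by auto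
  obtain p where p: "p \<in> dual_limit" using dual_limit_nonempty by blast
  define c where "c = mform (dlift x e) p / mform (lift x) p"
  define n where "n = dlift x e - c *\<^sub>R lift x"
  \<comment> \<open>\<open>dlift x e\<close> has \<open>lc_b\<close> equal to 0 and
    \<open>lift x\<close> has 1, so proportionality would force \<open>e\<close> to vanish.\<close>
  have "n \<noteq> 0"
  proof
    assume "n = 0"
    then have eq: "dlift x e = c *\<^sub>R lift x" by (simp add: n_def)
    have "lc_b (dlift x e) = 0" by (simp add: dlift_def lc_b_def)
    then have "c = 0" unfolding eq by (simp add: lc_b_linear)
    then have "spart (dlift x e) = 0" unfolding eq by simp
    then show False using e by (simp add: dlift_def)
  qed
  then obtain p' where p': "p' \<in> dual_limit" "mform n p' \<noteq> 0" using dual_limit_not_in_hyperplane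
    by blast
  have ne: "mform (dlift x e) p' / mform (lift x) p' \<noteq> c"
  proof
    assume "mform (dlift x e) p' / mform (lift x) p' = c"
    then have "mform (dlift x e) p' = c * mform (lift x) p'" using nz[OF p'(1)]
      by (simp add: field_simps)
    then show False using p'(2) by (simp add: n_def mform_linear)
  qed
  \<comment> \<open>Half of the gap, so that a strict inequality, an open condition, holds at the
    centre.\<close>
  define \<epsilon> where "\<epsilon> = \<bar>c - mform (dlift x e) p' / mform (lift x) p'\<bar> / 2"
  have \<epsilon>: "\<epsilon> > 0" using ne by (simp add: \<epsilon>_def)
  \<comment> \<open>The denominators are cleared, so that both sides are continuous everywhere and
    the set below is open.\<close>
  define F where "F = (\<lambda>(y :: real^'d, e', u, u'). \<bar>mform (dlift y e') u * mform (lift y) u' - mform (dlift y e') u' * mform (lift y) u\<bar>)"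
  define G where "G = (\<lambda>(y :: real^'d, e' :: real^'d, u, u'). \<bar>mform (lift y) u * mform (lift y) u'\<bar>)"
  let ?O = "{z. 0 < G z \<and> \<epsilon> * G z < F z}"
  have "continuous_on UNIV F" "continuous_on UNIV G"
    unfolding F_def G_def case_prod_beta' dlift_def by (intro continuous_intros)+
  then have "open ?O" by (intro open_Collect_conj open_Collect_less continuous_intros)
  moreover have "(x, e, p, p') \<in> ?O"
  proof -
    have ab: "mform (lift x) p \<noteq> 0" "mform (lift x) p' \<noteq> 0" using nz p p' by auto
    have "\<bar>a / b - a' / b'\<bar> / 2 * \<bar>b * b'\<bar> < \<bar>a * b' - a' * b\<bar>" if "b \<noteq> 0" "b' \<noteq> 0" "a / b \<noteq> a' / b'" for a b a' b' :: real
    proof -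
      have "\<bar>a / b - a' / b'\<bar> * \<bar>b * b'\<bar> = \<bar>a * b' - a' * b\<bar>"
      proof -
        have "(a / b - a' / b') * (b * b') = a * b' - a' * b" using that
          by (simp add: left_diff_distrib)
        then show ?thesis unfolding abs_mult[symmetric] by simp
      qed
      moreover have "\<bar>a / b - a' / b'\<bar> * \<bar>b * b'\<bar> > 0" using that by simp
      ultimately show ?thesis by simp
    qed
    from this[OF ab, of "mform (dlift x e) p" "mform (dlift x e) p'"]
    show ?thesis using ab ne unfolding F_def G_def \<epsilon>_def c_def by auto
  qed
  ultimately obtain h where h: "h > 0" "ball (x, e, p, p') h \<subseteq> ?O" using openE by blast
  \<comment> \<open>The distance in the fourfold product is at most the sum of the four distances,
    whence h / 4.\<close>
  have main: "mform (lift y) u \<noteq> 0 \<and> mform (lift y) u' \<noteq> 0 \<and>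
      \<epsilon> \<le> \<bar>mform (dlift y e') u / mform (lift y) u - mform (dlift y e') u' / mform (lift y) u'\<bar>"
    if d: "dist y x < h / 4" "dist e' e < h / 4" "dist u p < h / 4" "dist u' p' < h / 4" for y e' u u'
  proof -
    have tri: "dist (a, b) (a', b') \<le> dist a a' + dist b b'"
      for a a' :: "'x::metric_space" and b b' :: "'y::metric_space"
      unfolding dist_Pair_Pair by (rule sqrt_sum_squares_le_sum) auto
    have "dist (y, e', u, u') (x, e, p, p') \<le> dist y x + (dist e' e + (dist u p + dist u' p'))"
      using tri[of y "(e', u, u')" x "(e, p, p')"] tri[of e' "(u, u')" e "(p, p')"] tri[of u u' p p']
      by linarith
    then have "(y, e', u, u') \<in> ball (x, e, p, p') h" using d by (simp add: dist_commute)
    then have "(y, e', u, u') \<in> ?O" using h(2) by blast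
    then have GF: "0 < \<bar>mform (lift y) u * mform (lift y) u'\<bar>"
      "\<epsilon> * \<bar>mform (lift y) u * mform (lift y) u'\<bar> < \<bar>mform (dlift y e') u * mform (lift y) u' - mform (dlift y e') u' * mform (lift y) u\<bar>"
      by (auto simp: F_def G_def)
    then have b: "mform (lift y) u \<noteq> 0" "mform (lift y) u' \<noteq> 0" by auto
    have "\<epsilon> \<le> \<bar>a / b - a' / b'\<bar>" if "b \<noteq> 0" "b' \<noteq> 0" "\<epsilon> * \<bar>b * b'\<bar> < \<bar>a * b' - a' * b\<bar>" for a b a' b' :: real
    proof -
      have "\<bar>a / b - a' / b'\<bar> * \<bar>b * b'\<bar> = \<bar>a * b' - a' * b\<bar>"
      proof -
        have "(a / b - a' / b') * (b * b') = a * b' - a' * b" using that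
          by (simp add: left_diff_distrib)
        then show ?thesis unfolding abs_mult[symmetric] by simp
      qed
      then have "\<epsilon> * \<bar>b * b'\<bar> \<le> \<bar>a / b - a' / b'\<bar> * \<bar>b * b'\<bar>" using that(3) by simp
      moreover have "0 < \<bar>b * b'\<bar>" using that by simp
      ultimately show ?thesis by (rule mult_right_le_imp_le)
    qed
    then show ?thesis using b GF(2) by blast
  qed
  then have "separates (x, e) p p' (h / 4) \<epsilon>" unfolding separates_def by simp
  then show ?thesis using h(1) by (intro that[OF p p'(1) _ \<epsilon>, of "h / 4"]) auto
qed

text \<open>The conclusion of the theorem with derivatives of \<open>tau\<close> expressed by
  \<open>tgrad\<close> and distortions by \<open>bfac\<close>, and with all of
  \<open>closure \<Delta>\<close> in place of its limit points.\<close>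

definition nonintegrable_family ::
    "real \<Rightarrow> real \<Rightarrow> real \<Rightarrow> nat \<Rightarrow> nat \<Rightarrow> (nat \<Rightarrow> nat \<Rightarrow> 'd mat) \<Rightarrow> bool" where
  "nonintegrable_family r \<epsilon>0 C n0 j0 \<gamma> \<longleftrightarrow>
    (\<forall>m\<in>{1..2}. \<forall>j\<in>{1..j0}. \<gamma> m j \<in> words H n0) \<and>
    (\<forall>x e. x \<in> closure \<Delta> \<and> norm e = 1 \<longrightarrow>
      (\<exists>j\<in>{1..j0}. \<forall>y\<in>ball x r. bfac (\<gamma> 1 j) y \<noteq> 0 \<and> bfac (\<gamma> 2 j) y \<noteq> 0 \<and>
        \<epsilon>0 \<le> \<bar>(tgrad (\<gamma> 1 j) y - tgrad (\<gamma> 2 j) y) \<bullet> e\<bar>)) \<and>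
    (\<forall>m\<in>{1..2}. \<forall>j\<in>{1..j0}. \<forall>x\<in>\<Delta>. bfac (\<gamma> m j) x \<noteq> 0 \<and>
      norm (tgrad (\<gamma> m j) x) \<le> C1 / (1 - lam) \<and> 1 / bfac (\<gamma> m j) x \<le> \<epsilon>0 / C)"

text \<open>Compactness of the set of pairs of point and direction yields finitely many dual limit
  pairs, and with them \<open>r\<close> and \<open>\<epsilon>0\<close>. For all large n there are
  words of length n with poles close enough to these finitely many points, and
  \<open>lam ^ n\<close> is below \<epsilon>0 / C.\<close>

lemma uniform_nonintegrability:
  "\<exists>r>0. \<exists>\<epsilon>0>0. \<forall>C>1. \<forall>\<^sub>F n0 in sequentially. \<exists>j0 \<gamma>. nonintegrable_family r \<epsilon>0 C n0 j0 \<gamma>"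
proof -
  define K where "K = closure \<Delta> \<times> sphere (0 :: real^'d) 1"
  have cK: "compact K" unfolding K_def using bounded_Delta
    by (intro compact_Times compact_sphere) (simp add: compact_closure)
  obtain e0 :: "real^'d" where "norm e0 = 1" using vector_choose_size[of 1] by auto
  moreover obtain x0 where "x0 \<in> closure \<Delta>" using meets closure_subset by blast
  ultimately have K0: "(x0, e0) \<in> K" by (simp add: K_def)
  have "\<forall>z\<in>K. \<exists>t. fst t \<in> dual_limit \<and> fst (snd t) \<in> dual_limit \<and> 0 < fst (snd (snd t)) \<and> 0 < snd (snd (snd t)) \<and>
    separates z (fst t) (fst (snd t)) (fst (snd (snd t))) (snd (snd (snd t)))"
  proof
    fix z assume "z \<in> K"
    then have z: "fst z \<in> closure \<Delta>" "norm (snd z) = 1" by (auto simp: K_def)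
    obtain p p' d \<epsilon> where "p \<in> dual_limit" "p' \<in> dual_limit" "0 < d" "0 < \<epsilon>" "separates z p p' d \<epsilon>"
      using local_nonintegrability[OF z] by (metis prod.collapse)
    then show "\<exists>t. fst t \<in> dual_limit \<and> fst (snd t) \<in> dual_limit \<and> 0 < fst (snd (snd t)) \<and> 0 < snd (snd (snd t)) \<and>
        separates z (fst t) (fst (snd t)) (fst (snd (snd t))) (snd (snd (snd t)))"
      by (intro exI[of _ "(p, p', d, \<epsilon>)"]) simp
  qed
  then obtain t where t: "\<forall>z\<in>K. fst (t z) \<in> dual_limit \<and> fst (snd (t z)) \<in> dual_limit \<and> 0 < fst (snd (snd (t z))) \<and> 0 < snd (snd (snd (t z))) \<and>
    separates z (fst (t z)) (fst (snd (t z))) (fst (snd (snd (t z)))) (snd (snd (snd (t z))))"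
    by (rule bchoice[THEN exE])
  define p p' d \<epsilon> where "p z = fst (t z)" and "p' z = fst (snd (t z))" and "d z = fst (snd (snd (t z)))"
    and "\<epsilon> z = snd (snd (snd (t z)))" for z
  have pK: "p z \<in> dual_limit" "p' z \<in> dual_limit" "0 < d z" "0 < \<epsilon> z" "separates z (p z) (p' z) (d z) (\<epsilon> z)" if "z \<in> K" for z
    using t that unfolding p_def p'_def d_def \<epsilon>_def by blast+
  \<comment> \<open>Half of \<open>d z\<close> is kept in reserve for points \<open>y\<close> within
    \<open>r\<close> of \<open>x\<close>.\<close>
  define V where "V z = ball (fst z) (d z / 2) \<times> ball (snd z) (d z)" for z
  have Kcov: "K \<subseteq> (\<Union>z\<in>K. V z)"
  proof
    fix z assume z: "z \<in> K"
    then have "z \<in> V z" using pK(3)[OF z] by (cases z) (simp add: V_def)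
    then show "z \<in> (\<Union>z\<in>K. V z)" using z by blast
  qed
  have oV: "open (V z)" for z unfolding V_def by (intro open_Times) auto
  obtain S where S: "S \<subseteq> K" "finite S" "K \<subseteq> (\<Union>z\<in>S. V z)"
    by (rule compactE_image[OF cK oV Kcov])
  have Sne: "S \<noteq> {}" using S(3) K0 by blast
  define r where "r = Min ((\<lambda>z. d z / 2) ` S)"
  define \<epsilon>0 where "\<epsilon>0 = Min (\<epsilon> ` S)"
  have r: "r > 0" unfolding r_def using S Sne pK(3) by (subst Min_gr_iff) auto
  have \<epsilon>0: "\<epsilon>0 > 0" unfolding \<epsilon>0_def using S Sne pK(4) by (subst Min_gr_iff) auto
  have rS: "r \<le> d z / 2" "\<epsilon>0 \<le> \<epsilon> z" if "z \<in> S" for z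
    unfolding r_def \<epsilon>0_def by (intro Min_le finite_imageI S(2) imageI that)+
  have "\<forall>\<^sub>F n0 in sequentially. \<exists>j0 \<gamma>. nonintegrable_family r \<epsilon>0 C n0 j0 \<gamma>" if C: "C > 1" for C
  proof -
    have near: "eventually (\<lambda>n. \<exists>w\<in>words H n. norm (upole w - q) < \<delta>) sequentially" if "q \<in> dual_limit" "\<delta> > 0" for q \<delta>
      using that unfolding dual_limit_def eventually_sequentially by blast
    have ev1: "eventually (\<lambda>n. \<forall>z\<in>S. \<exists>w\<in>words H n. norm (upole w - p z) < d z) sequentially"
      using S(2)
    proof (rule eventually_ball_finite, intro ballI)
      fix z assume "z \<in> S"
      then have z: "z \<in> K" using S(1) by blast
      show "eventually (\<lambda>n. \<exists>w\<in>words H n. norm (upole w - p z) < d z) sequentially"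
        by (rule near[OF pK(1)[OF z] pK(3)[OF z]])
    qed
    have ev2: "eventually (\<lambda>n. \<forall>z\<in>S. \<exists>w\<in>words H n. norm (upole w - p' z) < d z) sequentially"
      using S(2)
    proof (rule eventually_ball_finite, intro ballI)
      fix z assume "z \<in> S"
      then have z: "z \<in> K" using S(1) by blast
      show "eventually (\<lambda>n. \<exists>w\<in>words H n. norm (upole w - p' z) < d z) sequentially"
        by (rule near[OF pK(2)[OF z] pK(3)[OF z]])
    qed
    have "(\<lambda>n. lam ^ n) \<longlonglongrightarrow> 0" using lam by (intro LIMSEQ_power_zero) auto
    then have ev3: "eventually (\<lambda>n. lam ^ n < \<epsilon>0 / C) sequentially"
      by (rule order_tendstoD(2)) (use \<epsilon>0 C in simp)
    show ?thesis
      using ev1 ev2 ev3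
    proof eventually_elim
      case (elim n)
      have "\<forall>z\<in>S. \<exists>w. w \<in> words H n \<and> norm (upole w - p z) < d z" using elim(1) by blast
      then obtain w where w: "\<forall>z\<in>S. w z \<in> words H n \<and> norm (upole (w z) - p z) < d z"
        by (rule bchoice[THEN exE])
      have "\<forall>z\<in>S. \<exists>w. w \<in> words H n \<and> norm (upole w - p' z) < d z" using elim(2) by blast
      then obtain w' where w': "\<forall>z\<in>S. w' z \<in> words H n \<and> norm (upole (w' z) - p' z) < d z"
        by (rule bchoice[THEN exE])
      \<comment> \<open>The pairs are indexed by the finite subcover, so \<open>j0\<close> is its
        cardinality, independent of n.\<close>
      obtain h where h: "bij_betw h {1..card S} S" using ex_bij_betw_nat_finite_1[OF S(2)] by blast
      define \<gamma> where "\<gamma> m j = (if m = (1::nat) then w (h j) else w' (h j))" for m j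
      have hS: "h j \<in> S" if "j \<in> {1..card S}" for j using bij_betwE[OF h] that by blast
      have gw: "\<gamma> m j \<in> words H n" if "j \<in> {1..card S}" for m j
        using hS[OF that] w w' by (simp add: \<gamma>_def)
      have "nonintegrable_family r \<epsilon>0 C n (card S) \<gamma>"
        unfolding nonintegrable_family_def
      proof (intro conjI ballI allI impI)
        fix m j :: nat assume "m \<in> {1..2}" and j: "j \<in> {1..card S}"
        show "\<gamma> m j \<in> words H n" by (rule gw[OF j])
        fix x assume x: "x \<in> \<Delta>"
        show "bfac (\<gamma> m j) x \<noteq> 0" using words_bfac_pos[OF gw[OF j] x, of m] by simp
        show "norm (tgrad (\<gamma> m j) x) \<le> C1 / (1 - lam)" by (rule words_tgrad_bound[OF gw[OF j] x])
        have "rho ^ n \<le> bfac (\<gamma> m j) x" using words_maps[OF gw[OF j] x] by blast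
        then have "1 / bfac (\<gamma> m j) x \<le> 1 / rho ^ n" using lam
          by (intro divide_left_mono mult_pos_pos) (auto intro: words_bfac_pos[OF gw[OF j] x])
        then show "1 / bfac (\<gamma> m j) x \<le> \<epsilon>0 / C" using elim(3) by (simp add: inv_power_lam)
      next
        fix x e :: "real^'d" assume xe: "x \<in> closure \<Delta> \<and> norm e = 1"
        then have "(x, e) \<in> K" by (simp add: K_def)
        then obtain z where z: "z \<in> S" "(x, e) \<in> V z" using S(3) by blast
        then have zK: "z \<in> K" using S(1) by blast
        obtain j where j: "j \<in> {1..card S}" "h j = z"
          using h z(1) by (metis bij_betw_imp_surj_on imageE)
        show "\<exists>j\<in>{1..card S}. \<forall>y\<in>ball x r. bfac (\<gamma> 1 j) y \<noteq> 0 \<and> bfac (\<gamma> 2 j) y \<noteq> 0 \<and>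
            \<epsilon>0 \<le> \<bar>(tgrad (\<gamma> 1 j) y - tgrad (\<gamma> 2 j) y) \<bullet> e\<bar>"
        proof (rule bexI[OF _ j(1)], rule ballI)
          fix y assume y: "y \<in> ball x r"
          have g: "\<gamma> 1 j = w z" "\<gamma> 2 j = w' z" using j(2) by (simp_all add: \<gamma>_def)
          have w0: "w z \<in> carrier SO0" "w' z \<in> carrier SO0" using w w' z(1) words_SO0 by blast+
          have "dist y (fst z) \<le> dist y x + dist x (fst z)" by (rule dist_triangle)
          then have "dist y (fst z) < d z" using y z(2) rS(1)[OF z(1)]
            by (simp add: V_def dist_commute)
          moreover have "dist e (snd z) < d z" using z(2) by (simp add: V_def dist_commute)
          moreover have "dist (upole (w z)) (p z) < d z" "dist (upole (w' z)) (p' z) < d z"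
            using w w' z(1) by (simp_all add: dist_norm)
          ultimately have s: "mform (lift y) (upole (w z)) \<noteq> 0 \<and> mform (lift y) (upole (w' z)) \<noteq> 0 \<and>
            \<epsilon> z \<le> \<bar>tgrad (w z) y \<bullet> e - tgrad (w' z) y \<bullet> e\<bar>"
            using pK(5)[OF zK] unfolding separates_def tgrad_inner_upole[OF w0(1)] tgrad_inner_upole[OF w0(2)]
            by simp
          show "bfac (\<gamma> 1 j) y \<noteq> 0 \<and> bfac (\<gamma> 2 j) y \<noteq> 0 \<and> \<epsilon>0 \<le> \<bar>(tgrad (\<gamma> 1 j) y - tgrad (\<gamma> 2 j) y) \<bullet> e\<bar>"
            unfolding g bfac_upole[OF w0(1)] bfac_upole[OF w0(2)]
            using s rS(2)[OF z(1)] pole_null(2)[OF w0(1)] pole_null(2)[OF w0(2)]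
            by (simp add: inner_diff_left)
        qed
      qed
      then show ?case by blast
    qed
  qed
  then show ?thesis using r \<epsilon>0 by blast
qed

end

section \<open>The coding of the cusped group\<close>

text \<open>By \<open>emap_dist\<close> the conformal factors at any two fixed points have product
  1; three fixed points force them to be 1. Then \<open>g\<close> fixes the lifts of an open set,
  and these span.\<close>

lemma bact_fixes_open_imp_one:
  assumes g: "g \<in> carrier SO0" and V: "open V" "V \<noteq> {}"
    and fixed: "\<And>x. x \<in> V \<Longrightarrow> bact g (Some x) = Some x"
  shows "g = mat 1"
proof -
  have b: "bfac g x \<noteq> 0" "emap g x = x" if "x \<in> V" for x
    using bact_SomeD[OF fixed[OF that]] by simp_all
  have pos: "bfac g x > 0" if "x \<in> V" for x using b(1)[OF that] bfac_nonneg[OF g, of x] by simp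
  have prod1: "bfac g x * bfac g y = 1" if "x \<in> V" "y \<in> V" "x \<noteq> y" for x y
  proof -
    have "(norm (x - y))\<^sup>2 = (norm (x - y))\<^sup>2 / (bfac g x * bfac g y)"
      using emap_dist[OF g b(1) b(1), of x y] that b(2) by simp
    moreover have "(norm (x - y))\<^sup>2 \<noteq> 0" using that by simp
    moreover have "bfac g x * bfac g y \<noteq> 0" using b(1) that by simp
    ultimately show ?thesis by (simp add: field_simps)
  qed
  have inf: "infinite V" using V finite_imp_not_open by blast
  have b1: "bfac g x = 1" if x: "x \<in> V" for x
  proof -
    have "infinite (V - {x})" using inf by simp
    then obtain y where y: "y \<in> V" "y \<noteq> x" by (metis DiffE ex_in_conv finite.emptyI insertI1)
    have "infinite (V - {x} - {y})" using inf by simp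
    then obtain z where z: "z \<in> V" "z \<noteq> x" "z \<noteq> y"
      by (metis DiffE ex_in_conv finite.emptyI insertI1)
    have "bfac g x * bfac g y = 1" "bfac g x * bfac g z = 1" "bfac g y * bfac g z = 1"
      using prod1 x y z by metis+
    then have "bfac g y = bfac g z" by (metis mult_cancel_left mult_zero_left zero_neq_one)
    then have "bfac g y * bfac g y = 1" using \<open>bfac g y * bfac g z = 1\<close> by simp
    then have "bfac g y = 1" using pos[OF y(1)] by (simp add: square_eq_1_iff)
    then show ?thesis using \<open>bfac g x * bfac g y = 1\<close> by simp
  qed
  have gl: "g *v lift x = lift x" if "x \<in> V" for x
    using emap_lift[OF g b(1)[OF that]] b(2)[OF that] b1[OF that] by simp
  have "matrix_inv g *v v = v" for v
  proof -
    have "matrix_inv g *v v - v = 0"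
    proof (rule mform_lift_zero_on_open[OF V])
      fix y assume "y \<in> V"
      have "mform (lift y) (matrix_inv g *v v) = mform (lift y) v"
        using SO0_mform_inv[OF g, of "lift y" v] gl[OF \<open>y \<in> V\<close>] by simp
      then show "mform (matrix_inv g *v v - v) (lift y) = 0"
        by (simp add: mform_linear mform_sym[of _ "lift y"])
    qed
    then show ?thesis by simp
  qed
  then have "g *v v = v" for v using SO0_inv_cancel(4)[OF g, of v] by simp
  then show ?thesis by (simp add: matrix_eq)
qed

lemma conj_set_one: "conj_set (mat 1) \<Gamma> = (\<Gamma> :: 'd::finite mat set)"
proof -
  have "matrix_inv (mat 1) = (mat 1 :: 'd mat)" using SO0_inv_cancel(1)[OF SO0_one, where 'a = 'd]
    by simp
  then show ?thesis by (simp add: conj_set_def)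
qed

lemma Delta_one:
  assumes "cusp_setup \<Gamma> D"
  shows "Delta D 1 = Some ` cyl (flat D 1) (width D 1) (ptope D 1)"
proof -
  have "gmap D 1 = mat 1" using assms by (simp add: cusp_setup_def)
  moreover have "matrix_inv (mat 1) = (mat 1 :: 'a mat)"
    using SO0_inv_cancel(1)[OF SO0_one, where 'a = 'a] by simp
  ultimately show ?thesis by (simp add: Delta_def image_image)
qed

lemma cusp_setup_one:
  assumes "cusp_setup \<Gamma> D"
  obtains a E where "affine (flat D 1)" "parallelotope_in (flat D 1) a E" "ptope D 1 = parallelotope a E"
    "0 < width D 1" "lat D 1 \<subseteq> \<Gamma>"
    "limit_set \<Gamma> \<subseteq> insert None
          (\<Union>\<gamma>\<in>lat D 1. bact \<gamma> ` Some ` closure (cyl (flat D 1) (width D 1 / 2) (ptope D 1)))"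
proof -
  have g1: "gmap D 1 = mat 1" and n1: "1 \<in> {1..ncusps D}" using assms
    by (simp_all add: cusp_setup_def)
  have "\<forall>i\<in>{1..ncusps D}. let \<Gamma>\<^sub>i = conj_set (gmap D i) \<Gamma> in
        bieberbach \<Gamma>\<^sub>i (lat D i) (flat D i) \<and>
        fund_parallelotope (lat D i) (flat D i) (ptope D i) \<and> 0 < width D i \<and>
        limit_set \<Gamma>\<^sub>i \<subseteq> insert None
          (\<Union>\<gamma>\<in>lat D i. bact \<gamma> ` Some ` closure (cyl (flat D i) (width D i / 2) (ptope D i)))"
    using assms unfolding cusp_setup_def by blast
  from bspec[OF this n1] have c: "bieberbach \<Gamma> (lat D 1) (flat D 1)"
    "fund_parallelotope (lat D 1) (flat D 1) (ptope D 1)" "0 < width D 1"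
    "limit_set \<Gamma> \<subseteq> insert None
          (\<Union>\<gamma>\<in>lat D 1. bact \<gamma> ` Some ` closure (cyl (flat D 1) (width D 1 / 2) (ptope D 1)))"
    unfolding Let_def g1 conj_set_one by blast+
  obtain a E where aE: "parallelotope_in (flat D 1) a E" "ptope D 1 = parallelotope a E"
    using c(2) unfolding fund_parallelotope_def by (elim conjE exE)
  have "affine (flat D 1)" using c(1) by (simp add: bieberbach_def Let_def)
  moreover have "lat D 1 \<subseteq> \<Gamma>"
  proof -
    have "lat D 1 \<lhd> SO0\<lparr>carrier := stab \<Gamma> None\<rparr>"
      using c(1) by (simp add: bieberbach_def Let_def abelian_normal_def)
    then have "subgroup (lat D 1) (SO0\<lparr>carrier := stab \<Gamma> None\<rparr>)" by (rule normal_imp_subgroup)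
    then have "lat D 1 \<subseteq> stab \<Gamma> None" using subgroup.subset by fastforce
    then show ?thesis by (auto simp: stab_def)
  qed
  ultimately show ?thesis using that[OF _ aE c(3)] c(4) by blast
qed

lemma frechet_tau:
  assumes g: "g \<in> carrier SO0" and x: "bfac g x \<noteq> 0"
  shows "tau g differentiable (at x)" "onorm (frechet_derivative (tau g) (at x)) = norm (tgrad g x)"
    "onorm (frechet_derivative (\<lambda>y. ln (lin_dist (bact g) y)) (at x)) = norm (tgrad g x)"
proof -
  note d = has_derivative_tau[OF g x]
  show "tau g differentiable (at x)" using d by (auto simp: differentiable_def)
  show "onorm (frechet_derivative (tau g) (at x)) = norm (tgrad g x)"
    using frechet_derivative_at[OF d, symmetric] by (simp add: onorm_inner)
  have "((\<lambda>y. - tau g y) has_derivative (\<lambda>e. - (tgrad g x \<bullet> e))) (at x)"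
    by (rule has_derivative_minus[OF d])
  moreover have "(\<lambda>y. - tau g y) = (\<lambda>y. ln (lin_dist (bact g) y))" by (simp add: tau_def)
  ultimately have "frechet_derivative (\<lambda>y. ln (lin_dist (bact g) y)) (at x) = (\<lambda>e. - (tgrad g x \<bullet> e))"
    using frechet_derivative_at by metis
  then show "onorm (frechet_derivative (\<lambda>y. ln (lin_dist (bact g) y)) (at x)) = norm (tgrad g x)"
    by (simp add: onorm_neg onorm_inner)
qed

lemma tau_directional_derivative:
  assumes g: "g \<in> carrier SO0" and y: "bfac g y \<noteq> 0"
  shows "((\<lambda>s. tau g (y + s *\<^sub>R e)) has_real_derivative (tgrad g y \<bullet> e)) (at 0)"
proof -
  have line: "((\<lambda>s. y + s *\<^sub>R e) has_derivative (\<lambda>s. s *\<^sub>R e)) (at (0::real))"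
    by (auto intro!: derivative_eq_intros)
  have "(tau g has_derivative (\<lambda>e. tgrad g y \<bullet> e)) (at (y + 0 *\<^sub>R e))"
    using has_derivative_tau[OF g y] by simp
  from has_derivative_compose[OF line this]
  have "((\<lambda>s. tau g (y + s *\<^sub>R e)) has_derivative (\<lambda>s. tgrad g y \<bullet> (s *\<^sub>R e))) (at 0)" .
  moreover have "(\<lambda>s. tgrad g y \<bullet> (s *\<^sub>R e)) = (*) (tgrad g y \<bullet> e)"
    by (simp add: fun_eq_iff mult.commute)
  ultimately show ?thesis by (simp add: has_field_derivative_def)
qed

text \<open>On an overlap both inverses agree with \<open>T_map\<close>, so
  \<open>\<gamma>' ** matrix_inv \<gamma>\<close> fixes an open set. Disjointness is what turns the
  sum of measures in \<open>coding_constants\<close> into the measure of a union.\<close>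

lemma inverse_branches_disjoint:
  assumes \<Gamma>: "subgroup \<Gamma> SO0" and \<Delta>: "Delta D 1 = Some ` \<Delta>" "open \<Delta>"
    and g: "\<gamma> \<in> inverse_branches \<Gamma> D \<eta> gam" "\<gamma>' \<in> inverse_branches \<Gamma> D \<eta> gam" "\<gamma> \<noteq> \<gamma>'"
  shows "bact \<gamma> ` Delta D 1 \<inter> bact \<gamma>' ` Delta D 1 = {}"
proof (rule ccontr)
  assume ne: "bact \<gamma> ` Delta D 1 \<inter> bact \<gamma>' ` Delta D 1 \<noteq> {}"
  note G = subgroup_SO0D[OF \<Gamma>]
  have gG: "\<gamma> \<in> \<Gamma>" "\<gamma>' \<in> \<Gamma>" using g by (auto simp: inverse_branches_def)
  then have g0: "\<gamma> \<in> carrier SO0" "\<gamma>' \<in> carrier SO0" using G(1) by blast+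
  define U where "U = bact \<gamma> ` Delta D 1 \<inter> bact \<gamma>' ` Delta D 1"
  obtain W where W: "open W" "Delta D 1 = {\<xi>. ray \<xi> \<in> W}"
    using openin_bdry_obtain[OF openin_bdry_Some[OF \<Delta>(2)]] \<Delta>(1) by metis
  have "openin bdry_top (bact g ` Delta D 1)" if "g \<in> carrier SO0" for g
    unfolding bact_image[OF that] W(2) bact_vimage[OF SO0_inv[OF that]]
    by (rule openin_ray[OF open_act_preimage[OF W(1)]])
  then have "openin bdry_top U" unfolding U_def using g0 by (intro openin_Int) auto
  then obtain W' where W': "open W'" "U = {\<xi>. ray \<xi> \<in> W'}" using openin_bdry_obtain by blast
  have Usub: "U \<subseteq> Some ` \<Delta>"
    using g(1) unfolding U_def inverse_branches_def dom_T_def \<Delta>(1) by blast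
  define V where "V = {x. Some x \<in> U}"
  have "open V"
  proof -
    have "open {x :: real^'a. Some x \<in> U}"
    proof -
      have "continuous_map euclidean bdry_top (Some :: real^'a \<Rightarrow> _)"
        unfolding bdry_top_def by (rule continuous_map_Some)
      then have "openin euclidean {x \<in> topspace euclidean. (Some :: real^'a \<Rightarrow> _) x \<in> U}"
        using \<open>openin bdry_top U\<close> by (rule openin_continuous_map_preimage)
      then show ?thesis by simp
    qed
    then show ?thesis by (simp add: V_def)
  qed
  moreover have "V \<noteq> {}" using ne Usub unfolding V_def U_def[symmetric] by blast
  moreover have "bact (\<gamma>' ** matrix_inv \<gamma>) (Some x) = Some x" if "x \<in> V" for x
  proof -
    have x: "Some x \<in> bact \<gamma> ` Delta D 1" "Some x \<in> bact \<gamma>' ` Delta D 1" using that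
      by (auto simp: V_def U_def)
    then have "bact (matrix_inv \<gamma>) (Some x) = bact (matrix_inv \<gamma>') (Some x)"
      using g(1,2) unfolding inverse_branches_def by (metis (mono_tags, lifting) mem_Collect_eq)
    then have "bact \<gamma>' (bact (matrix_inv \<gamma>) (Some x)) = Some x" by (simp add: bact_inv[OF g0(2)])
    then show ?thesis by (simp add: bact_mult[OF g0(2) SO0_inv[OF g0(1)]])
  qed
  ultimately have "\<gamma>' ** matrix_inv \<gamma> = mat 1"
    by (rule bact_fixes_open_imp_one[OF SO0_mult[OF g0(2) SO0_inv[OF g0(1)]]])
  then have "\<gamma>' ** (matrix_inv \<gamma> ** \<gamma>) = \<gamma>" by (simp add: matrix_mul_assoc)
  then show False using g(3) by (simp add: SO0_inv_cancel[OF g0(1)])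
qed

lemma coding_inverse_branches:
  fixes \<Gamma> :: "'d::finite mat set" and D :: "'d cusp_data" and \<nu> :: "'d hpt \<Rightarrow> 'd bdry measure"
  assumes \<Gamma>: "subgroup \<Gamma> SO0" and zd: "zariski_dense \<Gamma>" and gf: "geometrically_finite \<Gamma>"
    and ps: "ps_density \<Gamma> \<nu>" and cs: "cusp_setup \<Gamma> D"
    and cc: "coding_constants \<Gamma> D (\<nu> base_pt) \<eta> gam C1 lam eps_o"
  shows "coding \<Gamma> \<nu> (cyl (flat D 1) (width D 1) (ptope D 1)) (inverse_branches \<Gamma> D \<eta> gam) C1 lam"
proof -
  interpret ps_group \<Gamma> \<nu> by (rule ps_group.intro) (rule \<Gamma> zd ps)+
  obtain a E where cusp: "affine (flat D 1)" "parallelotope_in (flat D 1) a E" "ptope D 1 = parallelotope a E"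
    "0 < width D 1" "lat D 1 \<subseteq> \<Gamma>"
    "limit_set \<Gamma> \<subseteq> insert None
          (\<Union>\<gamma>\<in>lat D 1. bact \<gamma> ` Some ` closure (cyl (flat D 1) (width D 1 / 2) (ptope D 1)))"
    using cusp_setup_one[OF cs] .
  define \<Delta> where "\<Delta> = cyl (flat D 1) (width D 1) (ptope D 1)"
  define H where "H = inverse_branches \<Gamma> D \<eta> gam"
  have D1: "Delta D 1 = Some ` \<Delta>" unfolding \<Delta>_def by (rule Delta_one[OF cs])
  have disc: "discrete \<Gamma>" using gf by (simp add: geometrically_finite_def)
  have oD: "open \<Delta>" unfolding \<Delta>_def cusp(3) by (rule open_cyl_parallelotope[OF cusp(1,2)])
  have HG: "H \<subseteq> \<Gamma>" by (auto simp: H_def inverse_branches_def)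
  have H0: "\<gamma> \<in> carrier SO0" if "\<gamma> \<in> H" for \<gamma> using that HG grp(1) by blast
  have Hsub: "bact \<gamma> ` Delta D 1 \<subseteq> Delta D 1" if "\<gamma> \<in> H" for \<gamma>
    using that unfolding H_def inverse_branches_def dom_T_def by blast
  have maps: "bfac \<gamma> x \<noteq> 0 \<and> emap \<gamma> x \<in> \<Delta>" if "\<gamma> \<in> H" "x \<in> \<Delta>" for \<gamma> x
  proof -
    have "bact \<gamma> (Some x) \<in> Some ` \<Delta>" using Hsub[OF that(1)] that(2) unfolding D1 by blast
    then obtain y where "bact \<gamma> (Some x) = Some y" "y \<in> \<Delta>" by blast
    then show ?thesis using bact_SomeD by blast
  qed
  have cc': "0 < C1" "0 < lam" "lam < 1"
    "((\<lambda>\<gamma>. measure \<mu> (bact \<gamma> ` Delta D 1)) has_sum measure \<mu> (Delta D 1)) H"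
    "\<forall>\<gamma>\<in>H. \<forall>x. Some x \<in> Delta D 1 \<longrightarrow> lin_dist (bact \<gamma>) x \<le> lam \<and>
        onorm (frechet_derivative (\<lambda>y. ln (lin_dist (bact \<gamma>) y)) (at x)) < C1"
    using cc unfolding coding_constants_def H_def Let_def by blast+
  have "coding \<Gamma> \<nu> \<Delta> H C1 lam"
  proof
    show "open \<Delta>" by (rule oD)
    show "bounded \<Delta>" unfolding \<Delta>_def cusp(3) by (rule bounded_cyl_parallelotope[OF cusp(1,2)])
    show "\<exists>x\<in>\<Delta>. ray (Some x) \<in> limit_rays \<Gamma>"
      unfolding \<Delta>_def cusp(3)
      by (rule limit_rays_meets_region[OF disc cusp(5,1,2,4)]) (rule cusp(6)[unfolded cusp(3)])
    show "discrete \<Gamma>" by (rule disc)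
    show "H \<subseteq> \<Gamma>" by (rule HG)
    show "bfac \<gamma> x \<noteq> 0 \<and> emap \<gamma> x \<in> \<Delta>" if "\<gamma> \<in> H" "x \<in> \<Delta>" for \<gamma> x by (rule maps[OF that])
    show "0 < lam" "lam < 1" "0 < C1" by (rule cc')+
    show "1 / lam \<le> bfac \<gamma> x" if "\<gamma> \<in> H" "x \<in> \<Delta>" for \<gamma> x
    proof -
      have nz: "bfac \<gamma> x \<noteq> 0" using maps[OF that] by blast
      have "bfac \<gamma> x > 0" using nz bfac_nonneg[OF H0[OF that(1)], of x] by simp
      moreover have "1 / bfac \<gamma> x \<le> lam"
      proof -
        have "lin_dist (bact \<gamma>) x \<le> lam" using cc'(5) that unfolding D1 by blast
        then show ?thesis unfolding lin_dist_bact[OF H0[OF that(1)] nz] .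
      qed
      ultimately show ?thesis using cc'(2) by (simp add: field_simps)
    qed
    show "norm (tgrad \<gamma> x) \<le> C1" if "\<gamma> \<in> H" "x \<in> \<Delta>" for \<gamma> x
    proof -
      have nz: "bfac \<gamma> x \<noteq> 0" using maps[OF that] by blast
      have "onorm (frechet_derivative (\<lambda>y. ln (lin_dist (bact \<gamma>) y)) (at x)) < C1"
        using cc'(5) that unfolding D1 by blast
      then show ?thesis unfolding frechet_tau(3)[OF H0[OF that(1)] nz] by simp
    qed
    show "emeasure \<mu> (Some ` \<Delta> - (\<Union>\<gamma>\<in>H. bact \<gamma> ` Some ` \<Delta>)) = 0"
    proof -
      interpret fm: finite_measure \<mu> by (rule finite_mu)
      let ?A = "\<lambda>\<gamma>. bact \<gamma> ` Delta D 1"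
      have Ds: "Delta D 1 \<in> sets \<mu>" unfolding D1 by (simp add: sets_mu openin_bdry_Some oD)
      have As: "?A \<gamma> \<in> sets \<mu>" if "\<gamma> \<in> H" for \<gamma>
        by (rule bact_image_sets[OF H0[OF that] Ds])
      have cH: "countable H" using countable_discrete[OF disc] HG countable_subset by blast
      have Us: "(\<Union>\<gamma>\<in>H. ?A \<gamma>) \<in> sets \<mu>" by (rule sets.countable_UN''[OF cH As])
      \<comment> \<open>Finite partial sums are measures of disjoint unions inside the full union,
        so their limit, the measure of \<open>Delta D 1\<close>, does not exceed its
        measure.\<close>
      have "measure \<mu> (Delta D 1) \<le> measure \<mu> (\<Union>\<gamma>\<in>H. ?A \<gamma>)"
      proof (rule has_sum_le_finite_sums[OF cc'(4)])
        fix F assume F: "finite F" "F \<subseteq> H"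
        have dis: "disjoint_family_on ?A F"
          unfolding disjoint_family_on_def
        proof (intro ballI impI)
          fix \<gamma> \<gamma>' assume "\<gamma> \<in> F" "\<gamma>' \<in> F" "\<gamma> \<noteq> \<gamma>'"
          then show "?A \<gamma> \<inter> ?A \<gamma>' = {}"
            using inverse_branches_disjoint[OF \<Gamma> D1 oD] F(2) unfolding H_def by blast
        qed
        have AF: "?A ` F \<subseteq> sets \<mu>" using As F(2) by blast
        have "sum (\<lambda>\<gamma>. measure \<mu> (?A \<gamma>)) F = measure \<mu> (\<Union>\<gamma>\<in>F. ?A \<gamma>)"
          using fm.finite_measure_finite_Union[OF F(1) AF dis] by simp
        also have "\<dots> \<le> measure \<mu> (\<Union>\<gamma>\<in>H. ?A \<gamma>)"
          by (rule fm.finite_measure_mono[OF UN_mono[OF F(2)] Us]) simp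
        finally show "sum (\<lambda>\<gamma>. measure \<mu> (?A \<gamma>)) F \<le> measure \<mu> (\<Union>\<gamma>\<in>H. ?A \<gamma>)" .
      qed
      moreover have "(\<Union>\<gamma>\<in>H. ?A \<gamma>) \<subseteq> Delta D 1" using Hsub by blast
      ultimately have "measure \<mu> (Delta D 1 - (\<Union>\<gamma>\<in>H. ?A \<gamma>)) \<le> 0"
        using fm.finite_measure_Diff[OF Ds Us] by simp
      then have "measure \<mu> (Delta D 1 - (\<Union>\<gamma>\<in>H. ?A \<gamma>)) = 0"
        using measure_nonneg[of \<mu> "Delta D 1 - (\<Union>\<gamma>\<in>H. ?A \<gamma>)"] by linarith
      then show ?thesis unfolding D1 by (simp add: fm.emeasure_eq_measure)
    qed
  qed
  then show ?thesis by (simp only: \<Delta>_def H_def)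
qed

theorem lemma4p5:
  fixes \<Gamma> :: "'d::finite mat set"
    and D :: "'d cusp_data"
    and \<nu> :: "'d hpt \<Rightarrow> 'd bdry measure"
  assumes "subgroup \<Gamma> SO0"
    and "zariski_dense \<Gamma>"
    and "torsion_free \<Gamma>"
    and "geometrically_finite \<Gamma>"
    and "None \<in> parabolic_points \<Gamma>"
    and "ps_density \<Gamma> \<nu>"
    and "cusp_setup \<Gamma> D"
  shows "\<exists>\<eta>0. 0 < \<eta>0 \<and> \<eta>0 < 1 \<and> (\<forall>\<eta> gam C1 lam eps_o.
    0 < \<eta> \<and> \<eta> < \<eta>0 \<and>
    flower_choice \<Gamma> D gam \<and>
    T0_irreducible \<Gamma> D \<eta> gam \<and>
    coding_constants \<Gamma> D (\<nu> base_pt) \<eta> gam C1 lam eps_o \<longrightarrow>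
    (\<exists>r>0. \<exists>\<epsilon>0>0. \<forall>C>1. \<forall>\<^sub>F n0 in sequentially.
      \<exists>(j0::nat) (\<gamma> :: nat \<Rightarrow> nat \<Rightarrow> 'd mat).
        (\<forall>m\<in>{1..2}. \<forall>j\<in>{1..j0}. \<gamma> m j \<in> words (inverse_branches \<Gamma> D \<eta> gam) n0) \<and>
        (\<forall>x e. Some x \<in> limit_set \<Gamma> \<inter> bdry_top closure_of Delta D 1 \<and> norm e = 1 \<longrightarrow>
          (\<exists>j\<in>{1..j0}. \<forall>y\<in>ball x r. \<exists>c.
            ((\<lambda>s. tau (\<gamma> 1 j) (y + s *\<^sub>R e) - tau (\<gamma> 2 j) (y + s *\<^sub>R e)) has_real_derivative c) (at 0) \<and>
            \<bar>c\<bar> \<ge> \<epsilon>0)) \<and>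
        (\<forall>m\<in>{1..2}. \<forall>j\<in>{1..j0}. \<forall>x. Some x \<in> Delta D 1 \<longrightarrow>
          tau (\<gamma> m j) differentiable (at x) \<and>
          onorm (frechet_derivative (tau (\<gamma> m j)) (at x)) \<le> C1 / (1 - lam) \<and>
          lin_dist (bact (\<gamma> m j)) x \<le> \<epsilon>0 / C)))"
\<comment> \<open>The witness 1/2 is an arbitrary element of (0, 1).\<close>
proof (rule exI[of _ "1/2"], intro conjI allI impI, goal_cases)
  case (3 \<eta> gam C1 lam eps_o)
  define \<Delta> where "\<Delta> = cyl (flat D 1) (width D 1) (ptope D 1)"
  define H where "H = inverse_branches \<Gamma> D \<eta> gam"
  interpret coding \<Gamma> \<nu> \<Delta> H C1 lam
    unfolding \<Delta>_def H_def using 3 by (intro coding_inverse_branches assms) blast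
  have D1: "Delta D 1 = Some ` \<Delta>" unfolding \<Delta>_def by (rule Delta_one[OF assms(7)])
  obtain r \<epsilon>0 where r: "r > 0" and \<epsilon>0: "\<epsilon>0 > 0" and
    uni: "\<And>C. C > 1 \<Longrightarrow> \<forall>\<^sub>F n0 in sequentially. \<exists>j0 \<gamma>. nonintegrable_family r \<epsilon>0 C n0 j0 \<gamma>"
    using uniform_nonintegrability by blast
  show ?case
  proof (rule exI[of _ r], rule conjI[OF r], rule exI[of _ \<epsilon>0], rule conjI[OF \<epsilon>0], intro allI impI,
      rule eventually_mono[OF uni], assumption, elim exE, goal_cases)
    case (1 C n0 j0 \<gamma>)
    then have w: "\<forall>m\<in>{1..2}. \<forall>j\<in>{1..j0}. \<gamma> m j \<in> words H n0" and
      sep: "\<forall>x e. x \<in> closure \<Delta> \<and> norm e = 1 \<longrightarrow>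
        (\<exists>j\<in>{1..j0}. \<forall>y\<in>ball x r. bfac (\<gamma> 1 j) y \<noteq> 0 \<and> bfac (\<gamma> 2 j) y \<noteq> 0 \<and>
          \<epsilon>0 \<le> \<bar>(tgrad (\<gamma> 1 j) y - tgrad (\<gamma> 2 j) y) \<bullet> e\<bar>)" and
      bd: "\<forall>m\<in>{1..2}. \<forall>j\<in>{1..j0}. \<forall>x\<in>\<Delta>. bfac (\<gamma> m j) x \<noteq> 0 \<and>
        norm (tgrad (\<gamma> m j) x) \<le> C1 / (1 - lam) \<and> 1 / bfac (\<gamma> m j) x \<le> \<epsilon>0 / C"
      unfolding nonintegrable_family_def by blast+
    have w0: "\<gamma> m j \<in> carrier SO0" if "m \<in> {1..2}" "j \<in> {1..j0}" for m j
      using w that words_SO0 by blast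
    show ?case
    proof (intro exI[of _ j0] exI[of _ \<gamma>] conjI ballI allI impI)
      fix m j :: nat assume mj: "m \<in> {1..2}" "j \<in> {1..j0}"
      show "\<gamma> m j \<in> words (inverse_branches \<Gamma> D \<eta> gam) n0" using w mj by (simp add: H_def)
      fix x assume "Some x \<in> Delta D 1"
      then have "x \<in> \<Delta>" unfolding D1 by blast
      then have b: "bfac (\<gamma> m j) x \<noteq> 0" "norm (tgrad (\<gamma> m j) x) \<le> C1 / (1 - lam)"
        "1 / bfac (\<gamma> m j) x \<le> \<epsilon>0 / C" using bd mj by blast+
      show "tau (\<gamma> m j) differentiable (at x)" by (rule frechet_tau(1)[OF w0[OF mj] b(1)])
      show "onorm (frechet_derivative (tau (\<gamma> m j)) (at x)) \<le> C1 / (1 - lam)"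
        unfolding frechet_tau(2)[OF w0[OF mj] b(1)] by (rule b(2))
      show "lin_dist (bact (\<gamma> m j)) x \<le> \<epsilon>0 / C"
        unfolding lin_dist_bact[OF w0[OF mj] b(1)] by (rule b(3))
    next
      fix x e :: "real^'d" assume xe: "Some x \<in> limit_set \<Gamma> \<inter> bdry_top closure_of Delta D 1 \<and> norm e = 1"
      then have "x \<in> closure \<Delta>" unfolding D1 using closure_of_Some by blast
      then obtain j where j: "j \<in> {1..j0}" "\<forall>y\<in>ball x r. bfac (\<gamma> 1 j) y \<noteq> 0 \<and> bfac (\<gamma> 2 j) y \<noteq> 0 \<and>
          \<epsilon>0 \<le> \<bar>(tgrad (\<gamma> 1 j) y - tgrad (\<gamma> 2 j) y) \<bullet> e\<bar>"
        using sep xe by blast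
      show "\<exists>j\<in>{1..j0}. \<forall>y\<in>ball x r. \<exists>c.
          ((\<lambda>s. tau (\<gamma> 1 j) (y + s *\<^sub>R e) - tau (\<gamma> 2 j) (y + s *\<^sub>R e)) has_real_derivative c) (at 0) \<and>
          \<bar>c\<bar> \<ge> \<epsilon>0"
      proof (rule bexI[OF _ j(1)], rule ballI)
        fix y assume "y \<in> ball x r"
        then have y: "bfac (\<gamma> 1 j) y \<noteq> 0" "bfac (\<gamma> 2 j) y \<noteq> 0"
          "\<epsilon>0 \<le> \<bar>(tgrad (\<gamma> 1 j) y - tgrad (\<gamma> 2 j) y) \<bullet> e\<bar>" using j(2) by blast+
        have "((\<lambda>s. tau (\<gamma> 1 j) (y + s *\<^sub>R e) - tau (\<gamma> 2 j) (y + s *\<^sub>R e))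
            has_real_derivative (tgrad (\<gamma> 1 j) y \<bullet> e - tgrad (\<gamma> 2 j) y \<bullet> e)) (at 0)"
          by (intro DERIV_diff tau_directional_derivative w0 y j(1)) auto
        then show "\<exists>c. ((\<lambda>s. tau (\<gamma> 1 j) (y + s *\<^sub>R e) - tau (\<gamma> 2 j) (y + s *\<^sub>R e)) has_real_derivative c) (at 0) \<and>
          \<bar>c\<bar> \<ge> \<epsilon>0"
          using y(3) by (intro exI[of _ "tgrad (\<gamma> 1 j) y \<bullet> e - tgrad (\<gamma> 2 j) y \<bullet> e"]) (simp add: inner_diff_left)
      qed
    qed
  qed
qed simp_all

end
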